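(* In the setting described in the context (with assumptions (A1) and (A2) on $\lambda$), let $(X,Y,N)$ be the unique strong solution of $$X_t=X_0+\int_{0+}^t\int_{\mathbb{R}}h_\Lambda(X_{u-},Y_{u-},N_{u-},v)\,\wp(du,dv),$$ $$Y_t=Y_0+t-\int_{0+}^t Y_{u-}\int_{\mathbb{R}}g_\Lambda(X_{u-},Y_{u-},N_{u-},v)\,\wp(du,dv),$$ $$N_t=\int_{0+}^t\int_{\mathbb{R}}g_\Lambda(X_{u-},Y_{u-},N_{u-},v)\,\wp(du,dv),$$ so that $X$ is a semi-Markov process, and let $T_1<T_2<\cdots$ be the successive jump times of $X$. Then the associated kernel is given, for every $y>0$, $n\ge1$ and $i\ne j$ in $\mathcal{X}$, by $$Q_{ij}(y,n):=P[X_{T_{n+1}}=j,\,T_{n+1}-T_n\le y\mid X_{T_n}=i]=\int_0^y e^{-\gamma_i(s,n)}\lambda_{ij}(s,n)\,ds.$$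
   Context: Setting. $(\Omega,\mathcal{F},\{\mathcal{F}_t\}_{t\ge0},P)$ is a filtered probability space satisfying the usual hypotheses; $\mathcal{X}=\{1,2,\dots\}\subset\mathbb{R}$ is the state space; $\mathbb{N}_0=\{0,1,2,\dots\}$, $\mathbb{R}_+=[0,\infty)$; $m_d$ is Lebesgue measure on $\mathbb{R}^d$. $\mathcal{X}$ carries a total order $\prec_1$, and $\mathcal{X}_2:=\{(i,j)\in\mathcal{X}^2: i\ne j\}$ carries the induced lexicographic total order $\prec_2$. For each $(i,j)\in\mathcal{X}_2$, $\lambda_{ij}:\mathbb{R}_+\times\mathbb{N}_0\to\mathbb{R}_+$ is a bounded measurable function; $\lambda_i(y,n):=\sum_{j\in\mathcal{X}\setminus\{i\}}\lambda_{ij}(y,n)$, and $\lambda(y,n)$ is the matrix with off-diagonal entries $\lambda_{ij}(y,n)$ and $i$-th diagonal entry $-\lambda_i(y,n)$. Assumptions: (A1) with $c_i:=\sum_{j\in\mathcal{X}\setminus\{i\}}\|\lambda_{ij}\|_{L^\infty(\mathbb{R}_+\times\mathbb{N}_0)}$, one has $c:=\sup_i c_i<\infty$. (A2) for each $n\in\mathbb{N}_0$, $i\in\mathcal{X}$, $\lim_{y\to\infty}\gamma_i(y,n)=\infty$, where $\gamma_i(y,n):=\int_0^y\lambda_i(y',n)\,dy'$. The order $\prec_1$ is such that $C_i:=c_i+\sum_{k\prec_1 i}c_k<\infty$ for every $i$ (e.g. the usual order). For each $(i,j)\in\mathcal{X}_2$, $\tilde\lambda_{ij}:\mathbb{R}_+\times\mathbb{N}_0\to\mathbb{R}_+$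 is a measurable function with $\lambda_{ij}(y,n)\le\tilde\lambda_{ij}(y,n)$ for all $(y,n)$, and $\tilde\lambda_{ij}(y,n)\le\|\lambda_{ij}\|_{L^\infty(\mathbb{R}_+\times\mathbb{N}_0)}$ for almost every $y$ and all $n$. Define the intervals $$\Lambda_{ij}(y,n)=\Big(\sum_{(i',j')\prec_2(i,j)}\tilde\lambda_{i'j'}(y,n)\Big)+[0,\lambda_{ij}(y,n)),$$ where $a+B=\{a+b: b\in B\}$ (for almost every $y$ the sum is finite; $\Lambda_{ij}(y,n)=\emptyset$ if it is infinite), and the functions on $\mathcal{X}\times\mathbb{R}_+\times\mathbb{N}_0\times\mathbb{R}$ $$h_\Lambda(i,y,n,v):=\sum_{j\in\mathcal{X}\setminus\{i\}}(j-i)\mathbf{1}_{\Lambda_{ij}(y,n)}(v),\qquad g_\Lambda(i,y,n,v):=\sum_{j\in\mathcal{X}\setminus\{i\}}\mathbf{1}_{\Lambda_{ij}(y,n)}(v).$$ $\wp(du,dv)$ is a Poisson random measure on $\mathbb{R}_+\times\mathbb{R}$ with intensity $m_2(du,dv)$, defined on $(\Omega,\mathcal{F},P)$; $\{\wp((0,t]\times dv)\}_{t\ge0}$ is adapted to $\{\mathcal{F}_t\}$, and the restriction of $\wp$ to $(t,\infty)\times\mathbb{R}$ is independent of $\mathcal{F}_t$. The initial data $X_0\in\mathcal{X}$, $Y_0\in\mathbb{R}_+$ are $\mathcal{F}_0$-measurable, and $N_0=0$. $\int_{0+}^t$ denotes integration over $(0,t]$. The system has a unique (pathwise) strong solution,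 i.e. an $\{\mathcal{F}_t\}$-adapted r.c.l.l. process satisfying the equations almost surely. Conditioning on $\{X_{T_n}=i\}$ is understood for $i$ with $P(X_{T_n}=i)>0$. *)

theory Defs
  imports "HOL-Probability.Probability"
begin

section \<open>Filtered probability spaces and Poisson random measures\<close>

text \<open>A filtration indexed by \<open>[0, \<infinity>)\<close> is a family over the reals of which only the members with
  nonnegative index matter.\<close>

definition usual_hypotheses :: "'w measure \<Rightarrow> (real \<Rightarrow> 'w measure) \<Rightarrow> bool" where
  "usual_hypotheses M F \<longleftrightarrow>
     prob_space M \<and> complete_measure M \<and>
     (\<forall>t\<ge>0. subalgebra M (F t)) \<and>
     (\<forall>s t. 0 \<le> s \<longrightarrow> s \<le> t \<longrightarrow> sets (F s) \<subseteq> sets (F t)) \<and>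
     (\<forall>t\<ge>0. sets (F t) = (\<Inter>s\<in>{t<..}. sets (F s))) \<and>
     null_sets M \<subseteq> sets (F 0)"

definition poisson_random_measure ::
    "'w measure \<Rightarrow> 'a measure \<Rightarrow> ('w \<Rightarrow> 'a measure) \<Rightarrow> bool" where
  "poisson_random_measure M \<mu> P \<longleftrightarrow>
     (\<forall>\<omega>\<in>space M. sets (P \<omega>) = sets \<mu>) \<and>
     (\<forall>\<omega>\<in>space M. \<forall>A\<in>sets \<mu>. emeasure (P \<omega>) A \<in> range of_nat \<union> {\<infinity>}) \<and>
     (\<forall>A\<in>sets \<mu>. (\<lambda>\<omega>. emeasure (P \<omega>) A) \<in> borel_measurable M) \<and>
     (\<forall>A\<in>sets \<mu>. emeasure \<mu> A < \<infinity> \<longrightarrow>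
        (\<forall>k. \<P>(\<omega> in M. emeasure (P \<omega>) A = of_nat k)
              = measure \<mu> A ^ k / fact k * exp (- measure \<mu> A))) \<and>
     (\<forall>A\<in>sets \<mu>. emeasure \<mu> A = \<infinity> \<longrightarrow> (AE \<omega> in M. emeasure (P \<omega>) A = \<infinity>)) \<and>
     (\<forall>A :: nat \<Rightarrow> 'a set. range A \<subseteq> sets \<mu> \<longrightarrow> disjoint_family A \<longrightarrow>
        prob_space.indep_vars M (\<lambda>_. borel) (\<lambda>k \<omega>. emeasure (P \<omega>) (A k)) UNIV)"

definition half_plane :: "(real \<times> real) measure" where
  "half_plane = restrict_space lborel ({0..} \<times> UNIV)"

definition prm_adapted ::
    "(real \<Rightarrow> 'w measure) \<Rightarrow> ('w \<Rightarrow> (real \<times> real) measure) \<Rightarrow> bool" where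
  "prm_adapted F P \<longleftrightarrow>
     (\<forall>t\<ge>0. \<forall>B\<in>sets borel. (\<lambda>\<omega>. emeasure (P \<omega>) ({0<..t} \<times> B)) \<in> borel_measurable (F t))"

definition prm_future_indep ::
    "'w measure \<Rightarrow> (real \<Rightarrow> 'w measure) \<Rightarrow> ('w \<Rightarrow> (real \<times> real) measure) \<Rightarrow> bool" where
  "prm_future_indep M F P \<longleftrightarrow>
     (\<forall>t\<ge>0. prob_space.indep_set M (sets (F t))
        (sigma_sets (space M)
          {(\<lambda>\<omega>. emeasure (P \<omega>) A) -` B \<inter> space M | A B.
             A \<in> sets half_plane \<and> A \<subseteq> {t<..} \<times> UNIV \<and> B \<in> sets borel}))"


section \<open>Transition rates\<close>

definition states :: "nat set" where
  "states = {1..}"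

definition state_pairs :: "(nat \<times> nat) set" where
  "state_pairs = {(i, j). i \<in> states \<and> j \<in> states \<and> i \<noteq> j}"

text \<open>Families of rates are written \<open>lam i j y n\<close>; only \<open>(i, j) \<in> state_pairs\<close> and \<open>y \<ge> 0\<close> matter.\<close>

definition Linf_norm :: "(real \<Rightarrow> nat \<Rightarrow> real) \<Rightarrow> ennreal" where
  "Linf_norm f =
     esssup (restrict_space lborel {0..} \<Otimes>\<^sub>M count_space UNIV) (\<lambda>(y, n). ennreal \<bar>f y n\<bar>)"

definition rate_measurable :: "(real \<Rightarrow> nat \<Rightarrow> real) \<Rightarrow> bool" where
  "rate_measurable f \<longleftrightarrow>
     (\<forall>y\<ge>0. \<forall>n. 0 \<le> f y n) \<and>
     (\<lambda>(y, n). f y n) \<in> borel_measurable (restrict_space borel {0..} \<Otimes>\<^sub>M count_space UNIV)"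

definition rate_bounded :: "(real \<Rightarrow> nat \<Rightarrow> real) \<Rightarrow> bool" where
  "rate_bounded f \<longleftrightarrow> (\<exists>B. \<forall>y\<ge>0. \<forall>n. \<bar>f y n\<bar> \<le> B)"

text \<open>The real-valued infinite sum is \<open>0\<close> where it diverges.  If \<open>rate_bound lam i\<close> below is finite,
  then for each \<open>n\<close> this concerns only a Lebesgue-null set of \<open>y\<close>, so that it does not affect
  \<open>cum_rate\<close>.\<close>

definition exit_rate :: "(nat \<Rightarrow> nat \<Rightarrow> real \<Rightarrow> nat \<Rightarrow> real) \<Rightarrow> nat \<Rightarrow> real \<Rightarrow> nat \<Rightarrow> real" where
  "exit_rate lam i y n = (\<Sum>\<^sub>\<infinity>j\<in>states - {i}. lam i j y n)"

definition cum_rate :: "(nat \<Rightarrow> nat \<Rightarrow> real \<Rightarrow> nat \<Rightarrow> real) \<Rightarrow> nat \<Rightarrow> real \<Rightarrow> nat \<Rightarrow> real" where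
  "cum_rate lam i y n = (LINT s:{0..y}|lborel. exit_rate lam i s n)"

definition rate_bound :: "(nat \<Rightarrow> nat \<Rightarrow> real \<Rightarrow> nat \<Rightarrow> real) \<Rightarrow> nat \<Rightarrow> ennreal" where
  "rate_bound lam i = (\<Sum>\<^sub>\<infinity>j\<in>states - {i}. Linf_norm (lam i j))"

definition assumption_A1 :: "(nat \<Rightarrow> nat \<Rightarrow> real \<Rightarrow> nat \<Rightarrow> real) \<Rightarrow> bool" where
  "assumption_A1 lam \<longleftrightarrow> (SUP i\<in>states. rate_bound lam i) < \<infinity>"

definition assumption_A2 :: "(nat \<Rightarrow> nat \<Rightarrow> real \<Rightarrow> nat \<Rightarrow> real) \<Rightarrow> bool" where
  "assumption_A2 lam \<longleftrightarrow> (\<forall>n. \<forall>i\<in>states. filterlim (\<lambda>y. cum_rate lam i y n) at_top at_top)"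

definition order_summable ::
    "(nat \<Rightarrow> nat \<Rightarrow> real \<Rightarrow> nat \<Rightarrow> real) \<Rightarrow> (nat \<times> nat) set \<Rightarrow> bool" where
  "order_summable lam prec \<longleftrightarrow>
     (\<forall>i\<in>states. rate_bound lam i + (\<Sum>\<^sub>\<infinity>k\<in>{k \<in> states. (k, i) \<in> prec}. rate_bound lam k) < \<infinity>)"


section \<open>The intervals and the coefficients of the system\<close>

text \<open>In the following, \<open>prec\<close> is the strict order on the states, \<open>lamt\<close> the dominating rates, and the
  left endpoint is summed in the extended nonnegative reals so that its divergence is visible.\<close>

definition left_end ::
    "(nat \<times> nat) set \<Rightarrow> (nat \<Rightarrow> nat \<Rightarrow> real \<Rightarrow> nat \<Rightarrow> real) \<Rightarrow> nat \<Rightarrow> nat \<Rightarrow> real \<Rightarrow> nat \<Rightarrow> ennreal" where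
  "left_end prec lamt i j y n =
     (\<Sum>\<^sub>\<infinity>(i', j')\<in>{p \<in> state_pairs. (p, (i, j)) \<in> prec <*lex*> prec}. ennreal (lamt i' j' y n))"

definition Lam ::
    "(nat \<times> nat) set \<Rightarrow> (nat \<Rightarrow> nat \<Rightarrow> real \<Rightarrow> nat \<Rightarrow> real) \<Rightarrow> (nat \<Rightarrow> nat \<Rightarrow> real \<Rightarrow> nat \<Rightarrow> real) \<Rightarrow>
     nat \<Rightarrow> nat \<Rightarrow> real \<Rightarrow> nat \<Rightarrow> real set" where
  "Lam prec lam lamt i j y n =
     (if left_end prec lamt i j y n = \<infinity> then {}
      else (\<lambda>b. enn2real (left_end prec lamt i j y n) + b) ` {0..<lam i j y n})"

definition h_Lam ::
    "(nat \<times> nat) set \<Rightarrow> (nat \<Rightarrow> nat \<Rightarrow> real \<Rightarrow> nat \<Rightarrow> real) \<Rightarrow> (nat \<Rightarrow> nat \<Rightarrow> real \<Rightarrow> nat \<Rightarrow> real) \<Rightarrow>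
     nat \<Rightarrow> real \<Rightarrow> nat \<Rightarrow> real \<Rightarrow> real" where
  "h_Lam prec lam lamt i y n v =
     (\<Sum>\<^sub>\<infinity>j\<in>states - {i}. (real j - real i) * indicator (Lam prec lam lamt i j y n) v)"

definition g_Lam ::
    "(nat \<times> nat) set \<Rightarrow> (nat \<Rightarrow> nat \<Rightarrow> real \<Rightarrow> nat \<Rightarrow> real) \<Rightarrow> (nat \<Rightarrow> nat \<Rightarrow> real \<Rightarrow> nat \<Rightarrow> real) \<Rightarrow>
     nat \<Rightarrow> real \<Rightarrow> nat \<Rightarrow> real \<Rightarrow> real" where
  "g_Lam prec lam lamt i y n v =
     (\<Sum>\<^sub>\<infinity>j\<in>states - {i}. indicator (Lam prec lam lamt i j y n) v)"


section \<open>Strong solutions and jump times\<close>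

definition left_lim :: "(real \<Rightarrow> 'a::t2_space) \<Rightarrow> real \<Rightarrow> 'a" where
  "left_lim f t = Lim (at_left t) f"

definition rcll :: "(real \<Rightarrow> 'a::t2_space) \<Rightarrow> bool" where
  "rcll f \<longleftrightarrow> (\<forall>t\<ge>0. continuous (at_right t) f) \<and> (\<forall>t>0. \<exists>l. (f \<longlongrightarrow> l) (at_left t))"

text \<open>The components \<open>X\<close> and \<open>N\<close> are \<open>nat\<close>-valued; convergence of their paths in the discrete topology
  is the same as convergence in the reals, as the integers are closed and discrete there.\<close>

definition at_left_limits ::
    "(nat \<Rightarrow> real \<Rightarrow> nat \<Rightarrow> real \<Rightarrow> real) \<Rightarrow>
     (real \<Rightarrow> nat) \<Rightarrow> (real \<Rightarrow> real) \<Rightarrow> (real \<Rightarrow> nat) \<Rightarrow> real \<times> real \<Rightarrow> real" where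
  "at_left_limits k x y n = (\<lambda>(u, v). k (left_lim x u) (left_lim y u) (left_lim n u) v)"

text \<open>Integrability is part of the equations because the Bochner integral of a nonintegrable function
  is \<open>0\<close> by convention.\<close>

definition solves_system ::
    "(nat \<Rightarrow> real \<Rightarrow> nat \<Rightarrow> real \<Rightarrow> real) \<Rightarrow> (nat \<Rightarrow> real \<Rightarrow> nat \<Rightarrow> real \<Rightarrow> real) \<Rightarrow>
     (real \<times> real) measure \<Rightarrow> nat \<Rightarrow> real \<Rightarrow>
     (real \<Rightarrow> nat) \<Rightarrow> (real \<Rightarrow> real) \<Rightarrow> (real \<Rightarrow> nat) \<Rightarrow> bool" where
  "solves_system h g p x0 y0 x y n \<longleftrightarrow>
     (\<forall>t\<ge>0.
        set_integrable p ({0<..t} \<times> UNIV) (at_left_limits h x y n) \<and>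
        set_integrable p ({0<..t} \<times> UNIV) (at_left_limits g x y n) \<and>
        set_integrable p ({0<..t} \<times> UNIV) (\<lambda>z. left_lim y (fst z) * at_left_limits g x y n z) \<and>
        real (x t) = real x0 + (LINT z:({0<..t} \<times> UNIV)|p. at_left_limits h x y n z) \<and>
        y t = y0 + t - (LINT z:({0<..t} \<times> UNIV)|p. left_lim y (fst z) * at_left_limits g x y n z) \<and>
        real (n t) = (LINT z:({0<..t} \<times> UNIV)|p. at_left_limits g x y n z))"

definition strong_solution ::
    "'w measure \<Rightarrow> (real \<Rightarrow> 'w measure) \<Rightarrow> ('w \<Rightarrow> (real \<times> real) measure) \<Rightarrow>
     (nat \<Rightarrow> real \<Rightarrow> nat \<Rightarrow> real \<Rightarrow> real) \<Rightarrow> (nat \<Rightarrow> real \<Rightarrow> nat \<Rightarrow> real \<Rightarrow> real) \<Rightarrow>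
     ('w \<Rightarrow> nat) \<Rightarrow> ('w \<Rightarrow> real) \<Rightarrow>
     (real \<Rightarrow> 'w \<Rightarrow> nat) \<Rightarrow> (real \<Rightarrow> 'w \<Rightarrow> real) \<Rightarrow> (real \<Rightarrow> 'w \<Rightarrow> nat) \<Rightarrow> bool" where
  "strong_solution M F P h g X0 Y0 X Y N \<longleftrightarrow>
     (\<forall>t\<ge>0. X t \<in> F t \<rightarrow>\<^sub>M count_space UNIV \<and> Y t \<in> borel_measurable (F t) \<and>
             N t \<in> F t \<rightarrow>\<^sub>M count_space UNIV) \<and>
     (\<forall>\<omega>\<in>space M. \<forall>t\<ge>0. X t \<omega> \<in> states \<and> 0 \<le> Y t \<omega>) \<and>
     (\<forall>\<omega>\<in>space M. rcll (\<lambda>t. X t \<omega>) \<and> rcll (\<lambda>t. Y t \<omega>) \<and> rcll (\<lambda>t. N t \<omega>)) \<and>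
     (AE \<omega> in M. solves_system h g (P \<omega>) (X0 \<omega>) (Y0 \<omega>)
                   (\<lambda>t. X t \<omega>) (\<lambda>t. Y t \<omega>) (\<lambda>t. N t \<omega>))"

text \<open>The \<open>n\<close>-th jump time of a path is \<open>\<infinity>\<close> if there are fewer than \<open>n\<close> jumps.\<close>

primrec jump_time :: "(real \<Rightarrow> nat) \<Rightarrow> nat \<Rightarrow> ereal" where
  "jump_time x 0 = 0"
| "jump_time x (Suc n) =
     Inf {ereal t | t. 0 < t \<and> jump_time x n < ereal t \<and> x t \<noteq> left_lim x t}"

text \<open>The event that the state at the \<open>n\<close>-th jump time is \<open>i\<close>, which includes that there are at least
  \<open>n\<close> jumps.\<close>

definition jumps_to :: "(real \<Rightarrow> nat) \<Rightarrow> nat \<Rightarrow> nat \<Rightarrow> bool" where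
  "jumps_to x n i \<longleftrightarrow> jump_time x n < \<infinity> \<and> x (real_of_ereal (jump_time x n)) = i"

definition renewal_kernel ::
    "'w measure \<Rightarrow> (real \<Rightarrow> 'w \<Rightarrow> nat) \<Rightarrow> nat \<Rightarrow> nat \<Rightarrow> real \<Rightarrow> nat \<Rightarrow> real" where
  "renewal_kernel M X i j y n =
     \<P>(\<omega> in M.
         jumps_to (\<lambda>t. X t \<omega>) (Suc n) j \<and>
         jump_time (\<lambda>t. X t \<omega>) (Suc n) - jump_time (\<lambda>t. X t \<omega>) n \<le> ereal y
       \<bar> jumps_to (\<lambda>t. X t \<omega>) n i)"

end

theory Submission
  imports Defs
begin

text \<open>The kernel is found from the compensation formula: for a predictable random set \<open>C\<close>, the number of
  atoms of the Poisson random measure in \<open>C\<close> and the Lebesgue measure of \<open>C\<close> have the same expectation.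
  It is applied to the set of all \<open>(u, v)\<close> with \<open>X\<^bsub>u-\<^esub> = i\<close>, \<open>N\<^bsub>u-\<^esub> = n\<close>, \<open>Y\<^bsub>u-\<^esub> \<le> y\<close> and
  \<open>v \<in> \<Lambda>\<^bsub>ij\<^esub>(Y\<^bsub>u-\<^esub>, n)\<close>.  As almost surely no two atoms are simultaneous and \<open>Y\<close> is the time since the
  last jump, this set holds one atom if \<open>X\<close> goes from \<open>i\<close> to \<open>j\<close> at its jump \<open>n + 1\<close> after a holding
  time \<open>D \<le> y\<close>, and no atom otherwise; its area is the integral of \<open>\<lambda>\<^bsub>ij\<^esub>(s, n)\<close> over \<open>s \<le> y\<close>,
  \<open>s < D\<close>.  With \<open>G(s)\<close> the probability of \<open>X\<^bsub>T\<^bsub>n\<^esub>\<^esub> = i\<close> and \<open>s < D\<close>, the joint probability of the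
  transition is therefore the integral of \<open>G \<lambda>\<^bsub>ij\<^esub>\<close>.  Summation over \<open>j\<close> gives
  \<open>G(y) + \<integral>\<^bsub>0..y\<^esub> G \<lambda>\<^bsub>i\<^esub> = G(0)\<close>, whence \<open>G = G(0) exp(-\<gamma>\<^bsub>i\<^esub>)\<close>.\<close>

section \<open>Infinite sums of nonnegative numbers\<close>

text \<open>The holding time starts at the random time T_n. Writing the transition as a predictable
  set puts what is known about T_n and X_{T_n} into that set, so that only independence after
  deterministic times enters; in return its mass and area have to be computed path by path. This
  rests on the left limit of Y being the age of the current state. That holds after an actual jump,
  where Y is reset to 0, whereas Y starts from Y_0 before T_1; hence \<open>n >= 1\<close>.

  The half plane has infinite intensity, so the complement step in the extension from boxes to all
  predictable sets is carried out inside bounded windows and followed by a monotone limit. All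
  pathwise facts hold only almost surely; completeness of the probability space turns sets and
  functions that are determined up to a null set into measurable ones. Uniform bounds from the
  summability of the \<open>L^infinity\<close> norms make the left ends of the intervals finite for
  almost every age, so that each interval has its full length \<open>lam\<close>.\<close>

lemma ennreal_summable_on [simp]: "(f :: 'a \<Rightarrow> ennreal) summable_on A"
  by (rule nonneg_summable_on_complete) simp

lemma infsum_ennreal_eq_SUP:
  fixes f :: "'a \<Rightarrow> ennreal"
  shows "infsum f A = (SUP F\<in>{F. finite F \<and> F \<subseteq> A}. sum f F)"
  by (rule nonneg_infsum_complete) simp

lemma sum_le_infsum_ennreal:
  fixes f :: "'a \<Rightarrow> ennreal"
  assumes "finite F" "F \<subseteq> A"
  shows "sum f F \<le> infsum f A"
  unfolding infsum_ennreal_eq_SUP using assms by (intro SUP_upper) auto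

lemma infsum_single_support:
  assumes "i \<in> A" "\<And>j. j \<in> A \<Longrightarrow> j \<noteq> i \<Longrightarrow> f j = 0"
  shows "infsum f A = f i"
proof -
  have "infsum f A = infsum f {i}"
    using assms by (intro infsum_cong_neutral) auto
  then show ?thesis by simp
qed

lemma borel_measurable_infsum_ennreal:
  fixes f :: "'a \<Rightarrow> 'b \<Rightarrow> ennreal"
  assumes "countable A" and "\<And>a. a \<in> A \<Longrightarrow> f a \<in> borel_measurable M"
  shows "(\<lambda>x. \<Sum>\<^sub>\<infinity>a\<in>A. f a x) \<in> borel_measurable M"
  unfolding infsum_ennreal_eq_SUP
  by (intro borel_measurable_SUP borel_measurable_sum)
     (use assms in \<open>auto intro: countable_Collect_finite_subset simp: conj_commute\<close>)

lemma infsum_ennreal_eq_suminf: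
  fixes f :: "nat \<Rightarrow> ennreal"
  shows "infsum f A = (\<Sum>k. if k \<in> A then f k else 0)"
proof -
  have "infsum f A = infsum (\<lambda>k. if k \<in> A then f k else 0) UNIV"
    by (rule infsum_cong_neutral) auto
  also have "\<dots> = (\<Sum>k. if k \<in> A then f k else 0)"
    using has_sum_imp_sums[OF has_sum_infsum[OF ennreal_summable_on]] sums_unique by blast
  finally show ?thesis .
qed

text \<open>The default values agree: a divergent real \<open>infsum\<close> is 0, and
  \<open>enn2real\<close> sends infinity to 0. So the exit rate can be studied through an
  \<open>ennreal\<close> sum, where measurability comes from a countable supremum.\<close>

lemma infsum_real_eq_enn2real:
  fixes f :: "nat \<Rightarrow> real"
  assumes nn: "\<And>k. k \<in> A \<Longrightarrow> 0 \<le> f k"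
  shows "infsum f A = enn2real (\<Sum>\<^sub>\<infinity>k\<in>A. ennreal (f k))"
proof (cases "f summable_on A")
  case True
  have "infsum (\<lambda>k. ennreal (f k)) A = ennreal (infsum f A)"
    using infsum_nonneg_is_SUPREMUM_ennreal[OF True nn] infsum_ennreal_eq_SUP[of "\<lambda>k. ennreal (f k)" A] nn
    by (auto simp: sum_ennreal subset_eq intro!: SUP_cong)
  then show ?thesis
    using infsum_nonneg[of A f] nn by simp
next
  case False
  have "infsum (\<lambda>k. ennreal (f k)) A = \<infinity>"
  proof (rule ccontr)
    assume "infsum (\<lambda>k. ennreal (f k)) A \<noteq> \<infinity>"
    then obtain r where r: "0 \<le> r" "infsum (\<lambda>k. ennreal (f k)) A = ennreal r"
      by (metis ennreal_cases infinity_ennreal_def)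
    have "sum f F \<le> r" if "finite F" "F \<subseteq> A" for F
    proof -
      have "ennreal (sum f F) = (\<Sum>k\<in>F. ennreal (f k))"
        using that nn by (intro sum_ennreal[symmetric]) auto
      also have "\<dots> \<le> ennreal r"
        unfolding r(2)[symmetric] using that by (intro sum_le_infsum_ennreal) auto
      finally show ?thesis
        using r by simp
    qed
    then have "f summable_on A"
      by (intro nonneg_bdd_above_summable_on nn bdd_aboveI[of _ r]) auto
    with False show False by simp
  qed
  with False show ?thesis
    by (simp add: infsum_not_exists)
qed

section \<open>Rates and intervals\<close>

lemma rate_measurable_section:
  assumes "rate_measurable f"
  shows "(\<lambda>s. f s m) \<in> borel_measurable (restrict_space borel {0..})"
proof -
  have "(\<lambda>s. (\<lambda>(y, n). f y n) (s, m)) \<in> borel_measurable (restrict_space borel {0..})"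
    by (rule measurable_compose[OF measurable_Pair2'[of m "count_space UNIV"]])
       (use assms in \<open>auto simp: rate_measurable_def\<close>)
  then show ?thesis by simp
qed

locale thinning_rates =
  fixes lam lamt :: "nat \<Rightarrow> nat \<Rightarrow> real \<Rightarrow> nat \<Rightarrow> real" and prec :: "(nat \<times> nat) set"
  assumes lam_measurable: "\<And>k l. (k, l) \<in> state_pairs \<Longrightarrow> rate_measurable (lam k l)"
    and lamt_measurable: "\<And>k l. (k, l) \<in> state_pairs \<Longrightarrow> rate_measurable (lamt k l)"
    and lam_le_lamt: "\<And>k l s m. (k, l) \<in> state_pairs \<Longrightarrow> 0 \<le> s \<Longrightarrow> lam k l s m \<le> lamt k l s m"
    and lamt_le_Linf: "\<And>k l. (k, l) \<in> state_pairs \<Longrightarrow>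
           (AE s in lborel. 0 \<le> s \<longrightarrow> (\<forall>m. ennreal (lamt k l s m) \<le> Linf_norm (lam k l)))"
    and prec_order: "strict_linear_order_on states prec"
    and summable_order: "order_summable lam prec"
begin

abbreviation "L \<equiv> Lam prec lam lamt"

lemma lam_nonneg: "(k, l) \<in> state_pairs \<Longrightarrow> 0 \<le> s \<Longrightarrow> 0 \<le> lam k l s m"
  using lam_measurable by (auto simp: rate_measurable_def)

lemma Lam_eq_interval:
  "L a b s m = (if left_end prec lamt a b s m = \<infinity> then {}
     else {enn2real (left_end prec lamt a b s m) ..< enn2real (left_end prec lamt a b s m) + lam a b s m})"
  by (simp add: Lam_def image_add_atLeastLessThan add.commute)

text \<open>In the lexicographic order \<open>(a, b)\<close> and all its predecessors precede
  \<open>(a, b')\<close>. Irreflexivity keeps \<open>(a, b)\<close> out of its own predecessors, so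
  its term is a genuine addition to the sum.\<close>

lemma left_end_step:
  assumes "a \<in> states" "b \<in> states - {a}" "b' \<in> states - {a}" "(b, b') \<in> prec"
  shows "left_end prec lamt a b s m + ennreal (lamt a b s m) \<le> left_end prec lamt a b' s m"
proof -
  have irr: "irrefl prec" and tr: "trans prec"
    using prec_order by (auto simp: strict_linear_order_on_def)
  let ?A = "{p \<in> state_pairs. (p, (a, b)) \<in> prec <*lex*> prec}"
  let ?B = "{p \<in> state_pairs. (p, (a, b')) \<in> prec <*lex*> prec}"
  let ?f = "\<lambda>p. case p of (i', j') \<Rightarrow> ennreal (lamt i' j' s m)"
  have nin: "(a, b) \<notin> ?A"
    using irr by (auto simp: irrefl_def)
  have sub: "?A \<union> {(a, b)} \<subseteq> ?B"
    using assms tr by (auto simp: state_pairs_def dest: transD)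
  have "infsum ?f ?A + infsum ?f {(a, b)} = infsum ?f (?A \<union> {(a, b)})"
    using nin by (intro infsum_Un_disjoint[symmetric] ennreal_summable_on) auto
  also have "\<dots> \<le> infsum ?f ?B"
    using sub by (intro infsum_mono_neutral) auto
  finally show ?thesis
    by (simp add: left_end_def)
qed

text \<open>The interval of the earlier target has length \<open>lam\<close>, which is at most
  \<open>lamt\<close>, so by \<open>left_end_step\<close> it ends no later than the other one
  begins. A common source \<open>a\<close> suffices, because \<open>h_Lam\<close> and
  \<open>g_Lam\<close> sum over targets only.\<close>

lemma Lam_disjoint:
  assumes "a \<in> states" "0 \<le> s" "b \<in> states - {a}" "b' \<in> states - {a}" "b \<noteq> b'"
  shows "L a b s m \<inter> L a b' s m = {}"
proof -
  have *: "L a b s m \<inter> L a b' s m = {}"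
    if "(b, b') \<in> prec" "b \<in> states - {a}" "b' \<in> states - {a}" for b b'
  proof (cases "left_end prec lamt a b' s m = \<infinity> \<or> left_end prec lamt a b s m = \<infinity>")
    case True
    then show ?thesis by (auto simp: Lam_eq_interval)
  next
    case False
    have p: "(a, b) \<in> state_pairs"
      using assms(1) that by (auto simp: state_pairs_def)
    obtain u w where u: "left_end prec lamt a b s m = ennreal u" "0 \<le> u"
      and w: "left_end prec lamt a b' s m = ennreal w" "0 \<le> w"
      using False by (metis ennreal_cases infinity_ennreal_def)
    have l: "0 \<le> lamt a b s m"
      using lamt_measurable[OF p] assms(2) by (auto simp: rate_measurable_def)
    have "ennreal (u + lamt a b s m) \<le> ennreal w"
      using left_end_step[OF assms(1) that(2,3,1), of s m] u w l by simp
    then have "u + lam a b s m \<le> w"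
      using w lam_le_lamt[OF p assms(2), of m] by (simp add: ennreal_le_iff)
    then show ?thesis
      using u w by (auto simp: Lam_eq_interval)
  qed
  have "(b, b') \<in> prec \<or> (b', b) \<in> prec"
    using prec_order assms by (auto simp: strict_linear_order_on_def total_on_def)
  with *[of b b'] *[of b' b] assms show ?thesis by auto
qed

text \<open>By disjointness at most one summand is nonzero, so the infinite sum is 0 or 1 and no
  question of convergence arises.\<close>

lemma g_Lam_eq_indicator:
  assumes "a \<in> states" "0 \<le> s"
  shows "g_Lam prec lam lamt a s m v = indicator (\<Union>b\<in>states - {a}. L a b s m) v"
proof (cases "\<exists>b\<in>states - {a}. v \<in> L a b s m")
  case True
  then obtain b where b: "b \<in> states - {a}" "v \<in> L a b s m" by auto
  have "g_Lam prec lam lamt a s m v = indicator (L a b s m) v"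
    unfolding g_Lam_def
  proof (rule infsum_single_support)
    show "indicator (L a b' s m) v = (0 :: real)" if "b' \<in> states - {a}" "b' \<noteq> b" for b'
      using Lam_disjoint[OF assms b(1) that(1), of m] that(2) b(2) by (auto simp: indicator_def)
  qed (use b in simp)
  with b show ?thesis by (auto simp: indicator_def)
next
  case False
  then have "g_Lam prec lam lamt a s m v = infsum (\<lambda>_. 0) (states - {a})"
    unfolding g_Lam_def by (intro infsum_cong) (auto simp: indicator_def)
  with False show ?thesis by (auto simp: indicator_def)
qed

lemma h_Lam_inside:
  assumes "a \<in> states" "0 \<le> s" "b \<in> states - {a}" "v \<in> L a b s m"
  shows "h_Lam prec lam lamt a s m v = real b - real a"
proof -
  have "h_Lam prec lam lamt a s m v = (real b - real a) * indicator (L a b s m) v"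
    unfolding h_Lam_def
  proof (rule infsum_single_support)
    show "(real b' - real a) * indicator (L a b' s m) v = 0" if "b' \<in> states - {a}" "b' \<noteq> b" for b'
      using Lam_disjoint[OF assms(1-3) that(1), of m] that(2) assms(4) by (auto simp: indicator_def)
  qed (use assms in simp)
  with assms(4) show ?thesis by simp
qed

lemma h_Lam_outside:
  assumes "v \<notin> (\<Union>b\<in>states - {a}. L a b s m)"
  shows "h_Lam prec lam lamt a s m v = 0"
proof -
  have "h_Lam prec lam lamt a s m v = infsum (\<lambda>_. 0) (states - {a})"
    unfolding h_Lam_def using assms by (intro infsum_cong) (auto simp: indicator_def)
  then show ?thesis by simp
qed

lemma Lam_borel: "L a b s m \<in> sets borel"
  by (simp add: Lam_eq_interval)

text \<open>There are countably many pairs of states, so the exceptional null sets merge into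
  one.\<close>

lemma AE_rates_bounded:
  "AE s in lborel. 0 \<le> s \<longrightarrow> (\<forall>(k, l)\<in>state_pairs. \<forall>m. ennreal (lamt k l s m) \<le> Linf_norm (lam k l))"
proof -
  have "AE s in lborel. \<forall>p\<in>state_pairs. 0 \<le> s \<longrightarrow>
      (\<forall>m. ennreal (lamt (fst p) (snd p) s m) \<le> Linf_norm (lam (fst p) (snd p)))"
    by (subst AE_ball_countable) (auto intro: lamt_le_Linf)
  then show ?thesis by eventually_elim auto
qed

lemma rate_bound_finite: "a \<in> states \<Longrightarrow> rate_bound lam a < \<infinity>"
  using summable_order by (auto simp: order_summable_def)

lemma AE_exit_finite:
  assumes "a \<in> states"
  shows "AE s in lborel. 0 \<le> s \<longrightarrow> (\<Sum>\<^sub>\<infinity>b\<in>states - {a}. ennreal (lam a b s m)) \<le> rate_bound lam a"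
  using AE_rates_bounded
proof eventually_elim
  case (elim s)
  have "ennreal (lam a b s m) \<le> Linf_norm (lam a b)" if "0 \<le> s" "b \<in> states - {a}" for b
  proof -
    have "(a, b) \<in> state_pairs" using that assms by (auto simp: state_pairs_def)
    then have "ennreal (lam a b s m) \<le> ennreal (lamt a b s m)"
      using that by (intro ennreal_leI lam_le_lamt)
    also have "\<dots> \<le> Linf_norm (lam a b)"
      using elim that \<open>(a, b) \<in> state_pairs\<close> by blast
    finally show ?thesis .
  qed
  then show ?case
    unfolding rate_bound_def by (auto intro!: infsum_mono)
qed

text \<open>Predecessors of \<open>(a, b)\<close> have their source in \<open>a\<close> or among the
  predecessors of \<open>a\<close>. Their \<open>L^infinity\<close> norms therefore sum to at most
  \<open>?C\<close>, which \<open>order_summable\<close> makes finite.\<close>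

lemma AE_left_end_finite:
  assumes a: "a \<in> states"
  shows "AE s in lborel. 0 \<le> s \<longrightarrow> left_end prec lamt a b s m < \<infinity>"
  using AE_rates_bounded
proof eventually_elim
  case (elim s)
  let ?K = "{k \<in> states. (k, a) \<in> prec}"
  let ?C = "rate_bound lam a + infsum (rate_bound lam) ?K"
  show ?case
  proof
    assume s: "0 \<le> s"
    have a_notin: "a \<notin> ?K"
      using prec_order by (auto simp: strict_linear_order_on_def irrefl_def)
    have ub: "(\<Sum>(i', j')\<in>G. ennreal (lamt i' j' s m)) \<le> ?C"
      if G: "finite G" "G \<subseteq> {p \<in> state_pairs. (p, (a, b)) \<in> prec <*lex*> prec}" for G
    proof -
      let ?G1 = "fst ` G" and ?G2 = "snd ` G"
      have G1: "?G1 \<subseteq> insert a ?K" "finite ?G1" and G2: "finite ?G2" "?G2 \<subseteq> states"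
        using G by (auto simp: state_pairs_def)
      have "(\<Sum>(i', j')\<in>G. ennreal (lamt i' j' s m)) \<le> (\<Sum>(i', j')\<in>G. Linf_norm (lam i' j'))"
        using elim s G by (intro sum_mono) auto
      \<comment> \<open>Enlarging \<open>G\<close> to the rectangle spanned by its projections,
        without the diagonal, turns the sum into an iterated one that is bounded row by row.\<close>
      also have "\<dots> \<le> (\<Sum>(i', j')\<in>(SIGMA k:?G1. ?G2 - {k}). Linf_norm (lam i' j'))"
        using G G1 G2 by (intro sum_mono2) (force simp: state_pairs_def)+
      also have "\<dots> = (\<Sum>k\<in>?G1. \<Sum>l\<in>?G2 - {k}. Linf_norm (lam k l))"
        using G1 G2 by (subst sum.Sigma) auto
      also have "\<dots> \<le> (\<Sum>k\<in>?G1. rate_bound lam k)"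
        unfolding rate_bound_def
      proof (rule sum_mono)
        fix k
        show "(\<Sum>l\<in>?G2 - {k}. Linf_norm (lam k l)) \<le> (\<Sum>\<^sub>\<infinity>l\<in>states - {k}. Linf_norm (lam k l))"
          by (rule sum_le_infsum_ennreal) (use G2 in auto)
      qed
      also have "\<dots> \<le> infsum (rate_bound lam) (insert a ?K)"
        using G1 by (intro sum_le_infsum_ennreal) auto
      also have "\<dots> = ?C"
        using a_notin infsum_Un_disjoint[of "rate_bound lam" "{a}" ?K] by auto
      finally show ?thesis .
    qed
    have "left_end prec lamt a b s m \<le> ?C"
      unfolding left_end_def
      by (subst infsum_ennreal_eq_SUP, rule SUP_least, rule ub) auto
    also have "\<dots> < \<infinity>"
      using summable_order a unfolding order_summable_def by blast
    finally show "left_end prec lamt a b s m < \<infinity>" .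
  qed
qed

lemma left_end_borel_measurable:
  "(\<lambda>s. left_end prec lamt a b s m) \<in> borel_measurable (restrict_space borel {0..})"
  unfolding left_end_def
proof (rule borel_measurable_infsum_ennreal)
  fix p assume "p \<in> {p \<in> state_pairs. (p, (a, b)) \<in> prec <*lex*> prec}"
  then have "rate_measurable (lamt (fst p) (snd p))"
    using lamt_measurable by auto
  from rate_measurable_section[OF this, of m]
  show "(\<lambda>s. case p of (i', j') \<Rightarrow> ennreal (lamt i' j' s m)) \<in> borel_measurable (restrict_space borel {0..})"
    by (cases p) simp
qed auto

lemma pred_in_Lam:
  assumes ab: "(a, b) \<in> state_pairs"
    and [measurable]: "f \<in> borel_measurable S" "g \<in> borel_measurable S"
    and nn: "\<And>z. z \<in> space S \<Longrightarrow> 0 \<le> f z"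
  shows "Measurable.pred S (\<lambda>z. g z \<in> L a b (f z) m)"
proof -
  have f: "f \<in> S \<rightarrow>\<^sub>M restrict_space borel {0..}"
    using nn by (intro measurable_restrict_space2) auto
  have [measurable]: "(\<lambda>z. left_end prec lamt a b (f z) m) \<in> borel_measurable S"
    "(\<lambda>z. lam a b (f z) m) \<in> borel_measurable S"
    using measurable_compose[OF f left_end_borel_measurable]
      measurable_compose[OF f rate_measurable_section[OF lam_measurable[OF ab]]] by auto
  have "Measurable.pred S (\<lambda>z. left_end prec lamt a b (f z) m \<noteq> \<infinity> \<and>
     enn2real (left_end prec lamt a b (f z) m) \<le> g z \<and>
     g z < enn2real (left_end prec lamt a b (f z) m) + lam a b (f z) m)"
    by measurable
  moreover have "(\<lambda>z. g z \<in> L a b (f z) m) = (\<lambda>z. left_end prec lamt a b (f z) m \<noteq> \<infinity> \<and>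
     enn2real (left_end prec lamt a b (f z) m) \<le> g z \<and>
     g z < enn2real (left_end prec lamt a b (f z) m) + lam a b (f z) m)"
    by (auto simp: Lam_eq_interval fun_eq_iff)
  ultimately show ?thesis by simp
qed

lemma exit_rate_eq:
  assumes "a \<in> states" "0 \<le> s"
  shows "exit_rate lam a s m = enn2real (\<Sum>\<^sub>\<infinity>b\<in>states - {a}. ennreal (lam a b s m))"
  unfolding exit_rate_def
  using assms by (intro infsum_real_eq_enn2real lam_nonneg) (auto simp: state_pairs_def)

end

section \<open>Paths of solutions\<close>

lemma sets_half_plane_iff: "A \<in> sets half_plane \<longleftrightarrow> A \<in> sets borel \<and> A \<subseteq> {0..} \<times> UNIV"
proof -
  have "closed ({0::real..} \<times> (UNIV :: real set))"
    by (intro closed_Times) auto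
  then show ?thesis
    unfolding half_plane_def by (subst sets_restrict_space_iff) auto
qed

lemma Times_in_half_plane:
  assumes "A \<in> sets borel" "B \<in> sets borel" "A \<subseteq> {0..}"
  shows "A \<times> B \<in> sets half_plane"
proof -
  have "A \<times> B \<in> sets (borel \<Otimes>\<^sub>M borel)"
    using assms by auto
  then have "A \<times> B \<in> sets borel"
    by (simp only: borel_prod)
  then show ?thesis
    using assms by (auto simp: sets_half_plane_iff)
qed

lemma half_plane_emeasure:
  assumes "A \<in> sets half_plane"
  shows "emeasure half_plane A = emeasure lborel A"
proof -
  have "closed ({0::real..} \<times> (UNIV :: real set))"
    by (intro closed_Times) auto
  with assms show ?thesis
    unfolding half_plane_def sets_half_plane_iff[unfolded half_plane_def]
    by (intro emeasure_restrict_space) auto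
qed

section \<open>Left limits and jumps of r.c.l.l. functions\<close>

lemma rcll_left_lim:
  fixes f :: "real \<Rightarrow> 'a::t2_space"
  assumes "rcll f" "0 < t"
  shows "(f \<longlongrightarrow> left_lim f t) (at_left t)"
proof -
  obtain l where "(f \<longlongrightarrow> l) (at_left t)"
    using assms by (auto simp: rcll_def)
  then show ?thesis
    unfolding left_lim_def by (metis tendsto_Lim trivial_limit_at_left_real)
qed

lemma rcll_left_lim_nonneg:
  fixes f :: "real \<Rightarrow> real"
  assumes "rcll f" "0 < t" "\<And>s. 0 \<le> s \<Longrightarrow> 0 \<le> f s"
  shows "0 \<le> left_lim f t"
proof -
  have "\<forall>\<^sub>F s in at_left t. 0 \<le> f s"
    unfolding eventually_at_left[OF assms(2)] using assms by (intro exI[of _ 0]) auto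
  then show ?thesis
    using tendsto_lowerbound[OF rcll_left_lim[OF assms(1,2)]] by simp
qed

lemma rcll_left_lim_nat:
  fixes f :: "real \<Rightarrow> nat"
  assumes "rcll f" "0 < t"
  obtains b where "b < t" "0 \<le> b" "\<And>s. b < s \<Longrightarrow> s < t \<Longrightarrow> f s = left_lim f t"
proof -
  have "\<forall>\<^sub>F s in at_left t. f s = left_lim f t"
    using rcll_left_lim[OF assms] by (simp add: tendsto_discrete)
  then obtain b where "b < t" "\<And>s. b < s \<Longrightarrow> s < t \<Longrightarrow> f s = left_lim f t"
    by (auto simp: eventually_at_left[of "t - 1" t])
  with that[of "max b 0"] assms show ?thesis by auto
qed

lemma rcll_right_nat:
  fixes f :: "real \<Rightarrow> nat"
  assumes "rcll f" "0 \<le> t"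
  obtains b where "t < b" "\<And>s. t \<le> s \<Longrightarrow> s < b \<Longrightarrow> f s = f t"
proof -
  have "(f \<longlongrightarrow> f t) (at_right t)"
    using assms by (auto simp: rcll_def continuous_within)
  then have "\<forall>\<^sub>F s in at_right t. f s = f t"
    by (simp add: tendsto_discrete)
  then obtain b where "t < b" "\<And>s. t < s \<Longrightarrow> s < b \<Longrightarrow> f s = f t"
    by (auto simp: eventually_at_right[of t "t + 1"])
  with that[of b] show ?thesis by (metis order_le_less)
qed

lemma left_lim_nat_eqI:
  fixes f :: "real \<Rightarrow> nat"
  assumes "rcll f" "0 < t" "r < t" "\<And>s. r < s \<Longrightarrow> s < t \<Longrightarrow> f s = k"
  shows "left_lim f t = k"
proof -
  obtain b where "b < t" "0 \<le> b" "\<And>s. b < s \<Longrightarrow> s < t \<Longrightarrow> f s = left_lim f t"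
    using rcll_left_lim_nat[OF assms(1,2)] by blast
  moreover have "r < (max b r + t) / 2" "b < (max b r + t) / 2" "(max b r + t) / 2 < t"
    using \<open>b < t\<close> assms(3) by auto
  ultimately show ?thesis
    using assms(4) by metis
qed

text \<open>In the increment formula over \<open>(s, t]\<close> let \<open>s\<close> increase to
  \<open>t\<close>: the value at \<open>s\<close> tends to the left limit, and the strips shrink to
  the line \<open>{t} \<times> UNIV\<close>, where integrability allows passing to the
  limit.\<close>

lemma jump_eq_integral:
  fixes f :: "real \<Rightarrow> real"
  assumes p: "sets p = sets half_plane"
    and int: "\<And>t. 0 \<le> t \<Longrightarrow> set_integrable p ({0<..t} \<times> UNIV) k"
    and f: "\<And>s t. 0 \<le> s \<Longrightarrow> s \<le> t \<Longrightarrow> f t = f s + (LINT z:({s<..t} \<times> UNIV)|p. k z)"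
    and t: "0 < t" and lim: "(f \<longlongrightarrow> l) (at_left t)"
  shows "f t = l + (LINT z:({t} \<times> UNIV)|p. k z)"
proof -
  define s where "s m = t - t / (real m + 2)" for m :: nat
  have s: "0 \<le> s m" "s m < t" for m
    using t by (auto simp: s_def field_simps)
  have "s \<longlonglongrightarrow> t"
    unfolding s_def by real_asymp
  then have "filterlim s (at_left t) sequentially"
    using s by (auto simp: filterlim_at intro!: always_eventually less_imp_neq)
  then have 1: "(\<lambda>m. f (s m)) \<longlonglongrightarrow> l"
    by (rule filterlim_compose[OF lim])
  have mono: "s m \<le> s m'" if "m \<le> m'" for m m'
    using that t by (auto simp: s_def intro!: divide_left_mono mult_pos_pos)
  have "(\<lambda>m. LINT z:({s m<..t} \<times> UNIV)|p. k z) \<longlonglongrightarrow> (LINT z:(\<Inter>m. {s m<..t} \<times> UNIV)|p. k z)"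
  proof (rule set_integral_cont_down)
    show "{s m<..t} \<times> UNIV \<in> sets p" for m
      unfolding p using s(1)[of m] by (intro Times_in_half_plane) (auto intro: order_trans)
    then show "set_integrable p ({s 0<..t} \<times> UNIV) k"
      using s(1)[of 0] t by (intro set_integrable_subset[OF int[of t]]) auto
    show "decseq (\<lambda>m. {s m<..t} \<times> UNIV)"
      using mono by (force simp: decseq_def)
  qed
  also have "(\<Inter>m. {s m<..t} \<times> (UNIV :: real set)) = {t} \<times> UNIV"
  proof -
    have "u = t" if "\<And>m. s m < u" "u \<le> t" for u
      using LIMSEQ_le_const2[OF \<open>s \<longlonglongrightarrow> t\<close>, of u] that by (meson less_imp_le order_antisym)
    then show ?thesis
      using s by auto
  qed
  finally have "(\<lambda>m. f (s m) + (LINT z:({s m<..t} \<times> UNIV)|p. k z)) \<longlonglongrightarrow> l + (LINT z:({t} \<times> UNIV)|p. k z)"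
    by (intro tendsto_add 1)
  moreover have "f (s m) + (LINT z:({s m<..t} \<times> UNIV)|p. k z) = f t" for m
    using f[of "s m" t] s[of m] by simp
  ultimately show ?thesis
    by (simp add: LIMSEQ_const_iff)
qed

lemma tendsto_real_of_nat:
  fixes f :: "'a \<Rightarrow> nat"
  assumes "(f \<longlongrightarrow> l) F"
  shows "((\<lambda>t. real (f t)) \<longlongrightarrow> real l) F"
  using assms by (auto simp: tendsto_discrete elim!: eventually_mono intro!: tendsto_eventually)

text \<open>A single outcome with everything random frozen: \<open>p\<close> is the realized point
  measure. Integer masses and the absence of simultaneous atoms are put in as assumptions, to be
  supplied almost surely later.\<close>

locale thinning_path = thinning_rates +
  fixes p :: "(real \<times> real) measure" and x0 :: nat and y0 :: real
    and x :: "real \<Rightarrow> nat" and y :: "real \<Rightarrow> real" and n :: "real \<Rightarrow> nat"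
  assumes sets_p: "sets p = sets half_plane"
    and p_integer: "\<And>A. A \<in> sets half_plane \<Longrightarrow> emeasure p A \<in> range of_nat \<union> {\<infinity>}"
    and p_simple: "\<And>t. 0 < t \<Longrightarrow> emeasure p ({t} \<times> UNIV) \<le> 1"
    and rcll_x: "rcll x" and rcll_y: "rcll y" and rcll_n: "rcll n"
    and x_states: "\<And>t. 0 \<le> t \<Longrightarrow> x t \<in> states" and y_nonneg: "\<And>t. 0 \<le> t \<Longrightarrow> 0 \<le> y t"
    and solves: "solves_system (h_Lam prec lam lamt) (g_Lam prec lam lamt) p x0 y0 x y n"
begin

abbreviation "h \<equiv> at_left_limits (h_Lam prec lam lamt) x y n"
abbreviation "g \<equiv> at_left_limits (g_Lam prec lam lamt) x y n"
abbreviation "strip s t \<equiv> {s::real<..t} \<times> (UNIV :: real set)"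
abbreviation "T \<equiv> jump_time x"

section \<open>Increments over strips and jumps at single times of one path\<close>

lemma strip_sets [simp]: "0 \<le> s \<Longrightarrow> strip s t \<in> sets p"
  unfolding sets_p by (intro Times_in_half_plane) auto

lemma point_sets [simp]: "0 < t \<Longrightarrow> A \<in> sets borel \<Longrightarrow> {t} \<times> A \<in> sets p"
  unfolding sets_p by (intro Times_in_half_plane) auto

lemma left_x_states: "0 < t \<Longrightarrow> left_lim x t \<in> states"
proof -
  assume t: "0 < t"
  then obtain b where "b < t" "0 \<le> b" "\<And>s. b < s \<Longrightarrow> s < t \<Longrightarrow> x s = left_lim x t"
    using rcll_left_lim_nat[OF rcll_x] by blast
  with x_states[of "(b + t) / 2"] show ?thesis by force
qed

lemma left_y_nonneg: "0 < t \<Longrightarrow> 0 \<le> left_lim y t"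
  by (rule rcll_left_lim_nonneg[OF rcll_y _ y_nonneg])

lemma g_eq: "0 < t \<Longrightarrow> g (t, v) =
    indicator (\<Union>b\<in>states - {left_lim x t}. L (left_lim x t) b (left_lim y t) (left_lim n t)) v"
  by (simp add: at_left_limits_def g_Lam_eq_indicator left_x_states left_y_nonneg)

lemma g_nonneg: "0 < t \<Longrightarrow> 0 \<le> g (t, v)"
  by (simp add: g_eq)

lemma h_zero:
  assumes "0 < t" "g (t, v) = 0"
  shows "h (t, v) = 0"
proof -
  have "v \<notin> (\<Union>b\<in>states - {left_lim x t}. L (left_lim x t) b (left_lim y t) (left_lim n t))"
    using assms unfolding g_eq[OF assms(1)] by (simp add: indicator_eq_0_iff)
  from h_Lam_outside[OF this] show ?thesis
    by (simp add: at_left_limits_def)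
qed

lemma
  assumes "0 \<le> t"
  shows integrable_h: "set_integrable p (strip 0 t) h"
    and integrable_g: "set_integrable p (strip 0 t) g"
    and integrable_yg: "set_integrable p (strip 0 t) (\<lambda>z. left_lim y (fst z) * g z)"
  using solves assms unfolding solves_system_def by blast+

lemma
  assumes "0 \<le> t"
  shows x_eq0: "real (x t) = real x0 + (LINT z:strip 0 t|p. h z)"
    and y_eq0: "y t = y0 + t - (LINT z:strip 0 t|p. left_lim y (fst z) * g z)"
    and n_eq0: "real (n t) = (LINT z:strip 0 t|p. g z)"
  using solves assms unfolding solves_system_def by blast+

lemma integral_strip_split:
  assumes k: "set_integrable p (strip 0 t) (k :: _ \<Rightarrow> real)" and "0 \<le> s" "s \<le> t"
  shows "(LINT z:strip 0 t|p. k z) = (LINT z:strip 0 s|p. k z) + (LINT z:strip s t|p. k z)"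
proof -
  have eq: "strip 0 t = strip 0 s \<union> strip s t"
    using assms by auto
  show ?thesis
    unfolding eq using assms
    by (intro set_integral_Un set_integrable_subset[OF k]) auto
qed

text \<open>Subtracting the drift \<open>t\<close> from the age leaves a pure jump function, so that
  all three equations have the shape that \<open>jump_eq_integral\<close> takes.\<close>

lemma
  assumes "0 \<le> s" "s \<le> t"
  shows x_increment: "real (x t) = real (x s) + (LINT z:strip s t|p. h z)"
    and y_increment: "y t - t = (y s - s) + (LINT z:strip s t|p. - (left_lim y (fst z) * g z))"
    and n_increment: "real (n t) = real (n s) + (LINT z:strip s t|p. g z)"
proof -
  have t: "0 \<le> t" using assms by simp
  note e = integral_strip_split[OF integrable_h[OF t] assms]
     integral_strip_split[OF integrable_yg[OF t] assms] integral_strip_split[OF integrable_g[OF t] assms]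
  show "real (x t) = real (x s) + (LINT z:strip s t|p. h z)"
    using e x_eq0[OF t] x_eq0[OF assms(1)] by simp
  show "real (n t) = real (n s) + (LINT z:strip s t|p. g z)"
    using e n_eq0[OF t] n_eq0[OF assms(1)] by simp
  have "(LINT z:strip s t|p. - (left_lim y (fst z) * g z)) = - (LINT z:strip s t|p. left_lim y (fst z) * g z)"
    by (simp add: set_lebesgue_integral_def)
  then show "y t - t = (y s - s) + (LINT z:strip s t|p. - (left_lim y (fst z) * g z))"
    using e y_eq0[OF t] y_eq0[OF assms(1)] by simp
qed

lemma
  assumes t: "0 < t"
  shows x_jump: "real (x t) = real (left_lim x t) + (LINT z:({t} \<times> UNIV)|p. h z)"
    and y_jump: "y t = left_lim y t + (LINT z:({t} \<times> UNIV)|p. - (left_lim y (fst z) * g z))"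
    and n_jump: "real (n t) = real (left_lim n t) + (LINT z:({t} \<times> UNIV)|p. g z)"
proof -
  show "real (x t) = real (left_lim x t) + (LINT z:({t} \<times> UNIV)|p. h z)"
    by (rule jump_eq_integral[OF sets_p integrable_h x_increment t])
       (use rcll_left_lim[OF rcll_x t] in \<open>auto intro: tendsto_real_of_nat\<close>)
  show "real (n t) = real (left_lim n t) + (LINT z:({t} \<times> UNIV)|p. g z)"
    by (rule jump_eq_integral[OF sets_p integrable_g n_increment t])
       (use rcll_left_lim[OF rcll_n t] in \<open>auto intro: tendsto_real_of_nat\<close>)
  have "y t - t = (left_lim y t - t) + (LINT z:({t} \<times> UNIV)|p. - (left_lim y (fst z) * g z))"
  proof (rule jump_eq_integral[OF sets_p _ y_increment t])
    show "set_integrable p (strip 0 s) (\<lambda>z. - (left_lim y (fst z) * g z))" if "0 \<le> s" for s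
      using integrable_yg[OF that] by (simp add: set_integrable_def)
    show "((\<lambda>t. y t - t) \<longlongrightarrow> left_lim y t - t) (at_left t)"
      by (intro tendsto_intros rcll_left_lim[OF rcll_y t])
  qed
  then show "y t = left_lim y t + (LINT z:({t} \<times> UNIV)|p. - (left_lim y (fst z) * g z))"
    by simp
qed

lemma point_mass_cases:
  assumes "0 < t" "A \<in> sets borel"
  shows "emeasure p ({t} \<times> A) = 0 \<or> emeasure p ({t} \<times> A) = 1"
proof -
  have le: "emeasure p ({t} \<times> A) \<le> 1"
    using assms by (intro order_trans[OF emeasure_mono p_simple]) auto
  have "emeasure p ({t} \<times> A) \<in> range of_nat \<union> {\<infinity>}"
    using point_sets[OF assms] p_integer by (simp add: sets_p)
  then obtain k :: nat where k: "emeasure p ({t} \<times> A) = of_nat k"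
    using le by (auto simp: top_unique)
  with le have "k \<le> 1"
    by (metis of_nat_1 of_nat_le_iff)
  with k show ?thesis
    by (cases k) auto
qed

text \<open>At a single time the point measure has mass 0 or 1, and everything follows from where
  the possible atom lies. If it lies in the interval of a target \<open>b\<close>, the integrals
  reduce to one value: \<open>x\<close> moves by \<open>b - a\<close>, \<open>n\<close> by 1, and
  \<open>y\<close> by \<open>- s\<close>, which resets the age to 0.\<close>

lemma jump_cases:
  assumes t: "0 < t"
  defines "a \<equiv> left_lim x t" and "s \<equiv> left_lim y t" and "m \<equiv> left_lim n t"
  obtains (stay) "n t = m" "x t = a" "y t = s" "emeasure p ({t} \<times> (\<Union>b\<in>states - {a}. L a b s m)) = 0"
  | (jump) b where "b \<in> states - {a}" "n t = Suc m" "x t = b" "y t = 0"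
      "emeasure p ({t} \<times> L a b s m) = 1" "emeasure p ({t} \<times> (- L a b s m)) = 0"
proof -
  let ?U = "\<Union>b\<in>states - {a}. L a b s m"
  have a: "a \<in> states" and s: "0 \<le> s"
    using left_x_states left_y_nonneg t by (auto simp: a_def s_def)
  have [simp]: "?U \<in> sets borel"
    using Lam_borel by (intro sets.countable_UN') auto
  have g: "g (t, v) = indicator ?U v" for v
    using g_eq[OF t] by (simp add: a_def s_def m_def)
  have h: "h (t, v) = h_Lam prec lam lamt a s m v" for v
    by (simp add: at_left_limits_def a_def s_def m_def)
  have int_g: "(LINT z:({t} \<times> UNIV)|p. g z) = measure p ({t} \<times> ?U)"
  proof -
    have "(LINT z:({t} \<times> UNIV)|p. g z) = (LINT z|p. indicator ({t} \<times> ?U) z)"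
      unfolding set_lebesgue_integral_def
      by (intro Bochner_Integration.integral_cong refl) (auto simp: g indicator_def)
    also have "\<dots> = measure p ({t} \<times> ?U)"
      using t sets.sets_into_space[OF point_sets[OF t, of ?U]] by (simp add: Int_absorb2)
    finally show ?thesis .
  qed
  have int_yg: "(LINT z:({t} \<times> UNIV)|p. - (left_lim y (fst z) * g z)) = - s * measure p ({t} \<times> ?U)"
  proof -
    have "(LINT z:({t} \<times> UNIV)|p. - (left_lim y (fst z) * g z)) = (LINT z:({t} \<times> UNIV)|p. - s * g z)"
      unfolding set_lebesgue_integral_def
      by (intro Bochner_Integration.integral_cong refl) (auto simp: s_def split: split_indicator)
    also have "\<dots> = - s * (LINT z:({t} \<times> UNIV)|p. g z)"
      by (rule set_integral_mult_right)
    finally show ?thesis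
      unfolding int_g .
  qed
  show thesis
  proof (cases "emeasure p ({t} \<times> ?U) = 0")
    case True
    have "AE z in p. indicator ({t} \<times> UNIV) z *\<^sub>R h z = 0"
    proof (rule AE_mp[OF AE_not_in])
      show "{t} \<times> ?U \<in> null_sets p"
        using True t by auto
      show "AE z in p. z \<notin> {t} \<times> ?U \<longrightarrow> indicator ({t} \<times> UNIV) z *\<^sub>R h z = 0"
        by (intro AE_I2) (auto simp: h indicator_def intro!: h_Lam_outside)
    qed
    then have "(LINT z:({t} \<times> UNIV)|p. h z) = 0"
      unfolding set_lebesgue_integral_def by (rule integral_eq_zero_AE)
    moreover have "measure p ({t} \<times> ?U) = 0"
      using True by (simp add: measure_def)
    ultimately show thesis
      using x_jump[OF t] y_jump[OF t] n_jump[OF t] int_g int_yg True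
      by (intro stay) (auto simp: a_def s_def m_def)
  next
    case False
    \<comment> \<open>A countable union of null sets is null, so positive mass of the union is
      carried by some single interval.\<close>
    have "\<exists>b\<in>states - {a}. emeasure p ({t} \<times> L a b s m) \<noteq> 0"
    proof (rule ccontr)
      assume "\<not> ?thesis"
      then have "(\<Union>b\<in>states - {a}. {t} \<times> L a b s m) \<in> null_sets p"
        using t Lam_borel by (intro null_sets_UN') (auto simp: null_sets_def)
      moreover have "(\<Union>b\<in>states - {a}. {t} \<times> L a b s m) = {t} \<times> ?U" by auto
      ultimately show False
        using False by auto
    qed
    then obtain b where b: "b \<in> states - {a}" and "emeasure p ({t} \<times> L a b s m) \<noteq> 0"
      by auto
    then have 1: "emeasure p ({t} \<times> L a b s m) = 1"
      using point_mass_cases[OF t Lam_borel] by metis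
    \<comment> \<open>The whole line at time \<open>t\<close> has mass at most 1; once the interval
      of \<open>b\<close> carries 1, nothing remains for its complement.\<close>
    have "emeasure p ({t} \<times> L a b s m) + emeasure p ({t} \<times> (- L a b s m)) = emeasure p ({t} \<times> UNIV)"
      using t Lam_borel by (subst plus_emeasure) (auto intro!: arg_cong[where f="emeasure p"])
    with p_simple[OF t] 1 have 0: "emeasure p ({t} \<times> (- L a b s m)) = 0"
      using point_mass_cases[OF t, of "- L a b s m"] Lam_borel by auto
    have U1: "emeasure p ({t} \<times> ?U) = 1"
      using point_mass_cases[OF t, of ?U] False by simp
    have "AE z in p. indicator ({t} \<times> UNIV) z *\<^sub>R h z = indicator ({t} \<times> L a b s m) z *\<^sub>R (real b - real a)"
    proof (rule AE_mp[OF AE_not_in])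
      show "{t} \<times> (- L a b s m) \<in> null_sets p"
        using 0 t Lam_borel by (auto simp: null_sets_def)
      show "AE z in p. z \<notin> {t} \<times> (- L a b s m) \<longrightarrow>
          indicator ({t} \<times> UNIV) z *\<^sub>R h z = indicator ({t} \<times> L a b s m) z *\<^sub>R (real b - real a)"
        by (intro AE_I2) (use h_Lam_inside[OF a s b] in \<open>auto simp: h indicator_def\<close>)
    qed
    then have "(LINT z:({t} \<times> UNIV)|p. h z) = (LINT z:({t} \<times> L a b s m)|p. real b - real a)"
      unfolding set_lebesgue_integral_def
    proof (rule integral_cong_AE[rotated 2])
      have "set_integrable p ({t} \<times> UNIV) h"
        by (rule set_integrable_subset[OF integrable_h[of t]]) (use t in auto)
      then show "(\<lambda>z. indicator ({t} \<times> UNIV) z *\<^sub>R h z) \<in> borel_measurable p"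
        by (auto simp only: set_integrable_def)
      show "(\<lambda>z. indicator ({t} \<times> L a b s m) z *\<^sub>R (real b - real a)) \<in> borel_measurable p"
        by (intro borel_measurable_scaleR borel_measurable_indicator point_sets t Lam_borel) simp
    qed
    also have "\<dots> = real b - real a"
      using 1 t Lam_borel by (simp add: set_integral_const measure_def)
    finally show thesis
      using x_jump[OF t] y_jump[OF t] n_jump[OF t] int_g int_yg U1 b 0 1
      by (intro jump[of b]) (auto simp: a_def s_def m_def measure_def)
  qed
qed

text \<open>A target always differs from its source, so each counted atom moves \<open>x\<close>.
  This carries \<open>jump_time\<close>, defined by the discontinuities of \<open>x\<close>, over to
  the monotone counter \<open>n\<close>.\<close>

lemma x_jumps_iff: "0 < t \<Longrightarrow> x t \<noteq> left_lim x t \<longleftrightarrow> n t \<noteq> left_lim n t"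
  by (cases t rule: jump_cases) auto

lemma n_jump_cases: "0 < t \<Longrightarrow> n t = left_lim n t \<or> n t = Suc (left_lim n t)"
  by (cases t rule: jump_cases) auto

lemma integral_g_nonneg: "0 \<le> s \<Longrightarrow> 0 \<le> (LINT z:strip s t|p. g z)"
  unfolding set_lebesgue_integral_def
  by (intro Bochner_Integration.integral_nonneg) (auto simp: g_nonneg split: split_indicator)

lemma n_mono: "0 \<le> s \<Longrightarrow> s \<le> t \<Longrightarrow> n s \<le> n t"
  using n_increment[of s t] integral_g_nonneg[of s t] by linarith

lemma AE_g_zero:
  assumes "0 \<le> s" "s \<le> t" "n s = n t"
  shows "AE z in p. z \<in> strip s t \<longrightarrow> g z = 0"
proof -
  have "(LINT z|p. indicator (strip s t) z *\<^sub>R g z) = 0"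
    using n_increment[OF assms(1,2)] assms(3) by (simp add: set_lebesgue_integral_def)
  moreover have "integrable p (\<lambda>z. indicator (strip s t) z *\<^sub>R g z)"
    unfolding set_integrable_def[symmetric]
    by (rule set_integrable_subset[OF integrable_g[of t]]) (use assms in auto)
  moreover have "AE z in p. 0 \<le> indicator (strip s t) z *\<^sub>R g z"
    using assms by (intro AE_I2) (auto simp: g_nonneg split: split_indicator)
  ultimately have "AE z in p. indicator (strip s t) z *\<^sub>R g z = 0"
    by (simp add: integral_nonneg_eq_0_iff_AE)
  then show ?thesis
    by eventually_elim (auto split: split_indicator_asm)
qed

text \<open>A constant counter means that \<open>g\<close> has integral 0 over the strip; being
  nonnegative, it vanishes almost everywhere there, and \<open>h\<close> vanishes wherever
  \<open>g\<close> does.\<close>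

lemma
  assumes "0 \<le> s" "s \<le> t" "n s = n t"
  shows x_const: "x t = x s" and y_linear: "y t = y s + (t - s)"
proof -
  have "AE z in p. indicator (strip s t) z *\<^sub>R h z = 0"
    using AE_g_zero[OF assms]
    by eventually_elim (use assms h_zero in \<open>auto split: split_indicator\<close>)
  then have "(LINT z:strip s t|p. h z) = 0"
    unfolding set_lebesgue_integral_def by (rule integral_eq_zero_AE)
  then show "x t = x s"
    using x_increment[OF assms(1,2)] by simp
  have "AE z in p. indicator (strip s t) z *\<^sub>R (- (left_lim y (fst z) * g z)) = 0"
    using AE_g_zero[OF assms] by eventually_elim (auto split: split_indicator)
  then have "(LINT z:strip s t|p. - (left_lim y (fst z) * g z)) = 0"
    unfolding set_lebesgue_integral_def by (rule integral_eq_zero_AE)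
  then show "y t = y s + (t - s)"
    using y_increment[OF assms(1,2)] by simp
qed

section \<open>Jump times as first passage times of the counter\<close>

lemma n_zero: "n 0 = 0"
  using n_eq0[of 0] by (simp add: set_lebesgue_integral_def)

text \<open>Describes \<open>T k\<close> as the first time at which the counter reaches
  \<open>k\<close>, by induction on \<open>k\<close>. The new passage time is the infimum of the
  times with \<open>Suc k \<le> n\<close>; it is attained, it is a discontinuity of
  \<open>x\<close>, and no earlier discontinuity lies after \<open>T k\<close>.\<close>

lemma jump_time_cases:
  obtains (never) "T k = \<infinity>" "\<And>t. 0 \<le> t \<Longrightarrow> n t < k"
  | (hits) r where "T k = ereal r" "0 \<le> r" "n r = k" "\<And>t. 0 \<le> t \<Longrightarrow> t < r \<Longrightarrow> n t < k"
proof -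
  have "(T k = \<infinity> \<and> (\<forall>t\<ge>0. n t < k)) \<or>
    (\<exists>r. T k = ereal r \<and> 0 \<le> r \<and> n r = k \<and> (\<forall>t. 0 \<le> t \<longrightarrow> t < r \<longrightarrow> n t < k))"
  proof (induction k)
    case 0
    show ?case
      using n_zero by (intro disjI2 exI[of _ 0]) (auto simp: zero_ereal_def)
  next
    case (Suc k)
    show ?case
      using Suc
    proof (elim disjE exE conjE)
      assume "T k = \<infinity>" "\<forall>t\<ge>0. n t < k"
      then show ?thesis
        by (auto simp: less_Suc_eq top_ereal_def)
    next
      fix r assume r: "T k = ereal r" "0 \<le> r" "n r = k" "\<forall>t. 0 \<le> t \<longrightarrow> t < r \<longrightarrow> n t < k"
      let ?J = "{ereal t | t. 0 < t \<and> T k < ereal t \<and> x t \<noteq> left_lim x t}"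
      \<comment> \<open>While the counter has not passed \<open>k\<close> it stays equal to
        \<open>k\<close> from \<open>r\<close> on, so it has no jump at \<open>t\<close>, and hence
        neither has \<open>x\<close>.\<close>
      have no_jump: "x t = left_lim x t" if "r < t" "n t \<le> k" for t
      proof -
        have "n s = k" if "r \<le> s" "s \<le> t" for s
          using n_mono[of r s] n_mono[of s t] r \<open>n t \<le> k\<close> that by simp
        then have "left_lim n t = k" "n t = k"
          using that r by (auto intro!: left_lim_nat_eqI[OF rcll_n, of t r])
        then show ?thesis
          using x_jumps_iff[of t] r that by auto
      qed
      show ?thesis
      proof (cases "\<exists>t\<ge>0. Suc k \<le> n t")
        case False
        then have "n t < Suc k" if "0 \<le> t" for t
          using that by (meson not_less)
        moreover from this have J: "?J = {}"
          using no_jump r by (auto simp: less_Suc_eq_le)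
        have "T (Suc k) = \<infinity>"
          unfolding jump_time.simps J by (simp add: top_ereal_def)
        ultimately show ?thesis
          by blast
      next
        case True
        define W where "W = {t. 0 \<le> t \<and> Suc k \<le> n t}"
        define r' where "r' = Inf W"
        have W: "W \<noteq> {}" "bdd_below W"
          using True by (auto simp: W_def intro!: bdd_belowI[of _ 0])
        have r'0: "0 \<le> r'"
          unfolding r'_def using W by (intro cInf_greatest) (auto simp: W_def)
        \<comment> \<open>Right continuity makes the infimum of \<open>W\<close> a member of
          \<open>W\<close>.\<close>
        have "Suc k \<le> n r'"
        proof -
          obtain b where b: "r' < b" "\<And>s. r' \<le> s \<Longrightarrow> s < b \<Longrightarrow> n s = n r'"
            using rcll_right_nat[OF rcll_n r'0] by blast
          obtain w where "w \<in> W" "w < b"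
            using cInf_lessD[OF W(1), of b] b by (auto simp: r'_def)
          moreover from this have "r' \<le> w"
            using W by (auto simp: r'_def intro: cInf_lower)
          ultimately show ?thesis
            using b(2)[of w] by (auto simp: W_def)
        qed
        have before: "n t < Suc k" if "0 \<le> t" "t < r'" for t
          using cInf_lower[OF _ W(2), of t] that by (auto simp: W_def r'_def not_less[symmetric])
        have "r < r'"
          using n_mono[of r' r] r \<open>Suc k \<le> n r'\<close> r'0 by (meson Suc_n_not_le_n leI order_trans order_eq_refl)
        have "left_lim n r' = k"
        proof (rule left_lim_nat_eqI[OF rcll_n _ \<open>r < r'\<close>])
          show "n s = k" if "r < s" "s < r'" for s
            using before[of s] n_mono[of r s] r that by simp
        qed (use r \<open>r < r'\<close> in simp)
        \<comment> \<open>The counter rises by at most 1, so from the left limit \<open>k\<close> it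
          cannot overshoot.\<close>
        then have n': "n r' = Suc k"
          using n_jump_cases[of r'] \<open>Suc k \<le> n r'\<close> r \<open>r < r'\<close> by auto
        have "Inf ?J = ereal r'"
        proof (rule cInf_eq_minimum)
          show "ereal r' \<in> ?J"
            using x_jumps_iff[of r'] n' \<open>left_lim n r' = k\<close> r \<open>r < r'\<close> by auto
          show "ereal r' \<le> z" if "z \<in> ?J" for z
          proof -
            obtain t where t: "z = ereal t" "r < t" "x t \<noteq> left_lim x t"
              using \<open>z \<in> ?J\<close> r by auto
            then have "\<not> n t \<le> k"
              using no_jump by blast
            with before[of t] t r show ?thesis
              by (cases "t < r'") auto
          qed
        qed
        with n' before r'0 show ?thesis
          by auto
      qed
    qed
  qed
  with that show thesis by blast
qed

end

declare jump_time.simps(2) [simp del]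

text \<open>The part of the half plane where an atom makes the process jump from \<open>i\<close> to \<open>j\<close> at its
  \<open>Suc k\<close>-th jump, after a holding time of at most \<open>c\<close>.\<close>

definition triggering_atoms ::
    "(nat \<times> nat) set \<Rightarrow> (nat \<Rightarrow> nat \<Rightarrow> real \<Rightarrow> nat \<Rightarrow> real) \<Rightarrow> (nat \<Rightarrow> nat \<Rightarrow> real \<Rightarrow> nat \<Rightarrow> real) \<Rightarrow>
     (real \<Rightarrow> nat) \<Rightarrow> (real \<Rightarrow> real) \<Rightarrow> (real \<Rightarrow> nat) \<Rightarrow> nat \<Rightarrow> nat \<Rightarrow> nat \<Rightarrow> real \<Rightarrow> (real \<times> real) set" where
  "triggering_atoms prec lam lamt x y n k i j c =
     {(u, v). 0 < u \<and> left_lim x u = i \<and> left_lim n u = k \<and> left_lim y u \<le> c \<and>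
        v \<in> Lam prec lam lamt i j (left_lim y u) k}"

context thinning_path
begin

text \<open>For positive \<open>k\<close> the counter really jumps at \<open>T k\<close>, and
  \<open>jump_cases\<close> resets the age. \<open>T 0 = 0\<close> is a convention and not a jump;
  there the age is the initial value \<open>y0\<close>.\<close>

lemma y_at_jump_time:
  assumes "1 \<le> k" "T k = ereal r"
  shows "y r = 0"
proof -
  obtain "0 \<le> r" "n r = k" and before: "\<And>t. 0 \<le> t \<Longrightarrow> t < r \<Longrightarrow> n t < k"
    using assms by (cases k rule: jump_time_cases) auto
  then have "0 < r"
    using n_zero assms(1) by (cases "r = 0") auto
  then obtain b where b: "b < r" "0 \<le> b" "\<And>s. b < s \<Longrightarrow> s < r \<Longrightarrow> n s = left_lim n r"
    using rcll_left_lim_nat[OF rcll_n] by blast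
  have "left_lim n r < k"
    using b(3)[of "(b + r) / 2"] before[of "(b + r) / 2"] b(1,2) by simp
  with \<open>0 < r\<close> \<open>n r = k\<close> show ?thesis
    by (cases r rule: jump_cases) auto
qed

lemma before_next_jump:
  assumes k: "1 \<le> k" "T k = ereal r" and s: "r \<le> s" "ereal s < T (Suc k)"
  shows "n s = k" "x s = x r" "y s = s - r"
proof -
  obtain r: "0 \<le> r" "n r = k"
    using k by (cases k rule: jump_time_cases) auto
  have "n s < Suc k"
    using s r(1) by (cases "Suc k" rule: jump_time_cases) auto
  with n_mono[of r s] r s show "n s = k"
    by simp
  then show "x s = x r" "y s = s - r"
    using x_const[of r s] y_linear[of r s] y_at_jump_time[OF k] r s by auto
qed

text \<open>The right end \<open>t = T (Suc k)\<close> is included: the atom that causes the next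
  jump sits there, and the left limits at that time still show the old state and its full holding
  time.\<close>

lemma left_limits_before_next_jump:
  assumes k: "1 \<le> k" "T k = ereal r" and t: "r < t" "ereal t \<le> T (Suc k)"
  shows "left_lim n t = k" "left_lim x t = x r" "left_lim y t = t - r"
proof -
  obtain r: "0 \<le> r" "n r = k"
    using k by (cases k rule: jump_time_cases) auto
  have t0: "0 < t"
    using r t by simp
  have lt: "ereal s < T (Suc k)" if "s < t" for s
    using that t(2) by (metis less_ereal.simps(1) less_le_trans)
  show "left_lim n t = k"
    by (rule left_lim_nat_eqI[OF rcll_n t0 t(1)], rule before_next_jump(1)[OF k]) (auto intro: lt)
  show "left_lim x t = x r"
    by (rule left_lim_nat_eqI[OF rcll_x t0 t(1)], rule before_next_jump(2)[OF k]) (auto intro: lt)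
  have "\<forall>\<^sub>F s in at_left t. y s = s - r"
    unfolding eventually_at_left[OF t(1)]
    by (intro exI[of _ r] conjI allI impI t before_next_jump(3)[OF k] lt) auto
  then have "(y \<longlongrightarrow> t - r) (at_left t) \<longleftrightarrow> ((\<lambda>s. s - r) \<longlongrightarrow> t - r) (at_left t)"
    by (intro tendsto_cong)
  then have "(y \<longlongrightarrow> t - r) (at_left t)"
    by (auto intro!: tendsto_intros)
  with rcll_left_lim[OF rcll_y t0] show "left_lim y t = t - r"
    using tendsto_unique trivial_limit_at_left_real by blast
qed

text \<open>Just before \<open>t\<close> the counter equals \<open>k\<close>, so \<open>T k\<close>
  has been passed, and a value of \<open>T (Suc k)\<close> below \<open>t\<close> would contradict
  monotonicity of the counter.\<close>

lemma left_count_eqD: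
  assumes "0 < t" "left_lim n t = k"
  obtains r where "T k = ereal r" "0 \<le> r" "r < t" "ereal t \<le> T (Suc k)"
proof -
  obtain b where b: "b < t" "0 \<le> b" "\<And>s. b < s \<Longrightarrow> s < t \<Longrightarrow> n s = k"
    using rcll_left_lim_nat[OF rcll_n assms(1)] assms(2) by blast
  let ?s = "(b + t) / 2"
  have s: "n ?s = k" "0 \<le> ?s" "?s < t"
    using b by auto
  show thesis
  proof (cases k rule: jump_time_cases)
    case never
    then have "n ?s < k" using s(2) by blast
    with s(1) show ?thesis by simp
  next
    case (hits r)
    have "r \<le> ?s"
      using hits(4)[of ?s] s by (cases "?s < r") auto
    moreover have "ereal t \<le> T (Suc k)"
    proof (cases "Suc k" rule: jump_time_cases)
      case (hits r')
      have "t \<le> r'"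
      proof (rule ccontr)
        assume "\<not> t \<le> r'"
        then have "n ((max b r' + t) / 2) = k"
          using b by (intro b(3)) auto
        moreover have "n r' \<le> n ((max b r' + t) / 2)"
          using hits b \<open>\<not> t \<le> r'\<close> by (intro n_mono) auto
        ultimately show False
          using hits by simp
      qed
      with hits show ?thesis by simp
    qed simp
    ultimately show ?thesis
      using hits s that by auto
  qed
qed

section \<open>Mass and area of the triggering set of one path\<close>

abbreviation "trigger_set \<equiv> triggering_atoms prec lam lamt x y n"

text \<open>The definition by left limits is what makes the set predictable; this form by jump times
  is what allows its mass and area to be computed.\<close>

lemma trigger_set_eq:
  assumes "1 \<le> k"
  shows "trigger_set k i j c = {(u, v). \<exists>r. T k = ereal r \<and> x r = i \<and> r < u \<and> ereal u \<le> T (Suc k) \<and>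
     u - r \<le> c \<and> v \<in> L i j (u - r) k}" (is "_ = ?R")
proof (intro set_eqI iffI)
  fix z assume z: "z \<in> trigger_set k i j c"
  obtain u v where [simp]: "z = (u, v)" by (cases z)
  have u: "0 < u" "left_lim n u = k"
    using z by (auto simp: triggering_atoms_def)
  from left_count_eqD[OF this] obtain r where r: "T k = ereal r" "0 \<le> r" "r < u" "ereal u \<le> T (Suc k)"
    by blast
  note left_limits_before_next_jump[OF assms r(1,3,4)]
  with r z show "z \<in> ?R"
    by (auto simp: triggering_atoms_def)
next
  fix z assume "z \<in> ?R"
  then obtain u v r where [simp]: "z = (u, v)" and r: "T k = ereal r" "x r = i" "r < u" "ereal u \<le> T (Suc k)"
     "u - r \<le> c" "v \<in> L i j (u - r) k"
    by auto
  have "0 \<le> r"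
    using r by (cases k rule: jump_time_cases) auto
  with left_limits_before_next_jump[OF assms r(1,3,4)] r show "z \<in> trigger_set k i j c"
    by (auto simp: triggering_atoms_def)
qed

lemma next_state:
  assumes "1 \<le> k" "jumps_to x k i" "T (Suc k) < \<infinity>"
  shows "\<exists>j\<in>states - {i}. jumps_to x (Suc k) j"
proof -
  obtain r where r: "T k = ereal r" "0 \<le> r" "n r = k" "x r = i"
    using assms(2) by (cases k rule: jump_time_cases) (auto simp: jumps_to_def)
  obtain r' where r': "T (Suc k) = ereal r'" "0 \<le> r'" "n r' = Suc k"
    using assms(3) by (cases "Suc k" rule: jump_time_cases) auto
  have "r < r'"
    using r r' n_mono[of r' r] by (cases "r < r'") auto
  then have "left_lim n r' = k" "left_lim x r' = i"
    using left_limits_before_next_jump[OF assms(1) r(1) \<open>r < r'\<close>] r r' by simp_all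
  moreover have "0 < r'"
    using r \<open>r < r'\<close> by simp
  ultimately have "x r' \<noteq> i"
    using x_jumps_iff[of r'] r' by simp
  with r' x_states[of r'] show ?thesis
    by (auto simp: jumps_to_def)
qed

text \<open>For fixed \<open>t\<close> the right side depends on the counter at time
  \<open>t\<close> alone; this is the source of the measurability of the jump times.\<close>

lemma jump_time_le_iff:
  assumes "0 \<le> t"
  shows "T k \<le> ereal t \<longleftrightarrow> k \<le> n t"
proof (cases k rule: jump_time_cases)
  case never
  with assms show ?thesis by (simp add: not_le)
next
  case (hits r)
  show ?thesis
  proof (cases "r \<le> t")
    case True
    then show ?thesis using hits n_mono[of r t] by simp
  next
    case False
    then show ?thesis using hits(1) hits(4)[OF assms] by simp
  qed
qed

lemma jump_time_nonneg: "0 \<le> T k"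
  by (cases k rule: jump_time_cases) auto

text \<open>Strictly before \<open>T (Suc k)\<close> an atom in the set would have
  \<open>g = 1\<close> and be counted, which is impossible while \<open>n\<close> is constant. So
  only the line at \<open>T (Suc k)\<close> can carry mass, and \<open>jump_cases\<close> decides
  it.\<close>

lemma trigger_mass:
  assumes k: "1 \<le> k" and ij: "(i, j) \<in> state_pairs"
    and S: "trigger_set k i j c \<in> sets half_plane"
  shows "emeasure p (trigger_set k i j c) =
    (if jumps_to x k i \<and> jumps_to x (Suc k) j \<and> T (Suc k) - T k \<le> ereal c then 1 else 0)"
proof (cases "jumps_to x k i")
  case False
  then have "trigger_set k i j c = {}"
    unfolding trigger_set_eq[OF k] by (auto simp: jumps_to_def)
  with False show ?thesis by simp
next
  case True
  let ?S = "trigger_set k i j c"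
  obtain r where r: "T k = ereal r" "0 \<le> r" "n r = k"
    using True by (cases k rule: jump_time_cases) (auto simp: jumps_to_def)
  have xr: "x r = i"
    using True r by (simp add: jumps_to_def)
  have j: "j \<in> states - {i}"
    using ij by (auto simp: state_pairs_def)
  have null: "AE z in p. z \<in> strip r t \<longrightarrow> z \<notin> ?S" if t: "r \<le> t" "ereal t < T (Suc k)" for t
  proof -
    have "n r = n t"
      using before_next_jump(1)[OF k r(1) t] r by simp
    from AE_g_zero[OF r(2) t(1) this] show ?thesis
    proof eventually_elim
      case (elim z)
      show ?case
      proof (intro impI notI)
        assume z: "z \<in> strip r t" "z \<in> ?S"
        obtain u v where uv: "z = (u, v)" by (cases z)
        have "0 < u" "v \<in> L (left_lim x u) j (left_lim y u) (left_lim n u)" "left_lim x u = i"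
          using z by (auto simp: uv triggering_atoms_def)
        then have "g z = 1"
          using j by (auto simp: uv g_eq indicator_def)
        with elim z show False by simp
      qed
    qed
  qed
  show ?thesis
  proof (cases "Suc k" rule: jump_time_cases)
    case never
    \<comment> \<open>With no further jump, countably many bounded strips exhaust the time after
      \<open>r\<close>, so their null sets can be united.\<close>
    have "AE z in p. \<forall>m::nat. z \<in> strip r (r + real m) \<longrightarrow> z \<notin> ?S"
      unfolding AE_all_countable using never null by simp
    then have "AE z in p. z \<notin> ?S"
    proof eventually_elim
      case (elim z)
      show ?case
      proof
        assume z: "z \<in> ?S"
        obtain m where "fst z < r + real m"
          using reals_Archimedean2[of "fst z - r"] by (auto simp: algebra_simps)
        moreover have "r < fst z"
          using z r(1) by (auto simp: trigger_set_eq[OF k])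
        ultimately have "z \<in> strip r (r + real m)"
          by (cases z) auto
        with elim z show False by blast
      qed
    qed
    then have "emeasure p ?S = 0"
      using S by (subst emeasure_eq_AE[of ?S "{}"]) (auto simp: sets_p)
    with never show ?thesis
      by (simp add: jumps_to_def)
  next
    case (hits r')
    have "r < r'"
      using hits r n_mono[of r' r] by (cases "r < r'") auto
    let ?P = "{r'} \<times> L i j (r' - r) k"
    have AE1: "AE z in p. z \<in> ?S \<longrightarrow> fst z = r'"
    proof -
      \<comment> \<open>The right ends of these strips increase to \<open>r'\<close> without
        reaching it; together the strips cover all times strictly between \<open>r\<close> and
        \<open>r'\<close>.\<close>
      have "AE z in p. \<forall>m::nat. z \<in> strip r (r' - (r' - r) / (real m + 1)) \<longrightarrow> z \<notin> ?S"
        unfolding AE_all_countable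
      proof
        fix m :: nat
        have "(r' - r) / (real m + 1) \<le> r' - r" "0 < (r' - r) / (real m + 1)"
          using \<open>r < r'\<close> divide_left_mono[of 1 "real m + 1" "r' - r"] by auto
        then show "AE z in p. z \<in> strip r (r' - (r' - r) / (real m + 1)) \<longrightarrow> z \<notin> ?S"
          using hits by (intro null) auto
      qed
      then show ?thesis
      proof eventually_elim
        case (elim z)
        show ?case
        proof (intro impI, rule ccontr)
          assume z: "z \<in> ?S" "fst z \<noteq> r'"
          obtain u v where uv: "z = (u, v)" by (cases z)
          have u: "r < u" "u < r'"
            using z hits r by (auto simp: uv trigger_set_eq[OF k])
          obtain m :: nat where "(r' - r) / (r' - u) < real m"
            using reals_Archimedean2 by blast
          then have "(r' - r) / (r' - u) \<le> real m + 1"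
            by simp
          then have "(r' - r) / (real m + 1) \<le> r' - u"
            using u by (simp add: field_simps)
          then have "z \<in> strip r (r' - (r' - r) / (real m + 1))"
            using u by (auto simp: uv)
          with elim z show False by blast
        qed
      qed
    qed
    have r'0: "0 < r'"
      using r \<open>r < r'\<close> by simp
    have at: "(r', v) \<in> ?S \<longleftrightarrow> r' - r \<le> c \<and> v \<in> L i j (r' - r) k" for v
      using hits r xr \<open>r < r'\<close> by (auto simp: trigger_set_eq[OF k])
    have eq: "emeasure p ?S = emeasure p (if r' - r \<le> c then ?P else {})"
    proof (rule emeasure_eq_AE)
      show "AE z in p. z \<in> ?S \<longleftrightarrow> z \<in> (if r' - r \<le> c then ?P else {})"
        using AE1
      proof eventually_elim
        case (elim z)
        obtain u v where z: "z = (u, v)" by (cases z)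
        show ?case
        proof (cases "u = r'")
          case True
          show ?thesis unfolding z True at by simp
        next
          case False
          with elim show ?thesis by (auto simp: z)
        qed
      qed
      show "?S \<in> sets p" "(if r' - r \<le> c then ?P else {}) \<in> sets p"
        using S r'0 Lam_borel by (simp_all add: sets_p[symmetric])
    qed
    have ll: "left_lim n r' = k" "left_lim x r' = i" "left_lim y r' = r' - r"
      using left_limits_before_next_jump[OF k r(1) \<open>r < r'\<close>] hits(1) xr by simp_all
    have "emeasure p ?P = (if x r' = j then 1 else 0)"
    proof (cases rule: jump_cases[OF r'0, case_names stay jump])
      case stay
      then show ?thesis using ll hits by simp
    next
      case (jump b)
      show ?thesis
      proof (cases "b = j")
        case True
        then show ?thesis using jump ll by simp
      next
        case False
        \<comment> \<open>The atom chose the target \<open>b\<close>; intervals of different targets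
          are disjoint, so the interval of \<open>j\<close> lies in the part of the line without
          mass.\<close>
        have "?P \<subseteq> {r'} \<times> (- L i b (r' - r) k)"
          using Lam_disjoint[of i "r' - r" b j k] False jump ll j \<open>r < r'\<close> ij
          by (auto simp: state_pairs_def)
        then have "emeasure p ?P \<le> emeasure p ({r'} \<times> (- L i b (r' - r) k))"
          using r'0 Lam_borel by (intro emeasure_mono) auto
        with jump ll False show ?thesis by simp
      qed
    qed
    then show ?thesis
      using True hits r eq by (auto simp: jumps_to_def)
  qed
qed

text \<open>Integrating over time first, the section at \<open>r + s\<close> is the interval for age
  \<open>s\<close>, of length \<open>lam i j s k\<close>, for as long as the path is still
  waiting.\<close>

lemma trigger_area:
  assumes k: "1 \<le> k" and ij: "(i, j) \<in> state_pairs"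
    and S: "trigger_set k i j c \<in> sets half_plane"
  shows "emeasure lborel (trigger_set k i j c) =
    (if jumps_to x k i then
       \<integral>\<^sup>+s\<in>{0..c}. (if ereal s < T (Suc k) - T k then ennreal (lam i j s k) else 0) \<partial>lborel else 0)"
proof (cases "jumps_to x k i")
  case False
  then have "trigger_set k i j c = {}"
    unfolding trigger_set_eq[OF k] by (auto simp: jumps_to_def)
  with False show ?thesis by simp
next
  case True
  let ?S = "trigger_set k i j c"
  obtain r where r: "T k = ereal r" "0 \<le> r" "x r = i"
    using True by (cases k rule: jump_time_cases) (auto simp: jumps_to_def)
  have S_eq: "(r + s, v) \<in> ?S \<longleftrightarrow> 0 < s \<and> s \<le> c \<and> ereal s \<le> T (Suc k) - T k \<and> v \<in> L i j s k" for s v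
    using r by (cases "T (Suc k)") (auto simp: trigger_set_eq[OF k] algebra_simps)
  have [measurable]: "?S \<in> sets (lborel \<Otimes>\<^sub>M lborel)"
    using S unfolding lborel_prod by (simp add: sets_half_plane_iff)
  have "emeasure lborel ?S = emeasure (lborel \<Otimes>\<^sub>M lborel) ?S"
    by (simp add: lborel_prod)
  also have "\<dots> = (\<integral>\<^sup>+u. emeasure lborel (Pair u -` ?S) \<partial>lborel)"
    by (rule lborel.emeasure_pair_measure_alt) measurable
  \<comment> \<open>Substitution \<open>u = r + s\<close>: from clock time to age.\<close>
  also have "\<dots> = (\<integral>\<^sup>+s. emeasure lborel (Pair (r + 1 * s) -` ?S) \<partial>lborel)"
    by (subst nn_integral_real_affine[where c=1 and t=r])
       (auto intro!: lborel.measurable_emeasure_Pair)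
  also have "\<dots> = (\<integral>\<^sup>+s\<in>{0..c}. (if ereal s < T (Suc k) - T k then ennreal (lam i j s k) else 0) \<partial>lborel)"
  proof (rule nn_integral_cong_AE)
    have i: "i \<in> states"
      using ij by (auto simp: state_pairs_def)
    \<comment> \<open>At age 0 the section is empty although \<open>{0..c}\<close> may contain 0,
      and at the holding time itself the set uses a weak inequality where the integrand uses a
      strict one. An infinite holding time gives the harmless point 0.\<close>
    have "AE s in lborel. s \<notin> {0, real_of_ereal (T (Suc k) - T k)}"
      by (intro AE_not_in finite_imp_null_set_lborel) auto
    with AE_left_end_finite[OF i, of j k]
    show "AE s in lborel. emeasure lborel (Pair (r + 1 * s) -` ?S) =
      (if ereal s < T (Suc k) - T k then ennreal (lam i j s k) else 0) * indicator {0..c} s"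
    proof eventually_elim
      case (elim s)
      have le_iff: "ereal s \<le> T (Suc k) - T k \<longleftrightarrow> ereal s < T (Suc k) - T k"
        using elim(2) by (cases "T (Suc k) - T k") auto
      have "emeasure lborel (L i j s k) = ennreal (lam i j s k)" if "0 \<le> s"
        using elim(1) that lam_nonneg[OF ij that, of k] by (simp add: Lam_eq_interval)
      moreover have "Pair (r + 1 * s) -` ?S =
          (if 0 < s \<and> s \<le> c \<and> ereal s < T (Suc k) - T k then L i j s k else {})"
        using S_eq le_iff by auto
      ultimately show ?case
        using elim(2) by (auto simp: indicator_def)
    qed
  qed
  finally show ?thesis
    using True by simp
qed

end

section \<open>Poisson random measures and the compensation formula\<close>

lemma half_plane_Times_bounded:
  assumes "B \<in> sets borel" "B \<subseteq> {c..d}" "0 \<le> a" "a \<le> b"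
  shows "{a<..b} \<times> B \<in> sets half_plane" "emeasure half_plane ({a<..b} \<times> B) < \<infinity>"
    "emeasure half_plane ({a<..b} \<times> B) = ennreal (b - a) * emeasure lborel B"
proof -
  show S: "{a<..b} \<times> B \<in> sets half_plane"
    using assms by (intro Times_in_half_plane) auto
  have "emeasure half_plane ({a<..b} \<times> B) = emeasure lborel ({a<..b} \<times> B)"
    using S by (rule half_plane_emeasure)
  also have "\<dots> = emeasure (lborel \<Otimes>\<^sub>M lborel) ({a<..b} \<times> B)"
    by (simp add: lborel_prod)
  also have "\<dots> = ennreal (b - a) * emeasure lborel B"
    using assms by (subst lborel.emeasure_pair_measure_Times) auto
  finally show eq: "emeasure half_plane ({a<..b} \<times> B) = ennreal (b - a) * emeasure lborel B" .
  have "emeasure lborel B \<le> emeasure lborel {c..d}"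
    using assms by (intro emeasure_mono) auto
  also have "\<dots> < \<infinity>" by (simp add: emeasure_lborel_Icc_eq)
  finally show "emeasure half_plane ({a<..b} \<times> B) < \<infinity>"
    unfolding eq by (simp add: ennreal_mult_less_top)
qed

lemma poisson_first_moment:
  fixes m :: real
  shows "(\<lambda>k. real k * (m ^ k / fact k * exp (- m))) sums m"
proof -
  have "(\<lambda>k. m * exp (- m) * (m ^ k /\<^sub>R fact k)) sums (m * exp (- m) * exp m)"
    by (intro sums_mult exp_converges)
  moreover have "m * exp (- m) * exp m = m"
    by (simp add: exp_minus)
  moreover have "real (Suc k) * (m ^ Suc k / fact (Suc k) * exp (- m)) = m * exp (- m) * (m ^ k /\<^sub>R fact k)" for k
    by (simp add: field_simps del: of_nat_Suc)
  ultimately have "(\<lambda>k. real (Suc k) * (m ^ Suc k / fact (Suc k) * exp (- m))) sums m"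
    by simp
  then show ?thesis
    by (subst (asm) sums_Suc_iff) simp
qed

lemma (in complete_measure) borel_measurable_cong_AE_complete:
  assumes f: "f \<in> borel_measurable M" and ae: "AE x in M. f x = g x"
  shows "g \<in> borel_measurable M"
proof (rule measurableI)
  fix B :: "'b set" assume B: "B \<in> sets borel"
  have "AE x in M. x \<in> f -` B \<inter> space M \<longleftrightarrow> x \<in> g -` B \<inter> space M"
    using ae by eventually_elim auto
  then show "g -` B \<inter> space M \<in> sets M"
    using measurable_sets[OF f B] by (rule in_sets_AE) auto
qed simp

locale filtered_poisson = prob_space M for M :: "'w measure" +
  fixes F :: "real \<Rightarrow> 'w measure" and P :: "'w \<Rightarrow> (real \<times> real) measure"
  assumes usual: "usual_hypotheses M F"
    and poisson: "poisson_random_measure M half_plane P"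
    and future: "prm_future_indep M F P"
begin

sublocale complete_measure M
  using usual by (simp add: usual_hypotheses_def)

section \<open>Counts of the Poisson random measure and absence of simultaneous atoms\<close>

lemma sets_P: "\<omega> \<in> space M \<Longrightarrow> sets (P \<omega>) = sets half_plane"
  using poisson by (simp add: poisson_random_measure_def)

lemma P_borel_measurable [measurable]:
  "A \<in> sets half_plane \<Longrightarrow> (\<lambda>\<omega>. emeasure (P \<omega>) A) \<in> borel_measurable M"
  using poisson by (simp add: poisson_random_measure_def)

lemma P_integer:
  "\<omega> \<in> space M \<Longrightarrow> A \<in> sets half_plane \<Longrightarrow> emeasure (P \<omega>) A \<in> range of_nat \<union> {\<infinity>}"
  using poisson unfolding poisson_random_measure_def by blast

lemma P_distribution:
  assumes "A \<in> sets half_plane" "emeasure half_plane A < \<infinity>"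
  shows "\<P>(\<omega> in M. emeasure (P \<omega>) A = of_nat k)
    = measure half_plane A ^ k / fact k * exp (- measure half_plane A)"
  using poisson assms unfolding poisson_random_measure_def by blast

text \<open>The Poisson weights sum to 1, so the events of having exactly \<open>k\<close> atoms
  exhaust the space up to a null set.\<close>

lemma AE_P_finite:
  assumes "A \<in> sets half_plane" "emeasure half_plane A < \<infinity>"
  shows "AE \<omega> in M. \<exists>k. emeasure (P \<omega>) A = of_nat k"
proof -
  let ?m = "measure half_plane A"
  define E where "E k = {\<omega> \<in> space M. emeasure (P \<omega>) A = of_nat k}" for k :: nat
  have E: "range E \<subseteq> sets M"
    unfolding E_def using assms(1) by auto
  have "disjoint_family E"
    by (auto simp: E_def disjoint_family_on_def)
  then have "(\<lambda>k. prob (E k)) sums prob (\<Union>k. E k)"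
    using finite_measure_UNION[OF E] by simp
  moreover have "(\<lambda>k. prob (E k)) sums 1"
  proof -
    have "(\<lambda>k. exp (- ?m) * (?m ^ k /\<^sub>R fact k)) sums (exp (- ?m) * exp ?m)"
      by (intro sums_mult exp_converges)
    moreover have "exp (- ?m) * exp ?m = 1"
      by (simp add: exp_minus)
    moreover have "prob (E k) = exp (- ?m) * (?m ^ k /\<^sub>R fact k)" for k
      using P_distribution[OF assms, of k] by (simp add: E_def field_simps)
    ultimately show ?thesis
      by simp
  qed
  ultimately have "prob (\<Union>k. E k) = 1"
    by (rule sums_unique2)
  then have "AE \<omega> in M. \<omega> \<in> (\<Union>k. E k)"
    using E by (intro AE_prob_1) auto
  then show ?thesis
    by eventually_elim (auto simp: E_def)
qed

text \<open>Almost surely the count is the sum of \<open>k\<close> times the indicator of having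
  exactly \<open>k\<close> atoms, so the events of having exactly \<open>k\<close> atoms are all
  that independence has to cover. The case \<open>D = space M\<close> gives the mean; events known
  at the left end of a box give the compensation formula there.\<close>

lemma P_mean_on_independent_event:
  assumes A: "A \<in> sets half_plane" "emeasure half_plane A < \<infinity>" and D: "D \<in> events"
    and ind: "\<And>k. prob (D \<inter> {\<omega> \<in> space M. emeasure (P \<omega>) A = of_nat k})
      = prob D * \<P>(\<omega> in M. emeasure (P \<omega>) A = of_nat k)"
  shows "(\<integral>\<^sup>+\<omega>\<in>D. emeasure (P \<omega>) A \<partial>M) = emeasure M D * emeasure half_plane A"
proof -
  let ?m = "measure half_plane A"
  define E where "E k = {\<omega> \<in> space M. emeasure (P \<omega>) A = of_nat k}" for k :: nat
  have [measurable]: "E k \<in> sets M" for k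
    unfolding E_def using A(1) by auto
  have m: "emeasure half_plane A = ennreal ?m"
    using A(2) by (simp add: emeasure_eq_ennreal_measure)
  have "(\<integral>\<^sup>+\<omega>\<in>D. emeasure (P \<omega>) A \<partial>M) = (\<integral>\<^sup>+\<omega>. (\<Sum>k. of_nat k * indicator (D \<inter> E k) \<omega>) \<partial>M)"
  proof (rule nn_integral_cong_AE)
    show "AE \<omega> in M. emeasure (P \<omega>) A * indicator D \<omega> = (\<Sum>k. of_nat k * indicator (D \<inter> E k) \<omega>)"
      using AE_P_finite[OF A]
    proof eventually_elim
      case (elim \<omega>)
      then obtain l :: nat where l: "emeasure (P \<omega>) A = of_nat l" by blast
      show ?case
      proof (cases "\<omega> \<in> space M")
        case True
        have "(\<Sum>k. of_nat k * indicator (D \<inter> E k) \<omega>) = (\<Sum>k\<in>{l}. of_nat k * indicator (D \<inter> E k) \<omega> :: ennreal)"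
          by (rule suminf_finite) (auto simp: E_def l)
        also have "\<dots> = emeasure (P \<omega>) A * indicator D \<omega>"
          using True by (auto simp: E_def l indicator_def)
        finally show ?thesis by simp
      next
        case False
        then have "\<omega> \<notin> D" using D sets.sets_into_space by blast
        then show ?thesis by simp
      qed
    qed
  qed
  also have "\<dots> = (\<Sum>k. \<integral>\<^sup>+\<omega>. of_nat k * indicator (D \<inter> E k) \<omega> \<partial>M)"
    using D by (intro nn_integral_suminf) auto
  also have "\<dots> = (\<Sum>k. ennreal (prob D * (real k * (?m ^ k / fact k * exp (- ?m)))))"
  proof (intro suminf_cong)
    fix k
    have "(\<integral>\<^sup>+\<omega>. of_nat k * indicator (D \<inter> E k) \<omega> \<partial>M) = of_nat k * ennreal (prob (D \<inter> E k))"
      using D by (simp add: nn_integral_cmult emeasure_eq_measure)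
    also have "prob (D \<inter> E k) = prob D * (?m ^ k / fact k * exp (- ?m))"
      using ind[of k] P_distribution[OF A, of k] by (simp add: E_def)
    finally show "(\<integral>\<^sup>+\<omega>. of_nat k * indicator (D \<inter> E k) \<omega> \<partial>M) =
        ennreal (prob D * (real k * (?m ^ k / fact k * exp (- ?m))))"
      by (simp add: ennreal_of_nat_eq_real_of_nat ennreal_mult[symmetric] mult.left_commute)
  qed
  also have "\<dots> = ennreal (prob D * ?m)"
    by (intro suminf_ennreal_eq sums_mult poisson_first_moment) auto
  finally show ?thesis
    using m by (simp add: emeasure_eq_measure ennreal_mult)
qed

lemma P_mean:
  assumes "A \<in> sets half_plane" "emeasure half_plane A < \<infinity>"
  shows "(\<integral>\<^sup>+\<omega>. emeasure (P \<omega>) A \<partial>M) = emeasure half_plane A"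
proof -
  have "(\<integral>\<^sup>+\<omega>. emeasure (P \<omega>) A \<partial>M) = (\<integral>\<^sup>+\<omega>\<in>space M. emeasure (P \<omega>) A \<partial>M)"
    by (intro nn_integral_cong) auto
  also have "\<dots> = emeasure half_plane A"
    using assms by (subst P_mean_on_independent_event[OF assms])
      (auto simp: prob_space emeasure_space_1 Int_absorb1)
  finally show ?thesis .
qed

text \<open>The quadratic order matters: over a partition into many cells of equal intensity the sum
  of these bounds tends to 0.\<close>

lemma prob_P_multiple:
  assumes A: "A \<in> sets half_plane" "emeasure half_plane A < \<infinity>"
  shows "\<P>(\<omega> in M. 1 < emeasure (P \<omega>) A) \<le> (measure half_plane A)\<^sup>2"
proof -
  let ?m = "measure half_plane A"
  define E where "E k = {\<omega> \<in> space M. emeasure (P \<omega>) A = of_nat k}" for k :: nat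
  have [measurable]: "E k \<in> sets M" for k
    using A(1) by (auto simp: E_def)
  have "{\<omega> \<in> space M. 1 < emeasure (P \<omega>) A} \<subseteq> space M - (E 0 \<union> E 1)"
    by (auto simp: E_def)
  then have "\<P>(\<omega> in M. 1 < emeasure (P \<omega>) A) \<le> prob (space M - (E 0 \<union> E 1))"
    by (intro finite_measure_mono) auto
  also have "\<dots> = 1 - (prob (E 0) + prob (E 1))"
  proof -
    have "E 0 \<inter> E 1 = {}"
      by (auto simp: E_def)
    then show ?thesis
      by (subst prob_compl) (auto simp: finite_measure_Union simp del: One_nat_def)
  qed
  also have "\<dots> = 1 - exp (- ?m) * (1 + ?m)"
    using P_distribution[OF A, of 0] P_distribution[OF A, of 1] by (simp add: E_def algebra_simps)
  \<comment> \<open>Uses \<open>exp (- m) \<ge> 1 - m\<close>.\<close>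
  also have "\<dots> \<le> 1 - (1 - ?m) * (1 + ?m)"
    using exp_ge_add_one_self[of "- ?m"] by (intro diff_left_mono mult_right_mono) auto
  also have "\<dots> = ?m\<^sup>2"
    by (simp add: algebra_simps power2_eq_square)
  finally show ?thesis .
qed

text \<open>Cutting \<open>{0<..K}\<close> into \<open>m + 1\<close> pieces, the probability that one of them carries two atoms
  is \<open>O(1 / m)\<close>.\<close>

lemma AE_P_simple_bounded:
  fixes K :: nat
  shows "AE \<omega> in M. \<forall>u. 0 < u \<and> u \<le> real K \<longrightarrow> emeasure (P \<omega>) ({u} \<times> {- real K..real K}) \<le> 1"
proof -
  define R where "R m l = {real l * (K / (real m + 1))<..(real l + 1) * (K / (real m + 1))} \<times> {- real K..real K}"
    for m l :: nat
  define E where "E m = (\<Union>l\<le>m. {\<omega> \<in> space M. 1 < emeasure (P \<omega>) (R m l)})" for m :: nat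
  have R: "R m l \<in> sets half_plane" "emeasure half_plane (R m l) < \<infinity>"
    "emeasure half_plane (R m l) = ennreal (K / (real m + 1)) * ennreal (2 * K)" for m l
  proof -
    define d where "d = real K / (real m + 1)"
    have d: "real l * d \<le> (real l + 1) * d" "0 \<le> real l * d" "(real l + 1) * d - real l * d = d"
    proof -
      have "0 \<le> d" by (simp add: d_def)
      then show "real l * d \<le> (real l + 1) * d" "0 \<le> real l * d" "(real l + 1) * d - real l * d = d"
        by (simp_all add: distrib_right)
    qed
    note * = half_plane_Times_bounded[of "{- real K..real K}" "- real K" "real K", OF _ _ d(2,1)]
    show "R m l \<in> sets half_plane" "emeasure half_plane (R m l) < \<infinity>"
      unfolding R_def d_def[symmetric] by (intro *; simp)+
    show "emeasure half_plane (R m l) = ennreal (K / (real m + 1)) * ennreal (2 * K)"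
      unfolding R_def d_def[symmetric] by (subst *) (simp_all add: d)
  qed
  have [measurable]: "E m \<in> sets M" for m
    unfolding E_def using R(1) by (intro sets.finite_UN) auto
  have bound: "prob (E m) \<le> (2 * (real K)\<^sup>2)\<^sup>2 / (real m + 1)" for m
  proof -
    have m: "measure half_plane (R m l) = 2 * (real K)\<^sup>2 / (real m + 1)" for l
      unfolding measure_def R(3) by (simp add: ennreal_mult[symmetric] power2_eq_square)
    have "prob (E m) \<le> (\<Sum>l\<le>m. \<P>(\<omega> in M. 1 < emeasure (P \<omega>) (R m l)))"
      unfolding E_def using R(1) by (intro finite_measure_subadditive_finite) auto
    also have "\<dots> \<le> (\<Sum>l\<le>m. (2 * (real K)\<^sup>2 / (real m + 1))\<^sup>2)"
      using prob_P_multiple[OF R(1,2), of m] unfolding m by (intro sum_mono)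
    also have "\<dots> = (2 * (real K)\<^sup>2)\<^sup>2 / (real m + 1)"
      by (simp add: power2_eq_square add.commute)
    finally show ?thesis .
  qed
  \<comment> \<open>A path with two simultaneous atoms in the bounded region lies in every
    \<open>E m\<close>, so this intersection is the exceptional set.\<close>
  have "prob (\<Inter>m. E m) \<le> 0"
  proof (rule LIMSEQ_le_const)
    show "(\<lambda>m. (2 * (real K)\<^sup>2)\<^sup>2 / (real m + 1)) \<longlonglongrightarrow> 0"
      by real_asymp
    have "prob (\<Inter>m. E m) \<le> (2 * (real K)\<^sup>2)\<^sup>2 / (real m + 1)" for m
      by (rule order_trans[OF finite_measure_mono bound]) auto
    then show "\<exists>N. \<forall>m\<ge>N. prob (\<Inter>m. E m) \<le> (2 * (real K)\<^sup>2)\<^sup>2 / (real m + 1)"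
      by blast
  qed
  then have "(\<Inter>m. E m) \<in> null_sets M"
    by (auto simp: null_sets_def emeasure_eq_measure measure_le_0_iff)
  then have "AE \<omega> in M. \<omega> \<notin> (\<Inter>m. E m)"
    by (rule AE_not_in)
  with AE_space show ?thesis
  proof eventually_elim
    case (elim \<omega>)
    then obtain m where m: "\<omega> \<notin> E m" by auto
    show ?case
    proof (intro allI impI)
      fix u :: real assume u: "0 < u \<and> u \<le> real K"
      define q where "q = u / (K / (real m + 1))"
      have K: "0 < K / (real m + 1)" using u by auto
      have q: "0 < q" "u = q * (K / (real m + 1))"
        using u K by (auto simp: q_def)
      have "q \<le> real m + 1"
        unfolding q_def pos_divide_le_eq[OF K] using u by simp
      \<comment> \<open>Index of the cell containing \<open>u\<close>: the cells are open on the
        left, so a grid point belongs to the cell that ends there.\<close>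
      define l where "l = nat (\<lceil>q\<rceil> - 1)"
      have "0 < \<lceil>q\<rceil>" using q by simp
      then have l: "real l < q" "q \<le> real l + 1"
        unfolding l_def using ceiling_correct[of q] by (auto simp: of_nat_nat)
      have "l \<le> m"
        using l \<open>q \<le> real m + 1\<close> by linarith
      have "real l * (K / (real m + 1)) < u" "u \<le> (real l + 1) * (K / (real m + 1))"
        unfolding q(2) using mult_strict_right_mono[OF l(1) K] mult_right_mono[OF l(2) less_imp_le[OF K]] by blast+
      then have "{u} \<times> {- real K..real K} \<subseteq> R m l"
        by (auto simp: R_def)
      then have "emeasure (P \<omega>) ({u} \<times> {- real K..real K}) \<le> emeasure (P \<omega>) (R m l)"
        using R(1) elim by (intro emeasure_mono) (auto simp: sets_P)
      also have "\<dots> \<le> 1"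
        using m \<open>l \<le> m\<close> elim by (auto simp: E_def not_less)
      finally show "emeasure (P \<omega>) ({u} \<times> {- real K..real K}) \<le> 1" .
    qed
  qed
qed

lemma AE_P_simple: "AE \<omega> in M. \<forall>u>0. emeasure (P \<omega>) ({u} \<times> UNIV) \<le> 1"
proof -
  have "AE \<omega> in M. \<forall>K::nat. \<forall>u. 0 < u \<and> u \<le> real K \<longrightarrow> emeasure (P \<omega>) ({u} \<times> {- real K..real K}) \<le> 1"
    unfolding AE_all_countable using AE_P_simple_bounded by blast
  with AE_space show ?thesis
  proof eventually_elim
    case (elim \<omega>)
    show ?case
    proof (intro allI impI)
      fix u :: real assume u: "0 < u"
      let ?A = "\<lambda>K::nat. {u} \<times> {- real K..real K}"
      have A: "?A K \<in> sets half_plane" for K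
        using u by (intro Times_in_half_plane) auto
      have "(\<Union>K. ?A K) = {u} \<times> UNIV"
      proof -
        have "\<exists>K. - real K \<le> v \<and> v \<le> real K" for v
        proof -
          obtain K where "\<bar>v\<bar> \<le> real K"
            using real_arch_simple by blast
          then show ?thesis
            by (intro exI[of _ K]) auto
        qed
        then show ?thesis by auto
      qed
      then have "emeasure (P \<omega>) ({u} \<times> UNIV) = (SUP K. emeasure (P \<omega>) (?A K))"
        using A elim(1) by (subst SUP_emeasure_incseq) (auto simp: sets_P incseq_def)
      also have "\<dots> \<le> 1"
      proof (rule SUP_least)
        fix K
        \<comment> \<open>The bounded statement restricts time and mark by the same number, so it
          has to be large enough for \<open>u\<close> too.\<close>
        define K' where "K' = max K (nat \<lceil>u\<rceil>)"
        have "u \<le> real K'" by (auto simp: K'_def) linarith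
        have "emeasure (P \<omega>) (?A K) \<le> emeasure (P \<omega>) (?A K')"
          using A elim(1) by (intro emeasure_mono) (auto simp: sets_P K'_def)
        also have "\<dots> \<le> 1"
          using elim(2) u \<open>u \<le> real K'\<close> by blast
        finally show "emeasure (P \<omega>) (?A K) \<le> 1" .
      qed
      finally show "emeasure (P \<omega>) ({u} \<times> UNIV) \<le> 1" .
    qed
  qed
qed

section \<open>The predictable sigma-algebra with real marks\<close>

lemma subalgebra_F: "0 \<le> t \<Longrightarrow> subalgebra M (F t)"
  using usual unfolding usual_hypotheses_def by blast

lemma F_mono: "0 \<le> s \<Longrightarrow> s \<le> t \<Longrightarrow> sets (F s) \<subseteq> sets (F t)"
  using usual unfolding usual_hypotheses_def by blast

lemma F_events: "0 \<le> t \<Longrightarrow> A \<in> sets (F t) \<Longrightarrow> A \<in> events"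
  using subalgebra_F[of t] by (auto simp: subalgebra_def)

text \<open>The event \<open>A\<close> is known at the excluded left end \<open>s\<close>, so it is
  independent of all atoms in \<open>{s<..t} \<times> B\<close>. These boxes generate the usual
  predictable sigma-algebra on positive times, with a Borel mark.\<close>

definition predictable_boxes :: "('w \<times> real \<times> real) set set" where
  "predictable_boxes = {A \<times> ({s<..t} \<times> B) | A s t B. 0 \<le> s \<and> s \<le> t \<and> A \<in> sets (F s) \<and> B \<in> sets borel}"

lemma predictable_boxesI:
  "0 \<le> s \<Longrightarrow> s \<le> t \<Longrightarrow> A \<in> sets (F s) \<Longrightarrow> B \<in> sets borel \<Longrightarrow> A \<times> ({s<..t} \<times> B) \<in> predictable_boxes"
  unfolding predictable_boxes_def mem_Collect_eq by (intro exI conjI) auto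

lemma predictable_boxesE:
  assumes "C \<in> predictable_boxes"
  obtains A s t B where "C = A \<times> ({s<..t} \<times> B)" "0 \<le> s" "s \<le> t" "A \<in> sets (F s)" "B \<in> sets borel"
  using assms unfolding predictable_boxes_def by blast

definition predictable :: "('w \<times> real \<times> real) measure" where
  "predictable = sigma (space M \<times> ({0::real<..} \<times> (UNIV :: real set))) predictable_boxes"

lemma predictable_boxes_subset: "predictable_boxes \<subseteq> Pow (space M \<times> ({0::real<..} \<times> (UNIV :: real set)))"
proof
  fix C assume "C \<in> predictable_boxes"
  then obtain A s t B where C: "C = A \<times> ({s<..t} \<times> B)" "0 \<le> s" "A \<in> sets (F s)"
    by (rule predictable_boxesE)
  then have "A \<subseteq> space M"
    using F_events sets.sets_into_space by blast
  with C show "C \<in> Pow (space M \<times> ({0::real<..} \<times> (UNIV :: real set)))"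
    by auto
qed

lemma space_predictable: "space predictable = space M \<times> ({0::real<..} \<times> (UNIV :: real set))"
  using predictable_boxes_subset by (simp add: predictable_def space_measure_of_conv)

lemma sets_predictable: "sets predictable = sigma_sets (space M \<times> ({0::real<..} \<times> (UNIV :: real set))) predictable_boxes"
  using predictable_boxes_subset by (simp add: predictable_def)

lemma Int_stable_predictable_boxes: "Int_stable predictable_boxes"
proof (rule Int_stableI)
  fix C C' assume "C \<in> predictable_boxes" "C' \<in> predictable_boxes"
  then obtain A s t B A' s' t' B' where
    C: "C = A \<times> ({s<..t} \<times> B)" "0 \<le> s" "s \<le> t" "A \<in> sets (F s)" "B \<in> sets borel" and
    C': "C' = A' \<times> ({s'<..t'} \<times> B')" "0 \<le> s'" "s' \<le> t'" "A' \<in> sets (F s')" "B' \<in> sets borel"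
    by (elim predictable_boxesE)
  \<comment> \<open>The outer maximum keeps the right end from falling below the left one, so that
    disjoint time intervals still yield a (void) box.\<close>
  let ?s = "max s s'" and ?t = "max (max s s') (min t t')"
  have "C \<inter> C' = (A \<inter> A') \<times> ({?s<..?t} \<times> (B \<inter> B'))"
    unfolding C C' by auto
  moreover have "A \<in> sets (F ?s)" "A' \<in> sets (F ?s)"
    using F_mono[OF C(2), of ?s] F_mono[OF C'(2), of ?s] C(4) C'(4) by (meson max.cobounded1 max.cobounded2 subsetD)+
  moreover have "0 \<le> ?s" "?s \<le> ?t"
    using C(2) by linarith+
  ultimately show "C \<inter> C' \<in> predictable_boxes"
    using C(5) C'(5) by (simp only:) (intro predictable_boxesI sets.Int)
qed

lemma predictable_product:
  assumes "C \<in> sets predictable"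
  shows "C \<in> sets (M \<Otimes>\<^sub>M (lborel \<Otimes>\<^sub>M (lborel :: real measure)))"
proof -
  have "sigma_sets (space M \<times> ({0::real<..} \<times> (UNIV :: real set))) predictable_boxes \<subseteq> sets (M \<Otimes>\<^sub>M (lborel \<Otimes>\<^sub>M (lborel :: real measure)))"
  proof (rule sets.sigma_sets_subset')
    show "predictable_boxes \<subseteq> sets (M \<Otimes>\<^sub>M (lborel \<Otimes>\<^sub>M (lborel :: real measure)))"
    proof
      fix C assume "C \<in> predictable_boxes"
      then obtain A s t B where "C = A \<times> ({s<..t} \<times> B)" "0 \<le> s" "A \<in> sets (F s)" "B \<in> sets borel"
        by (rule predictable_boxesE)
      then show "C \<in> sets (M \<Otimes>\<^sub>M (lborel \<Otimes>\<^sub>M (lborel :: real measure)))"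
        using F_events by (simp add: pair_measureI)
    qed
    show "space M \<times> ({0::real<..} \<times> (UNIV :: real set)) \<in> sets (M \<Otimes>\<^sub>M (lborel \<Otimes>\<^sub>M (lborel :: real measure)))"
      by (intro pair_measureI) auto
  qed
  with assms show ?thesis
    by (auto simp: sets_predictable)
qed

lemma predictable_section:
  assumes "C \<in> sets predictable"
  shows "Pair \<omega> -` C \<in> sets half_plane" "Pair \<omega> -` C \<subseteq> {0<..} \<times> UNIV"
proof -
  have "Pair \<omega> -` C \<in> sets borel"
    using sets_Pair1[OF predictable_product[OF assms], of \<omega>] unfolding lborel_prod by simp
  moreover show "Pair \<omega> -` C \<subseteq> {0<..} \<times> UNIV"
    using sets.sets_into_space[OF assms] by (auto simp: space_predictable)
  ultimately show "Pair \<omega> -` C \<in> sets half_plane"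
    unfolding sets_half_plane_iff by force
qed

section \<open>The compensation formula\<close>

definition window :: "nat \<Rightarrow> (real \<times> real) set" where
  "window K = {0<..real K} \<times> {- real K..real K}"

text \<open>Finite intensity makes the mass of a window almost surely finite and its mean finite, as
  subtraction in the complement step demands.\<close>

lemma window: "window K \<in> sets half_plane" "emeasure half_plane (window K) < \<infinity>"
  unfolding window_def using half_plane_Times_bounded[of "{- real K..real K}" "- real K" "real K" 0 "real K"]
  by auto

definition finite_windows :: "'w set" where
  "finite_windows = {\<omega> \<in> space M. \<forall>K. emeasure (P \<omega>) (window K) < \<infinity>}"

lemma finite_windows_event [measurable]: "finite_windows \<in> events"
  unfolding finite_windows_def using window by measurable

lemma AE_finite_windows: "AE \<omega> in M. \<omega> \<in> finite_windows"
proof -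
  have "AE \<omega> in M. \<forall>K. \<exists>k. emeasure (P \<omega>) (window K) = of_nat k"
    unfolding AE_all_countable using AE_P_finite window by blast
  with AE_space show ?thesis
  proof eventually_elim
    case (elim \<omega>)
    then show ?case
      by (auto simp: finite_windows_def) (metis of_nat_less_top)
  qed
qed

lemma half_plane_Int_window: "A \<in> sets half_plane \<Longrightarrow> A \<inter> window K \<in> sets half_plane"
  using window by auto

text \<open>Off the null set where some window has infinite mass, the mass is replaced by \<open>0\<close>, so that
  complements can be taken pathwise.\<close>

definition window_mass :: "nat \<Rightarrow> ('w \<times> real \<times> real) set \<Rightarrow> 'w \<Rightarrow> ennreal" where
  "window_mass K C \<omega> = emeasure (P \<omega>) (Pair \<omega> -` C \<inter> window K) * indicator finite_windows \<omega>"

definition window_area :: "nat \<Rightarrow> ('w \<times> real \<times> real) set \<Rightarrow> 'w \<Rightarrow> ennreal" where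
  "window_area K C \<omega> = emeasure half_plane (Pair \<omega> -` C \<inter> window K)"

lemma window_area_measurable:
  assumes "C \<in> sets predictable"
  shows "window_area K C \<in> borel_measurable M"
proof -
  have W: "window K \<in> sets (lborel \<Otimes>\<^sub>M lborel)"
    unfolding window_def by auto
  have "space M \<times> window K \<in> sets (M \<Otimes>\<^sub>M (lborel \<Otimes>\<^sub>M (lborel :: real measure)))"
    using W by (intro pair_measureI) auto
  with predictable_product[OF assms]
  have "C \<inter> (space M \<times> window K) \<in> sets (M \<Otimes>\<^sub>M (lborel \<Otimes>\<^sub>M (lborel :: real measure)))"
    by auto
  then have "(\<lambda>\<omega>. emeasure (lborel \<Otimes>\<^sub>M lborel) (Pair \<omega> -` (C \<inter> (space M \<times> window K)))) \<in> borel_measurable M"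
    unfolding lborel_prod by (rule lborel.measurable_emeasure_Pair)
  then show ?thesis
    by (rule measurable_cong[THEN iffD1, rotated])
       (auto simp: window_area_def lborel_prod half_plane_emeasure half_plane_Int_window predictable_section[OF assms]
         intro!: arg_cong[where f="emeasure lborel"])
qed

text \<open>Inside a window the box is \<open>A\<close> times a deterministic set \<open>R\<close>
  lying after time \<open>s\<close>. Independence of the future from \<open>F s\<close> makes both
  expectations the probability of \<open>A\<close> times the area of \<open>R\<close>.\<close>

lemma compensation_box:
  assumes "C \<in> predictable_boxes"
  shows "window_mass K C \<in> borel_measurable M \<and>
    (\<integral>\<^sup>+\<omega>. window_mass K C \<omega> \<partial>M) = (\<integral>\<^sup>+\<omega>. window_area K C \<omega> \<partial>M)"
proof -
  obtain A s t B where C: "C = A \<times> ({s<..t} \<times> B)" "0 \<le> s" "s \<le> t" "A \<in> sets (F s)" "B \<in> sets borel"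
    using assms by (rule predictable_boxesE)
  \<comment> \<open>The maximum with \<open>s\<close> covers a window that ends before
    \<open>s\<close>; then \<open>R\<close> is empty.\<close>
  define R where "R = {s<..max s (min t K)} \<times> (B \<inter> {- real K..real K})"
  have R_eq: "({s<..t} \<times> B) \<inter> window K = R"
    using C by (auto simp: R_def window_def)
  have R: "R \<in> sets half_plane" "emeasure half_plane R < \<infinity>"
    unfolding R_def using C half_plane_Times_bounded[of "B \<inter> {- real K..real K}" "- real K" "real K"]
    by auto
  have A: "A \<in> events"
    using C F_events by blast
  have mass: "window_mass K C \<omega> = emeasure (P \<omega>) R * indicator A \<omega> * indicator finite_windows \<omega>" for \<omega>
    using R_eq by (auto simp: window_mass_def C vimage_def indicator_def Int_def)
  have "window_mass K C \<in> borel_measurable M"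
    unfolding mass[abs_def] using A R by measurable
  moreover have "(\<integral>\<^sup>+\<omega>. window_mass K C \<omega> \<partial>M) = (\<integral>\<^sup>+\<omega>\<in>A. emeasure (P \<omega>) R \<partial>M)"
    by (intro nn_integral_cong_AE, use AE_finite_windows in eventually_elim) (simp add: mass)
  moreover have "\<dots> = emeasure M A * emeasure half_plane R"
  proof (rule P_mean_on_independent_event[OF R A])
    fix k :: nat
    have "{\<omega> \<in> space M. emeasure (P \<omega>) R = of_nat k} = (\<lambda>\<omega>. emeasure (P \<omega>) R) -` {of_nat k} \<inter> space M"
      by auto
    moreover have "R \<subseteq> {s<..} \<times> UNIV"
      by (auto simp: R_def)
    ultimately have "{\<omega> \<in> space M. emeasure (P \<omega>) R = of_nat k} \<in> sigma_sets (space M)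
          {(\<lambda>\<omega>. emeasure (P \<omega>) A) -` B \<inter> space M | A B.
             A \<in> sets half_plane \<and> A \<subseteq> {s<..} \<times> UNIV \<and> B \<in> sets borel}"
      using R(1) by (intro sigma_sets.Basic CollectI exI[of _ R] exI[of _ "{of_nat k}"] conjI) auto
    then show "prob (A \<inter> {\<omega> \<in> space M. emeasure (P \<omega>) R = of_nat k})
      = prob A * \<P>(\<omega> in M. emeasure (P \<omega>) R = of_nat k)"
      using future C unfolding prm_future_indep_def by (intro indep_setD) auto
  qed
  moreover have "(\<integral>\<^sup>+\<omega>. window_area K C \<omega> \<partial>M) = (\<integral>\<^sup>+\<omega>. emeasure half_plane R * indicator A \<omega> \<partial>M)"
    using R_eq by (intro nn_integral_cong) (auto simp: window_area_def C vimage_def indicator_def Int_def)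
  moreover have "\<dots> = emeasure half_plane R * emeasure M A"
    using A by (simp add: nn_integral_cmult_indicator)
  ultimately show ?thesis
    by (simp add: mult.commute)
qed

lemma window_area_finite: "(\<integral>\<^sup>+\<omega>. window_area K C \<omega> \<partial>M) < \<infinity>"
proof -
  have "(\<integral>\<^sup>+\<omega>. window_area K C \<omega> \<partial>M) \<le> (\<integral>\<^sup>+\<omega>. emeasure half_plane (window K) \<partial>M)"
    unfolding window_area_def using window by (intro nn_integral_mono emeasure_mono) auto
  then show ?thesis
    using window(2)[of K] by (simp add: emeasure_space_1)
qed

text \<open>Extension from boxes by a Dynkin class argument. Measurability is part of the induction
  because the random measure is known to be measurable on deterministic sets only.\<close>

lemma compensation_window:
  assumes "C \<in> sets predictable"
  shows "window_mass K C \<in> borel_measurable M \<and>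
    (\<integral>\<^sup>+\<omega>. window_mass K C \<omega> \<partial>M) = (\<integral>\<^sup>+\<omega>. window_area K C \<omega> \<partial>M)"
  using assms unfolding sets_predictable
proof (induction rule: sigma_sets_induct_disjoint[OF Int_stable_predictable_boxes predictable_boxes_subset,
    consumes 1, case_names basic empty compl union])
  case (basic C)
  then show ?case by (rule compensation_box)
next
  case empty
  then show ?case by (simp add: window_mass_def[abs_def] window_area_def)
next
  case (compl C)
  let ?\<Omega> = "space M \<times> ({0<..} \<times> (UNIV :: real set))"
  note C = compl(1)[folded sets_predictable]
  have [measurable]: "window_mass K C \<in> borel_measurable M"
    using compl by blast
  have eq: "Pair \<omega> -` (?\<Omega> - C) \<inter> window K = window K - (Pair \<omega> -` C \<inter> window K)" if "\<omega> \<in> space M" for \<omega>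
    using that by (auto simp: window_def)
  define total where "total \<omega> = emeasure (P \<omega>) (window K) * indicator finite_windows \<omega>" for \<omega>
  have [measurable]: "total \<in> borel_measurable M"
    unfolding total_def using window by measurable
  have le: "emeasure (P \<omega>) (Pair \<omega> -` C \<inter> window K) \<le> emeasure (P \<omega>) (window K)" if "\<omega> \<in> space M" for \<omega>
    using that window by (intro emeasure_mono) (auto simp: sets_P)
  have mass: "window_mass K (?\<Omega> - C) \<omega> = total \<omega> - window_mass K C \<omega>" if "\<omega> \<in> space M" for \<omega>
  proof (cases "\<omega> \<in> finite_windows")
    case True
    then have "emeasure (P \<omega>) (window K) < \<infinity>"
      by (simp add: finite_windows_def)
    then have "emeasure (P \<omega>) (Pair \<omega> -` C \<inter> window K) \<noteq> \<infinity>"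
      using le[OF that] by auto
    then have "emeasure (P \<omega>) (window K - (Pair \<omega> -` C \<inter> window K)) =
        emeasure (P \<omega>) (window K) - emeasure (P \<omega>) (Pair \<omega> -` C \<inter> window K)"
      using window half_plane_Int_window predictable_section[OF C] that
      by (intro emeasure_Diff) (auto simp: sets_P)
    with True show ?thesis
      using eq[OF that] by (simp add: window_mass_def total_def)
  qed (simp add: window_mass_def total_def)
  have meas: "window_mass K (?\<Omega> - C) \<in> borel_measurable M"
    by (subst measurable_cong[OF mass]) measurable
  \<comment> \<open>The set and its complement share out the whole window, for mass and for area,
    and the two totals have equal means. Cancelling the finite mean that belongs to \<open>C\<close>
    leaves the claim for the complement.\<close>
  have "(\<integral>\<^sup>+\<omega>. window_mass K (?\<Omega> - C) \<omega> \<partial>M) + (\<integral>\<^sup>+\<omega>. window_mass K C \<omega> \<partial>M) = (\<integral>\<^sup>+\<omega>. total \<omega> \<partial>M)"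
  proof (subst nn_integral_add[symmetric])
    show "(\<integral>\<^sup>+\<omega>. window_mass K (?\<Omega> - C) \<omega> + window_mass K C \<omega> \<partial>M) = (\<integral>\<^sup>+\<omega>. total \<omega> \<partial>M)"
    proof (rule nn_integral_cong)
      fix \<omega> assume w: "\<omega> \<in> space M"
      have "window_mass K C \<omega> \<le> total \<omega>"
        using le[OF w] by (auto simp: window_mass_def total_def indicator_def)
      then show "window_mass K (?\<Omega> - C) \<omega> + window_mass K C \<omega> = total \<omega>"
        using mass[OF w] by (simp add: diff_add_cancel_ennreal)
    qed
  qed (use meas in measurable)
  also have "\<dots> = (\<integral>\<^sup>+\<omega>. emeasure (P \<omega>) (window K) \<partial>M)"
    by (intro nn_integral_cong_AE, use AE_finite_windows in eventually_elim) (simp add: total_def)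
  also have "\<dots> = emeasure half_plane (window K)"
    using window by (rule P_mean)
  also have "\<dots> = (\<integral>\<^sup>+\<omega>. emeasure half_plane (window K) \<partial>M)"
    by (simp add: emeasure_space_1)
  also have "\<dots> = (\<integral>\<^sup>+\<omega>. window_area K (?\<Omega> - C) \<omega> + window_area K C \<omega> \<partial>M)"
  proof (rule nn_integral_cong)
    fix \<omega> assume w: "\<omega> \<in> space M"
    show "emeasure half_plane (window K) = window_area K (?\<Omega> - C) \<omega> + window_area K C \<omega>"
      unfolding window_area_def eq[OF w]
      using window half_plane_Int_window predictable_section[OF C]
      by (subst plus_emeasure) (auto intro!: arg_cong[where f="emeasure half_plane"])
  qed
  also have "\<dots> = (\<integral>\<^sup>+\<omega>. window_area K (?\<Omega> - C) \<omega> \<partial>M) + (\<integral>\<^sup>+\<omega>. window_area K C \<omega> \<partial>M)"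
  proof (rule nn_integral_add)
    have "?\<Omega> - C \<in> sets predictable"
      using C space_predictable by (metis sets.compl_sets)
    then show "window_area K (?\<Omega> - C) \<in> borel_measurable M"
      by (rule window_area_measurable)
  qed (rule window_area_measurable[OF C])
  finally show ?case
    using meas compl window_area_finite[of K C] by (auto simp: add.commute[of _ "\<integral>\<^sup>+\<omega>. window_area K C \<omega> \<partial>M"] ennreal_add_left_cancel)
next
  case (union C)
  have C: "C i \<in> sets predictable" for i
    using union(2) by (auto simp: sets_predictable)
  have vim: "Pair \<omega> -` (\<Union>i. C i) \<inter> window K = (\<Union>i. Pair \<omega> -` C i \<inter> window K)" for \<omega>
    by auto
  have disj: "disjoint_family (\<lambda>i. Pair \<omega> -` C i \<inter> window K)" for \<omega>
    using union(1) by (auto simp: disjoint_family_on_def)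
  have mass: "window_mass K (\<Union>i. C i) \<omega> = (\<Sum>i. window_mass K (C i) \<omega>)" if "\<omega> \<in> space M" for \<omega>
    unfolding window_mass_def vim using disj half_plane_Int_window predictable_section[OF C] that
    by (subst suminf_emeasure[symmetric]) (auto simp: sets_P indicator_def)
  have area: "window_area K (\<Union>i. C i) \<omega> = (\<Sum>i. window_area K (C i) \<omega>)" for \<omega>
    unfolding window_area_def vim using disj half_plane_Int_window predictable_section[OF C]
    by (subst suminf_emeasure[symmetric]) auto
  have [measurable]: "window_mass K (C i) \<in> borel_measurable M" for i
    using union by blast
  have "window_mass K (\<Union>i. C i) \<in> borel_measurable M"
    by (subst measurable_cong[OF mass]) measurable
  moreover have "(\<integral>\<^sup>+\<omega>. window_mass K (\<Union>i. C i) \<omega> \<partial>M) = (\<Sum>i. \<integral>\<^sup>+\<omega>. window_mass K (C i) \<omega> \<partial>M)"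
    by (subst nn_integral_suminf[symmetric]) (auto intro!: nn_integral_cong mass)
  moreover have "(\<integral>\<^sup>+\<omega>. window_area K (\<Union>i. C i) \<omega> \<partial>M) = (\<Sum>i. \<integral>\<^sup>+\<omega>. window_area K (C i) \<omega> \<partial>M)"
    by (subst nn_integral_suminf[symmetric]) (auto simp: area window_area_measurable[OF C] intro!: nn_integral_cong)
  ultimately show ?case
    using union by simp
qed

lemma compensation_formula:
  assumes C: "C \<in> sets predictable"
  shows "(\<lambda>\<omega>. emeasure (P \<omega>) (Pair \<omega> -` C)) \<in> borel_measurable M"
    and "(\<integral>\<^sup>+\<omega>. emeasure (P \<omega>) (Pair \<omega> -` C) \<partial>M) = (\<integral>\<^sup>+\<omega>. emeasure lborel (Pair \<omega> -` C) \<partial>M)"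
proof -
  note sec = predictable_section[OF C]
  have un: "(\<Union>K. Pair \<omega> -` C \<inter> window K) = Pair \<omega> -` C" for \<omega>
  proof -
    have "\<exists>K. z \<in> window K" if "z \<in> Pair \<omega> -` C" for z
    proof -
      obtain u v where z: "z = (u, v)" by (cases z)
      obtain K where "max u \<bar>v\<bar> \<le> real K"
        using real_arch_simple by blast
      moreover have "0 < u"
        using sec(2) that z by blast
      ultimately show ?thesis
        by (intro exI[of _ K]) (auto simp: z window_def)
    qed
    then show ?thesis by blast
  qed
  have inc: "incseq (\<lambda>K. Pair \<omega> -` C \<inter> window K)" for \<omega>
    by (auto simp: incseq_def window_def)
  have SUP: "(SUP K. emeasure N (Pair \<omega> -` C \<inter> window K)) = emeasure N (Pair \<omega> -` C)"
    if "sets N = sets half_plane" for \<omega> N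
  proof -
    have "(SUP K. emeasure N (Pair \<omega> -` C \<inter> window K)) = emeasure N (\<Union>K. Pair \<omega> -` C \<inter> window K)"
      using inc that half_plane_Int_window[OF sec(1)] by (intro SUP_emeasure_incseq) auto
    then show ?thesis
      unfolding un .
  qed
  have mass: "(SUP K. window_mass K C \<omega>) = emeasure (P \<omega>) (Pair \<omega> -` C)"
    if "\<omega> \<in> finite_windows" for \<omega>
    using that SUP[OF sets_P, of \<omega>] by (simp add: window_mass_def finite_windows_def)
  have meas: "(\<lambda>\<omega>. SUP K. window_mass K C \<omega>) \<in> borel_measurable M"
    using compensation_window[OF C] by (intro borel_measurable_SUP) auto
  have AE: "AE \<omega> in M. (SUP K. window_mass K C \<omega>) = emeasure (P \<omega>) (Pair \<omega> -` C)"
    using AE_finite_windows by eventually_elim (rule mass)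
  \<comment> \<open>The unmodified mass differs from the limit of the window masses only on a null
    set; completeness makes it measurable.\<close>
  show "(\<lambda>\<omega>. emeasure (P \<omega>) (Pair \<omega> -` C)) \<in> borel_measurable M"
    by (rule borel_measurable_cong_AE_complete[OF meas AE])
  have "(\<integral>\<^sup>+\<omega>. emeasure (P \<omega>) (Pair \<omega> -` C) \<partial>M) = (\<integral>\<^sup>+\<omega>. (SUP K. window_mass K C \<omega>) \<partial>M)"
    by (rule nn_integral_cong_AE, use AE in eventually_elim) simp
  also have "\<dots> = (SUP K. \<integral>\<^sup>+\<omega>. window_mass K C \<omega> \<partial>M)"
  proof (rule nn_integral_monotone_convergence_SUP_AE)
    show "AE \<omega> in M. window_mass K C \<omega> \<le> window_mass (Suc K) C \<omega>" for K
    proof (rule AE_I2)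
      fix \<omega> assume "\<omega> \<in> space M"
      then show "window_mass K C \<omega> \<le> window_mass (Suc K) C \<omega>"
        unfolding window_mass_def using half_plane_Int_window[OF sec(1)] incseq_SucD[OF inc]
        by (intro mult_right_mono emeasure_mono) (auto simp: sets_P)
    qed
  qed (use compensation_window[OF C] in blast)
  also have "\<dots> = (SUP K. \<integral>\<^sup>+\<omega>. window_area K C \<omega> \<partial>M)"
    using compensation_window[OF C] by simp
  also have "\<dots> = (\<integral>\<^sup>+\<omega>. (SUP K. window_area K C \<omega>) \<partial>M)"
  proof (rule nn_integral_monotone_convergence_SUP[symmetric])
    show "incseq (\<lambda>K. window_area K C)"
      unfolding window_area_def using half_plane_Int_window[OF sec(1)] incseqD[OF inc]
      by (intro monoI le_funI emeasure_mono) blast+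
  qed (rule window_area_measurable[OF C])
  also have "\<dots> = (\<integral>\<^sup>+\<omega>. emeasure lborel (Pair \<omega> -` C) \<partial>M)"
    unfolding window_area_def by (subst SUP) (simp_all add: half_plane_emeasure[OF sec(1)])
  finally show "(\<integral>\<^sup>+\<omega>. emeasure (P \<omega>) (Pair \<omega> -` C) \<partial>M) = (\<integral>\<^sup>+\<omega>. emeasure lborel (Pair \<omega> -` C) \<partial>M)" .
qed

section \<open>Predictability of marks and left limits\<close>

lemma predictable_box:
  "0 \<le> s \<Longrightarrow> s \<le> t \<Longrightarrow> A \<in> sets (F s) \<Longrightarrow> B \<in> sets borel \<Longrightarrow> A \<times> ({s<..t} \<times> B) \<in> sets predictable"
  unfolding sets_predictable by (intro sigma_sets.Basic predictable_boxesI)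

lemma mark_borel_measurable [measurable]: "(\<lambda>z. snd (snd z)) \<in> borel_measurable predictable"
proof (rule borel_measurableI)
  fix B :: "real set" assume "open B"
  have "space M \<in> sets (F 0)"
    using subalgebra_F[of 0] by (auto simp: subalgebra_def) (metis sets.top)
  then have "space M \<times> ({0<..real k} \<times> B) \<in> sets predictable" for k
    using \<open>open B\<close> by (intro predictable_box) auto
  then have "(\<Union>k::nat. space M \<times> ({0<..real k} \<times> B)) \<in> sets predictable"
    by auto
  also have "(\<Union>k::nat. space M \<times> ({0<..real k} \<times> B)) = (\<lambda>z. snd (snd z)) -` B \<inter> space predictable"
    using real_arch_simple by (auto simp: space_predictable)
  finally show "(\<lambda>z. snd (snd z)) -` B \<inter> space predictable \<in> sets predictable" .
qed

text \<open>The left limit at \<open>u\<close> is approximated by the values at grid points strictly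
  before \<open>u\<close>. With a fixed grid, preimages are countable unions of predictable boxes,
  since the value at the left end of a cell is known there.\<close>

lemma left_limit_predictable:
  fixes Z L :: "real \<Rightarrow> 'w \<Rightarrow> real"
  assumes Z: "\<And>t. 0 \<le> t \<Longrightarrow> Z t \<in> borel_measurable (F t)"
    and lim: "\<And>\<omega> t. \<omega> \<in> space M \<Longrightarrow> 0 < t \<Longrightarrow> ((\<lambda>s. Z s \<omega>) \<longlongrightarrow> L t \<omega>) (at_left t)"
  shows "(\<lambda>z. L (fst (snd z)) (fst z)) \<in> borel_measurable predictable"
proof (rule borel_measurable_LIMSEQ_real)
  \<comment> \<open>Number of the left-open cell of mesh \<open>1 / (m + 1)\<close> that contains
    \<open>u\<close>; its left end \<open>d m u\<close> is strictly below \<open>u\<close>, also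
    when \<open>u\<close> is a grid point.\<close>
  define k where "k m u = nat (\<lceil>u * (real m + 1)\<rceil> - 1)" for m and u :: real
  define d where "d m u = real (k m u) / (real m + 1)" for m u
  have k_iff: "k m u = l \<longleftrightarrow> real l / (real m + 1) < u \<and> u \<le> (real l + 1) / (real m + 1)"
    if "0 < u" for m l and u :: real
  proof -
    have pos: "0 < \<lceil>u * (real m + 1)\<rceil>"
      using that by simp
    have "k m u = l \<longleftrightarrow> \<lceil>u * (real m + 1)\<rceil> = int l + 1"
      using pos by (auto simp: k_def)
    also have "\<dots> \<longleftrightarrow> real l < u * (real m + 1) \<and> u * (real m + 1) \<le> real l + 1"
      by (auto simp: ceiling_eq_iff)
    also have "\<dots> \<longleftrightarrow> real l / (real m + 1) < u \<and> u \<le> (real l + 1) / (real m + 1)"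
      by (simp add: pos_divide_less_eq pos_le_divide_eq)
    finally show ?thesis .
  qed
  have d: "0 \<le> d m u" "d m u < u" "u - 1 / (real m + 1) \<le> d m u" if "0 < u" for m u
    using k_iff[OF that, of m "k m u"] by (auto simp: d_def add_divide_distrib)
  show "(\<lambda>z. Z (d m (fst (snd z))) (fst z)) \<in> borel_measurable predictable" for m
  proof (rule borel_measurableI)
    fix B :: "real set" assume "open B"
    have "(Z (real l / (real m + 1)) -` B \<inter> space M) \<times>
        ({real l / (real m + 1)<..(real l + 1) / (real m + 1)} \<times> UNIV) \<in> sets predictable" for l
    proof (rule predictable_box)
      show 0: "0 \<le> real l / (real m + 1)" by simp
      from measurable_sets[OF Z[OF this] borel_open[OF \<open>open B\<close>]] subalgebra_F[OF this]
      show "Z (real l / (real m + 1)) -` B \<inter> space M \<in> sets (F (real l / (real m + 1)))"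
        by (simp add: subalgebra_def)
    qed (simp_all add: divide_right_mono)
    then have "(\<Union>l::nat. (Z (real l / (real m + 1)) -` B \<inter> space M) \<times>
        ({real l / (real m + 1)<..(real l + 1) / (real m + 1)} \<times> UNIV)) \<in> sets predictable"
      by auto
    also have "(\<Union>l::nat. (Z (real l / (real m + 1)) -` B \<inter> space M) \<times>
        ({real l / (real m + 1)<..(real l + 1) / (real m + 1)} \<times> UNIV)) =
        (\<lambda>z. Z (d m (fst (snd z))) (fst z)) -` B \<inter> space predictable" (is "?A = ?B")
    proof (intro set_eqI iffI)
      fix z assume "z \<in> ?A"
      then obtain l \<omega> u v where z: "z = (\<omega>, u, v)" "\<omega> \<in> space M" "Z (real l / (real m + 1)) \<omega> \<in> B"
        "real l / (real m + 1) < u" "u \<le> (real l + 1) / (real m + 1)"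
        by auto
      have "0 < u"
        using z(4) by (rule le_less_trans[rotated]) simp
      then have "k m u = l"
        using k_iff z by blast
      with z \<open>0 < u\<close> show "z \<in> ?B"
        by (auto simp: d_def space_predictable)
    next
      fix z assume "z \<in> ?B"
      then obtain \<omega> u v where z: "z = (\<omega>, u, v)" "\<omega> \<in> space M" "0 < u" "Z (d m u) \<omega> \<in> B"
        by (auto simp: space_predictable)
      with k_iff[OF z(3), of m "k m u"] show "z \<in> ?A"
        by (auto simp: d_def)
    qed
    finally show "(\<lambda>z. Z (d m (fst (snd z))) (fst z)) -` B \<inter> space predictable \<in> sets predictable" .
  qed
  fix z assume "z \<in> space predictable"
  then obtain \<omega> u v where z: "z = (\<omega>, u, v)" "\<omega> \<in> space M" "0 < u"
    by (auto simp: space_predictable)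
  have "(\<lambda>m. d m u) \<longlonglongrightarrow> u"
  proof (rule tendsto_sandwich)
    show "(\<lambda>m. u - 1 / (real m + 1)) \<longlonglongrightarrow> u" by real_asymp
    show "\<forall>\<^sub>F m in sequentially. u - 1 / (real m + 1) \<le> d m u"
      using d(3)[OF z(3)] by simp
    show "\<forall>\<^sub>F m in sequentially. d m u \<le> u"
      using d(2)[OF z(3)] by (auto intro!: always_eventually less_imp_le)
  qed simp
  then have "filterlim (\<lambda>m. d m u) (at_left u) sequentially"
    using d(2)[OF z(3)] by (auto simp: filterlim_at intro!: always_eventually less_imp_neq)
  from filterlim_compose[OF lim[OF z(2,3)] this]
  show "(\<lambda>m. Z (d m (fst (snd z))) (fst z)) \<longlonglongrightarrow> L (fst (snd z)) (fst z)"
    by (simp add: z)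
qed

end

section \<open>The integral equation of the survival function\<close>

text \<open>Over \<open>m + 1\<close> equal steps the increments add up to at most
  \<open>K * c\<^sup>2 / (m + 1)\<close>, which tends to 0.\<close>

lemma quadratic_increments_imp_const:
  fixes f :: "real \<Rightarrow> real"
  assumes c: "0 \<le> c" and inc: "\<And>s t. 0 \<le> s \<Longrightarrow> s \<le> t \<Longrightarrow> t \<le> c \<Longrightarrow> \<bar>f t - f s\<bar> \<le> K * (t - s)\<^sup>2"
  shows "f c = f 0"
proof -
  have bound: "\<bar>f c - f 0\<bar> \<le> K * c\<^sup>2 / (real m + 1)" for m
  proof -
    define d where "d = c / (real m + 1)"
    have d: "0 \<le> d" "(real m + 1) * d = c"
      using c by (simp_all add: d_def)
    have "\<bar>f (real l * d) - f 0\<bar> \<le> real l * (K * d\<^sup>2)" if "l \<le> Suc m" for l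
      using that
    proof (induction l)
      case (Suc l)
      have "real (Suc l) * d \<le> c"
        using mult_right_mono[OF _ d(1), of "real (Suc l)" "real m + 1"] Suc.prems d(2) by simp
      then have "\<bar>f (real (Suc l) * d) - f (real l * d)\<bar> \<le> K * (real (Suc l) * d - real l * d)\<^sup>2"
        using d by (intro inc) (auto intro: mult_right_mono)
      also have "real (Suc l) * d - real l * d = d"
        by (simp add: distrib_right)
      finally show ?case
        using Suc by (simp add: distrib_right abs_le_iff)
    qed simp
    from this[of "Suc m"] have "\<bar>f c - f 0\<bar> \<le> (real m + 1) * (K * d\<^sup>2)"
      using d(2) by (simp add: add.commute)
    also have "(real m + 1) * (K * d\<^sup>2) = K * c\<^sup>2 / (real m + 1)"
      by (simp add: d_def power2_eq_square)
    finally show ?thesis .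
  qed
  have "(\<lambda>m. K * c\<^sup>2 / (real m + 1)) \<longlonglongrightarrow> 0"
    by real_asymp
  with bound have "\<bar>f c - f 0\<bar> \<le> 0"
    by (intro LIMSEQ_le_const) auto
  then show ?thesis by simp
qed

text \<open>The rate \<open>r\<close> is merely measurable, so that \<open>G\<close> need not be differentiable.  But
  \<open>G t * exp (\<integral>r)\<close> has quadratically small increments.\<close>

lemma survival_eq_exp:
  fixes r G :: "real \<Rightarrow> real"
  assumes r_meas: "(\<lambda>s. indicator {0..} s * r s) \<in> borel_measurable borel"
    and G_meas: "G \<in> borel_measurable borel"
    and r_bound: "AE s in lborel. 0 \<le> s \<longrightarrow> 0 \<le> r s \<and> r s \<le> K"
    and G_nonneg: "\<And>s. 0 \<le> G s" and G_anti: "\<And>s t. s \<le> t \<Longrightarrow> G t \<le> G s"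
    and eq: "\<And>t. 0 \<le> t \<Longrightarrow> G t + (LINT s:{0..t}|lborel. r s * G s) = p"
    and K: "0 \<le> K" and c: "0 \<le> c"
  shows "G c = p * exp (- (LINT s:{0..c}|lborel. r s))"
proof -
  define \<gamma> where "\<gamma> t = (LINT s:{0..t}|lborel. r s)" for t
  have int: "set_integrable lborel A k"
    if k: "(\<lambda>s. indicator {0..} s * k s) \<in> borel_measurable borel" "AE s in lborel. 0 \<le> s \<longrightarrow> \<bar>k s\<bar> \<le> b"
      and A: "A \<in> sets borel" "A \<subseteq> {0..t}" for k :: "real \<Rightarrow> real" and A b t
    unfolding set_integrable_def
  proof (rule Bochner_Integration.integrable_bound)
    show "integrable lborel (\<lambda>s. indicator {0..t} s *\<^sub>R b)"
      by (intro integrable_scaleR_left integrable_real_indicator) (auto simp: emeasure_lborel_Icc_eq)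
    have "(\<lambda>s. indicator A s *\<^sub>R k s) = (\<lambda>s. indicator A s * (indicator {0..} s * k s))"
      using A(2) by (auto simp: fun_eq_iff indicator_def)
    then show "(\<lambda>s. indicator A s *\<^sub>R k s) \<in> borel_measurable lborel"
      using k(1) A(1) by simp
    show "AE s in lborel. norm (indicator A s *\<^sub>R k s) \<le> norm (indicator {0..t} s *\<^sub>R b)"
      using k(2) by eventually_elim (use A(2) in \<open>force simp: indicator_def\<close>)
  qed
  have int_r: "set_integrable lborel A r" and int_rG: "set_integrable lborel A (\<lambda>s. r s * G s)"
    if A: "A \<in> sets borel" "A \<subseteq> {0..t}" for A t
  proof -
    show "set_integrable lborel A r"
      by (rule int[OF r_meas _ A, of K], use r_bound in eventually_elim) auto
    have "(\<lambda>s. (indicator {0..} s * r s) * G s) \<in> borel_measurable borel"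
      using r_meas G_meas by measurable
    then have "(\<lambda>s. indicator {0..} s * (r s * G s)) \<in> borel_measurable borel"
      by (simp add: mult.assoc)
    then show "set_integrable lborel A (\<lambda>s. r s * G s)"
    proof (rule int[OF _ _ A])
      show "AE s in lborel. 0 \<le> s \<longrightarrow> \<bar>r s * G s\<bar> \<le> K * G 0"
        using r_bound
      proof eventually_elim
        case (elim s)
        then show ?case
          using G_nonneg[of s] G_anti[of 0 s] by (auto simp: abs_mult intro!: mult_mono)
      qed
    qed
  qed
  have split: "(LINT s:{0..t}|lborel. k s) = (LINT s:{0..s0}|lborel. k s) + (LINT s:{s0<..t}|lborel. k s)"
    if "0 \<le> s0" "s0 \<le> t" "\<And>A. A \<in> sets borel \<Longrightarrow> A \<subseteq> {0..t} \<Longrightarrow> set_integrable lborel A k"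
    for s0 t and k :: "real \<Rightarrow> real"
  proof -
    have "{0..t} = {0..s0} \<union> {s0<..t}" using that by auto
    then show ?thesis
      using that by (simp only:) (intro set_integral_Un that(3); auto)
  qed
  \<comment> \<open>Since \<open>G\<close> decreases, its loss over \<open>(s, t]\<close> lies
    between \<open>G t\<close> and \<open>G s\<close> times the increase of the cumulative rate, and
    the bounded rate makes that increase at most linear in \<open>t - s\<close>.\<close>
  have incr: "0 \<le> \<gamma> t - \<gamma> s" "\<gamma> t - \<gamma> s \<le> K * (t - s)"
      "G t * (\<gamma> t - \<gamma> s) \<le> G s - G t" "G s - G t \<le> G s * (\<gamma> t - \<gamma> s)"
    if st: "0 \<le> s" "s \<le> t" for s t
  proof -
    have A: "{s<..t} \<in> sets borel" "{s<..t} \<subseteq> {0..t}"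
      using st by auto
    have \<gamma>: "\<gamma> t - \<gamma> s = (LINT u:{s<..t}|lborel. r u)"
      unfolding \<gamma>_def using split[OF st, of r] int_r[of _ t] by auto
    have g: "G s - G t = (LINT u:{s<..t}|lborel. r u * G u)"
      using split[OF st, of "\<lambda>s. r s * G s"] int_rG[of _ t] eq[of s] eq[of t] st by auto
    have AE: "AE u in lborel. u \<in> {s<..t} \<longrightarrow> 0 \<le> r u \<and> r u \<le> K \<and> G t * r u \<le> r u * G u \<and> r u * G u \<le> G s * r u"
      using r_bound
    proof eventually_elim
      case (elim u)
      then show ?case
        using st G_anti[of u t] G_anti[of s u] by (auto simp: mult.commute[of "r u"] intro!: mult_right_mono)
    qed
    have const: "set_integrable lborel {s<..t} (\<lambda>_. a :: real)" for a
      unfolding set_integrable_def using st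
      by (intro integrable_scaleR_left integrable_real_indicator) auto
    note ir = int_r[OF A] and irG = int_rG[OF A]
    have "0 \<le> (LINT u:{s<..t}|lborel. r u)"
      unfolding set_lebesgue_integral_def using AE
      by (intro integral_nonneg_AE, eventually_elim) (auto split: split_indicator)
    then show "0 \<le> \<gamma> t - \<gamma> s" by (simp add: \<gamma>)
    have "(LINT u:{s<..t}|lborel. r u) \<le> (LINT u:{s<..t}|lborel. K)"
      using AE by (intro set_integral_mono_AE ir const) auto
    also have "\<dots> = K * (t - s)"
      using st by (simp add: set_integral_const)
    finally show "\<gamma> t - \<gamma> s \<le> K * (t - s)" by (simp add: \<gamma>)
    have "(LINT u:{s<..t}|lborel. G t * r u) \<le> (LINT u:{s<..t}|lborel. r u * G u)"
      using AE by (intro set_integral_mono_AE irG set_integrable_mult_right ir) auto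
    then show "G t * (\<gamma> t - \<gamma> s) \<le> G s - G t" by (simp add: \<gamma> g)
    have "(LINT u:{s<..t}|lborel. r u * G u) \<le> (LINT u:{s<..t}|lborel. G s * r u)"
      using AE by (intro set_integral_mono_AE irG set_integrable_mult_right ir) auto
    then show "G s - G t \<le> G s * (\<gamma> t - \<gamma> s)" by (simp add: \<gamma> g)
  qed
  have \<gamma>0: "\<gamma> 0 = 0"
    unfolding \<gamma>_def set_lebesgue_integral_def
    by (intro integral_eq_zero_AE, use AE_lborel_singleton[of 0] in eventually_elim) auto
  have G0: "G 0 = p"
  proof -
    have "(LINT s:{0..0::real}|lborel. r s * G s) = 0"
      unfolding set_lebesgue_integral_def
      by (intro integral_eq_zero_AE, use AE_lborel_singleton[of 0] in eventually_elim) auto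
    with eq[of 0] show ?thesis by simp
  qed
  define \<psi> where "\<psi> t = G t * exp (\<gamma> t)" for t
  have "\<psi> c = \<psi> 0"
  proof (rule quadratic_increments_imp_const[OF c])
    fix s t :: real assume st: "0 \<le> s" "s \<le> t" "t \<le> c"
    define \<delta> where "\<delta> = \<gamma> t - \<gamma> s"
    have \<delta>: "0 \<le> \<delta>" "\<delta> \<le> K * (t - s)" "G t * \<delta> \<le> G s - G t" "G s - G t \<le> G s * \<delta>"
      using incr[OF st(1,2)] by (auto simp: \<delta>_def)
    have exp_\<delta>: "\<delta> \<le> exp \<delta> - 1" "exp \<delta> - 1 \<le> \<delta> * exp \<delta>"
    proof -
      show "\<delta> \<le> exp \<delta> - 1" using exp_ge_add_one_self[of \<delta>] by linarith
      have "(1 - \<delta>) * exp \<delta> \<le> exp (- \<delta>) * exp \<delta>"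
        by (rule mult_right_mono) (use exp_ge_add_one_self[of "- \<delta>"] in linarith, simp)
      also have "\<dots> = 1" by (simp add: exp_minus)
      finally show "exp \<delta> - 1 \<le> \<delta> * exp \<delta>" by (simp add: algebra_simps)
    qed
    have G_le: "G s \<le> p" "G t \<le> p"
      using G_anti[of 0 s] G_anti[of 0 t] st G0 by auto
    have diff: "\<psi> t - \<psi> s = exp (\<gamma> s) * (G t * (exp \<delta> - 1) - (G s - G t))"
      by (simp add: \<psi>_def \<delta>_def exp_diff field_simps)
    \<comment> \<open>The first-order terms cancel. From above, the loss is at least
      \<open>G t * \<delta>\<close>, which leaves \<open>exp \<delta> - 1 - \<delta>\<close>; from
      below, the error is at most \<open>(G s - G t) * \<delta>\<close>, again of second
      order.\<close>
    have "\<bar>G t * (exp \<delta> - 1) - (G s - G t)\<bar> \<le> p * (\<delta>\<^sup>2 * exp \<delta>)"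
    proof (rule abs_leI)
      have "G t * (exp \<delta> - 1) - (G s - G t) \<le> G t * (exp \<delta> - 1 - \<delta>)"
        using \<delta>(3) by (simp add: algebra_simps)
      also have "exp \<delta> - 1 - \<delta> \<le> \<delta>\<^sup>2 * exp \<delta>"
      proof -
        have "exp \<delta> - 1 - \<delta> \<le> \<delta> * (exp \<delta> - 1)"
          using exp_\<delta>(2) by (simp add: algebra_simps)
        also have "\<dots> \<le> \<delta> * (\<delta> * exp \<delta>)"
          using exp_\<delta>(2) \<delta>(1) by (rule mult_left_mono)
        finally show ?thesis by (simp add: power2_eq_square)
      qed
      then have "G t * (exp \<delta> - 1 - \<delta>) \<le> p * (\<delta>\<^sup>2 * exp \<delta>)"
        using G_le G_nonneg[of t] exp_\<delta>(1) by (intro mult_mono) auto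
      finally show "G t * (exp \<delta> - 1) - (G s - G t) \<le> p * (\<delta>\<^sup>2 * exp \<delta>)" .
      have "- (G t * (exp \<delta> - 1) - (G s - G t)) \<le> G s * \<delta> - G t * \<delta>"
        using \<delta>(4) mult_left_mono[OF exp_\<delta>(1) G_nonneg[of t]] by linarith
      also have "\<dots> = (G s - G t) * \<delta>" by (simp add: left_diff_distrib)
      also have "\<dots> \<le> G s * \<delta> * \<delta>" using \<delta> by (intro mult_right_mono) auto
      also have "\<dots> = G s * (\<delta>\<^sup>2 * 1)" by (simp add: power2_eq_square)
      also have "\<dots> \<le> p * (\<delta>\<^sup>2 * exp \<delta>)"
        using G_le G_nonneg[of s] \<delta>(1) by (intro mult_mono) auto
      finally show "- (G t * (exp \<delta> - 1) - (G s - G t)) \<le> p * (\<delta>\<^sup>2 * exp \<delta>)" .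
    qed
    then have "\<bar>\<psi> t - \<psi> s\<bar> \<le> exp (\<gamma> s) * (p * (\<delta>\<^sup>2 * exp \<delta>))"
      unfolding diff abs_mult by (intro mult_mono) auto
    also have "\<dots> = exp (\<gamma> t) * p * \<delta>\<^sup>2"
      by (simp add: \<delta>_def exp_diff)
    also have "\<dots> \<le> exp (K * c) * p * (K * (t - s))\<^sup>2"
    proof (intro mult_mono power_mono)
      have "\<gamma> t \<le> K * t" using incr(2)[of 0 t] \<gamma>0 st by simp
      also have "\<dots> \<le> K * c" using st K by (intro mult_left_mono) auto
      finally show "exp (\<gamma> t) \<le> exp (K * c)" by simp
    qed (use \<delta> G_le G_nonneg[of s] in auto)
    finally show "\<bar>\<psi> t - \<psi> s\<bar> \<le> (exp (K * c) * p * K\<^sup>2) * (t - s)\<^sup>2"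
      by (simp add: power_mult_distrib mult.assoc)
  qed
  then show ?thesis
    unfolding \<psi>_def using \<gamma>0 G0 by (simp add: \<gamma>_def exp_minus field_simps)
qed

section \<open>The transition probabilities\<close>

locale semi_markov_solution =
  thinning_rates lam lamt prec + filtered_poisson M F P
  for lam lamt :: "nat \<Rightarrow> nat \<Rightarrow> real \<Rightarrow> nat \<Rightarrow> real" and prec :: "(nat \<times> nat) set"
    and M :: "'w measure" and F :: "real \<Rightarrow> 'w measure" and P :: "'w \<Rightarrow> (real \<times> real) measure" +
  fixes X0 :: "'w \<Rightarrow> nat" and Y0 :: "'w \<Rightarrow> real"
    and X :: "real \<Rightarrow> 'w \<Rightarrow> nat" and Y :: "real \<Rightarrow> 'w \<Rightarrow> real" and N :: "real \<Rightarrow> 'w \<Rightarrow> nat"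
  assumes solution: "strong_solution M F P (h_Lam prec lam lamt) (g_Lam prec lam lamt) X0 Y0 X Y N"
begin

lemma adapted:
  assumes "0 \<le> t"
  shows "X t \<in> F t \<rightarrow>\<^sub>M count_space UNIV" "Y t \<in> borel_measurable (F t)" "N t \<in> F t \<rightarrow>\<^sub>M count_space UNIV"
  using solution assms unfolding strong_solution_def by blast+

lemma state_space: "\<omega> \<in> space M \<Longrightarrow> 0 \<le> t \<Longrightarrow> X t \<omega> \<in> states" "\<omega> \<in> space M \<Longrightarrow> 0 \<le> t \<Longrightarrow> 0 \<le> Y t \<omega>"
  using solution unfolding strong_solution_def by blast+

lemma rcll_paths:
  assumes "\<omega> \<in> space M"
  shows "rcll (\<lambda>t. X t \<omega>)" "rcll (\<lambda>t. Y t \<omega>)" "rcll (\<lambda>t. N t \<omega>)"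
  using solution assms unfolding strong_solution_def by blast+

text \<open>The outcomes to which the pathwise results apply. It is an event by completeness, having
  an almost sure description.\<close>

definition regular :: "'w set" where
  "regular = {\<omega> \<in> space M. thinning_path lam lamt prec (P \<omega>) (X0 \<omega>) (Y0 \<omega>)
     (\<lambda>t. X t \<omega>) (\<lambda>t. Y t \<omega>) (\<lambda>t. N t \<omega>)}"

lemma AE_regular: "AE \<omega> in M. \<omega> \<in> regular"
proof -
  have "AE \<omega> in M. solves_system (h_Lam prec lam lamt) (g_Lam prec lam lamt) (P \<omega>) (X0 \<omega>) (Y0 \<omega>)
      (\<lambda>t. X t \<omega>) (\<lambda>t. Y t \<omega>) (\<lambda>t. N t \<omega>)"
    using solution unfolding strong_solution_def by blast
  with AE_P_simple AE_space show ?thesis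
  proof eventually_elim
    case (elim \<omega>)
    have "thinning_path lam lamt prec (P \<omega>) (X0 \<omega>) (Y0 \<omega>) (\<lambda>t. X t \<omega>) (\<lambda>t. Y t \<omega>) (\<lambda>t. N t \<omega>)"
    proof unfold_locales
      show "sets (P \<omega>) = sets half_plane" using elim(2) by (rule sets_P)
      show "emeasure (P \<omega>) A \<in> range of_nat \<union> {\<infinity>}" if "A \<in> sets half_plane" for A
        using elim(2) that by (rule P_integer)
    qed (use elim rcll_paths state_space in auto)
    with elim show ?case by (simp add: regular_def)
  qed
qed

lemma regular_event [measurable]: "regular \<in> events"
proof (rule in_sets_AE)
  show "AE \<omega> in M. \<omega> \<in> space M \<longleftrightarrow> \<omega> \<in> regular"
    using AE_regular AE_space by eventually_elim simp
qed (auto simp: regular_def)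

lemma regular_path:
  "\<omega> \<in> regular \<Longrightarrow> thinning_path lam lamt prec (P \<omega>) (X0 \<omega>) (Y0 \<omega>)
     (\<lambda>t. X t \<omega>) (\<lambda>t. Y t \<omega>) (\<lambda>t. N t \<omega>)"
  by (simp add: regular_def)

abbreviation "T k \<omega> \<equiv> jump_time (\<lambda>t. X t \<omega>) k"

text \<open>On \<open>regular\<close>, \<open>T k \<le> t\<close> means that the counter at time
  \<open>t\<close> is at least \<open>k\<close>. Elsewhere the infimum over uncountably many times
  has no such description, so it is replaced by 0.\<close>

lemma jump_time_measurable: "(\<lambda>\<omega>. if \<omega> \<in> regular then T k \<omega> else 0) \<in> borel_measurable M"
proof (rule borel_measurableI_le)
  fix a :: ereal
  let ?S = "{\<omega> \<in> space M. (if \<omega> \<in> regular then T k \<omega> else 0) \<le> a}"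
  show "?S \<in> events"
  proof (cases "0 \<le> a")
    case False
    have "0 \<le> (if \<omega> \<in> regular then T k \<omega> else 0)" for \<omega>
      by (simp add: thinning_path.jump_time_nonneg[OF regular_path])
    then have "\<not> (if \<omega> \<in> regular then T k \<omega> else 0) \<le> a" for \<omega>
      using False order_trans by blast
    then have S: "?S = {}"
      by blast
    show ?thesis unfolding S by simp
  next
    case True
    then consider t where "a = ereal t" "0 \<le> t" | "a = \<infinity>"
      by (cases a) auto
    then show ?thesis
    proof cases
      case 1
      have "N t -` {k..} \<inter> space M \<in> events"
        using measurable_sets[OF adapted(3)[OF 1(2)], of "{k..}"] subalgebra_F[OF 1(2)]
        by (auto simp: subalgebra_def)
      then have "(space M - regular) \<union> (regular \<inter> (N t -` {k..} \<inter> space M)) \<in> events"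
        by auto
      also have "(space M - regular) \<union> (regular \<inter> (N t -` {k..} \<inter> space M)) = ?S"
        using thinning_path.jump_time_le_iff[OF regular_path, OF _ 1(2)] 1
        by (auto simp: regular_def)
      finally show ?thesis .
    next
      case 2
      then show ?thesis by simp
    qed
  qed
qed

definition triggers :: "nat \<Rightarrow> nat \<Rightarrow> nat \<Rightarrow> real \<Rightarrow> ('w \<times> real \<times> real) set" where
  "triggers k i j c = {z \<in> space predictable.
     snd z \<in> triggering_atoms prec lam lamt (\<lambda>t. X t (fst z)) (\<lambda>t. Y t (fst z)) (\<lambda>t. N t (fst z)) k i j c}"

text \<open>Every condition is on the mark or on left limits of adapted processes; the
  integer-valued ones are read in the reals to fit \<open>left_limit_predictable\<close>.\<close>

lemma triggers_predictable:
  assumes ij: "(i, j) \<in> state_pairs"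
  shows "triggers k i j c \<in> sets predictable"
proof -
  have [measurable]: "(\<lambda>z. real (left_lim (\<lambda>t. X t (fst z)) (fst (snd z)))) \<in> borel_measurable predictable"
    by (rule left_limit_predictable[where Z="\<lambda>t \<omega>. real (X t \<omega>)" and L="\<lambda>u \<omega>. real (left_lim (\<lambda>t. X t \<omega>) u)"])
       (auto intro!: tendsto_real_of_nat rcll_left_lim rcll_paths measurable_compose[OF adapted(1)])
  have [measurable]: "(\<lambda>z. real (left_lim (\<lambda>t. N t (fst z)) (fst (snd z)))) \<in> borel_measurable predictable"
    by (rule left_limit_predictable[where Z="\<lambda>t \<omega>. real (N t \<omega>)" and L="\<lambda>u \<omega>. real (left_lim (\<lambda>t. N t \<omega>) u)"])
       (auto intro!: tendsto_real_of_nat rcll_left_lim rcll_paths measurable_compose[OF adapted(3)])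
  have Y [measurable]: "(\<lambda>z. left_lim (\<lambda>t. Y t (fst z)) (fst (snd z))) \<in> borel_measurable predictable"
    by (rule left_limit_predictable[where Z=Y and L="\<lambda>u \<omega>. left_lim (\<lambda>t. Y t \<omega>) u"])
       (auto intro!: rcll_left_lim rcll_paths adapted)
  have [measurable]: "Measurable.pred predictable
      (\<lambda>z. snd (snd z) \<in> L i j (left_lim (\<lambda>t. Y t (fst z)) (fst (snd z))) k)"
  proof (rule pred_in_Lam[OF ij Y mark_borel_measurable])
    fix z assume "z \<in> space predictable"
    then show "0 \<le> left_lim (\<lambda>t. Y t (fst z)) (fst (snd z))"
      by (intro rcll_left_lim_nonneg rcll_paths state_space) (auto simp: space_predictable)
  qed
  have "triggers k i j c = {z \<in> space predictable.
     real (left_lim (\<lambda>t. X t (fst z)) (fst (snd z))) = real i \<and>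
     real (left_lim (\<lambda>t. N t (fst z)) (fst (snd z))) = real k \<and>
     left_lim (\<lambda>t. Y t (fst z)) (fst (snd z)) \<le> c \<and>
     snd (snd z) \<in> L i j (left_lim (\<lambda>t. Y t (fst z)) (fst (snd z))) k}"
    by (auto simp: triggers_def triggering_atoms_def space_predictable)
  also have "\<dots> \<in> sets predictable"
    by measurable
  finally show ?thesis .
qed

lemma triggers_section:
  assumes "\<omega> \<in> space M"
  shows "Pair \<omega> -` triggers k i j c = triggering_atoms prec lam lamt (\<lambda>t. X t \<omega>) (\<lambda>t. Y t \<omega>) (\<lambda>t. N t \<omega>) k i j c"
  using assms by (auto simp: triggers_def space_predictable triggering_atoms_def)

definition in_state :: "nat \<Rightarrow> nat \<Rightarrow> 'w set" where
  "in_state k i = {\<omega> \<in> space M. jumps_to (\<lambda>t. X t \<omega>) k i}"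

definition transition :: "nat \<Rightarrow> nat \<Rightarrow> nat \<Rightarrow> real \<Rightarrow> 'w set" where
  "transition k i j c = {\<omega> \<in> space M. jumps_to (\<lambda>t. X t \<omega>) k i \<and>
     jumps_to (\<lambda>t. X t \<omega>) (Suc k) j \<and> T (Suc k) \<omega> - T k \<omega> \<le> ereal c}"

text \<open>Restricted to \<open>regular\<close>, where the jump times are measurable, unlike
  \<open>in_state\<close> and \<open>transition\<close>, which have to match the events in
  \<open>renewal_kernel\<close> exactly.\<close>

definition surviving :: "nat \<Rightarrow> nat \<Rightarrow> real \<Rightarrow> 'w set" where
  "surviving k i s = {\<omega> \<in> regular. jumps_to (\<lambda>t. X t \<omega>) k i \<and> ereal s < T (Suc k) \<omega> - T k \<omega>}"

context
  fixes k i :: nat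
  assumes k: "1 \<le> k" and in_state_event [measurable]: "in_state k i \<in> events"
begin

lemma P_triggers:
  assumes "\<omega> \<in> regular" "(i, j) \<in> state_pairs"
  shows "emeasure (P \<omega>) (Pair \<omega> -` triggers k i j c) = indicator (transition k i j c) \<omega>"
    and "emeasure lborel (Pair \<omega> -` triggers k i j c) =
      (\<integral>\<^sup>+s. indicator (surviving k i s) \<omega> * (indicator {0..c} s * ennreal (lam i j s k)) \<partial>lborel)"
proof -
  interpret path: thinning_path lam lamt prec "P \<omega>" "X0 \<omega>" "Y0 \<omega>" "\<lambda>t. X t \<omega>" "\<lambda>t. Y t \<omega>" "\<lambda>t. N t \<omega>"
    using assms by (intro regular_path)
  have \<omega>: "\<omega> \<in> space M"
    using assms by (simp add: regular_def)
  have S: "path.trigger_set k i j c \<in> sets half_plane"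
    using predictable_section(1)[OF triggers_predictable[OF assms(2)], of \<omega> k c] triggers_section[OF \<omega>] by simp
  show "emeasure (P \<omega>) (Pair \<omega> -` triggers k i j c) = indicator (transition k i j c) \<omega>"
    unfolding triggers_section[OF \<omega>] path.trigger_mass[OF k assms(2) S]
    using \<omega> by (simp add: transition_def indicator_def)
  show "emeasure lborel (Pair \<omega> -` triggers k i j c) =
      (\<integral>\<^sup>+s. indicator (surviving k i s) \<omega> * (indicator {0..c} s * ennreal (lam i j s k)) \<partial>lborel)"
    unfolding triggers_section[OF \<omega>] path.trigger_area[OF k assms(2) S]
    using assms(1) by (auto simp: surviving_def indicator_def intro!: nn_integral_cong)
qed

text \<open>Up to a null set this is the event that the triggering set has mass 1, and the
  compensation formula includes the measurability of that mass.\<close>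

lemma transition_event:
  assumes ij: "(i, j) \<in> state_pairs"
  shows "transition k i j c \<in> events"
proof (rule in_sets_AE)
  note [measurable] = compensation_formula(1)[OF triggers_predictable[OF ij]]
  show "{\<omega> \<in> space M. emeasure (P \<omega>) (Pair \<omega> -` triggers k i j c) = 1} \<in> events"
    by measurable
  show "AE \<omega> in M. \<omega> \<in> {\<omega> \<in> space M. emeasure (P \<omega>) (Pair \<omega> -` triggers k i j c) = 1} \<longleftrightarrow>
      \<omega> \<in> transition k i j c"
    using AE_regular AE_space
    by eventually_elim (use P_triggers(1)[OF _ ij] in \<open>auto split: split_indicator\<close>)
qed (auto simp: transition_def)

text \<open>Joint measurability in outcome and age, as required for exchanging expectation and the
  integral over ages.\<close>

lemma surviving_measurable:
  "(\<lambda>z. indicator (surviving k i (snd z)) (fst z) :: ennreal) \<in> borel_measurable (M \<Otimes>\<^sub>M lborel)"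
proof -
  note [measurable] = jump_time_measurable
  let ?T = "\<lambda>k \<omega>. if \<omega> \<in> regular then T k \<omega> else 0"
  have "{z \<in> space (M \<Otimes>\<^sub>M lborel). fst z \<in> regular \<and> fst z \<in> in_state k i \<and>
      ereal (snd z) < ?T (Suc k) (fst z) - ?T k (fst z)} \<in> sets (M \<Otimes>\<^sub>M (lborel :: real measure))"
    by measurable
  also have "{z \<in> space (M \<Otimes>\<^sub>M lborel). fst z \<in> regular \<and> fst z \<in> in_state k i \<and>
      ereal (snd z) < ?T (Suc k) (fst z) - ?T k (fst z)} =
      {z \<in> space (M \<Otimes>\<^sub>M lborel). fst z \<in> surviving k i (snd z)}"
    by (auto simp: surviving_def in_state_def regular_def space_pair_measure)
  finally have "(\<lambda>z. indicator {z \<in> space (M \<Otimes>\<^sub>M lborel). fst z \<in> surviving k i (snd z)} z :: ennreal)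
      \<in> borel_measurable (M \<Otimes>\<^sub>M lborel)"
    by (rule borel_measurable_indicator)
  then show ?thesis
    by (rule measurable_cong[THEN iffD1, rotated]) (auto simp: indicator_def)
qed

lemma surviving_event: "surviving k i s \<in> events"
proof -
  have "(\<lambda>\<omega>. indicator (surviving k i s) \<omega> :: ennreal) \<in> borel_measurable M"
    using measurable_compose[OF _ surviving_measurable, of "\<lambda>\<omega>. (\<omega>, s)" M] by simp
  then have "surviving k i s \<inter> space M \<in> events"
    by (simp add: borel_measurable_indicator_iff)
  also have "surviving k i s \<inter> space M = surviving k i s"
    by (auto simp: surviving_def regular_def)
  finally show ?thesis .
qed

lemma lam_borel:
  assumes ij: "(i, j) \<in> state_pairs"
  shows "(\<lambda>s. indicator {0..c} s * ennreal (lam i j s k)) \<in> borel_measurable borel"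
proof -
  have "(\<lambda>s. indicator {0..} s * lam i j s k) \<in> borel_measurable borel"
    using rate_measurable_section[OF lam_measurable[OF ij], of k]
    by (simp add: borel_measurable_restrict_space_iff)
  then have "(\<lambda>s. indicator {0..c} s * ennreal (indicator {0..} s * lam i j s k)) \<in> borel_measurable borel"
    by measurable
  then show ?thesis
    by (rule measurable_cong[THEN iffD1, rotated]) (auto simp: indicator_def)
qed

lemma transition_emeasure:
  assumes ij: "(i, j) \<in> state_pairs"
  shows "emeasure M (transition k i j c) =
    (\<integral>\<^sup>+s. (indicator {0..c} s * ennreal (lam i j s k)) * emeasure M (surviving k i s) \<partial>lborel)"
proof -
  have meas: "(\<lambda>z. indicator (surviving k i (snd z)) (fst z) * (indicator {0..c} (snd z) * ennreal (lam i j (snd z) k)))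
      \<in> borel_measurable (M \<Otimes>\<^sub>M lborel)"
  proof (rule borel_measurable_times_ennreal[OF surviving_measurable])
    show "(\<lambda>z. indicator {0..c} (snd z) * ennreal (lam i j (snd z) k)) \<in> borel_measurable (M \<Otimes>\<^sub>M lborel)"
      by (rule measurable_compose[OF measurable_snd, of "\<lambda>s. indicator {0..c} s * ennreal (lam i j s k)"])
         (use lam_borel[OF ij] in simp)
  qed
  interpret pair_sigma_finite M "lborel :: real measure" ..
  have "emeasure M (transition k i j c) = (\<integral>\<^sup>+\<omega>. indicator (transition k i j c) \<omega> \<partial>M)"
    using transition_event[OF ij] by simp
  also have "\<dots> = (\<integral>\<^sup>+\<omega>. emeasure (P \<omega>) (Pair \<omega> -` triggers k i j c) \<partial>M)"
    by (intro nn_integral_cong_AE, use AE_regular in eventually_elim) (simp add: P_triggers(1)[OF _ ij])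
  also have "\<dots> = (\<integral>\<^sup>+\<omega>. emeasure lborel (Pair \<omega> -` triggers k i j c) \<partial>M)"
    by (rule compensation_formula(2)[OF triggers_predictable[OF ij]])
  also have "\<dots> = (\<integral>\<^sup>+\<omega>. \<integral>\<^sup>+s. indicator (surviving k i s) \<omega> * (indicator {0..c} s * ennreal (lam i j s k)) \<partial>lborel \<partial>M)"
    by (intro nn_integral_cong_AE, use AE_regular in eventually_elim) (simp add: P_triggers(2)[OF _ ij])
  also have "\<dots> = (\<integral>\<^sup>+s. \<integral>\<^sup>+\<omega>. indicator (surviving k i s) \<omega> * (indicator {0..c} s * ennreal (lam i j s k)) \<partial>M \<partial>lborel)"
    using Fubini[of "\<lambda>z. indicator (surviving k i (snd z)) (fst z) * (indicator {0..c} (snd z) * ennreal (lam i j (snd z) k))"] meas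
    by simp
  also have "\<dots> = (\<integral>\<^sup>+s. (indicator {0..c} s * ennreal (lam i j s k)) * emeasure M (surviving k i s) \<partial>lborel)"
    using surviving_event
    by (intro nn_integral_cong) (subst mult.commute, simp only: nn_integral_cmult_indicator)
  finally show ?thesis .
qed

lemma surviving_antimono: "s \<le> t \<Longrightarrow> surviving k i t \<subseteq> surviving k i s"
  by (auto simp: surviving_def) (meson ereal_less_eq(3) le_less_trans)

lemma surviving_prob_antimono: "s \<le> t \<Longrightarrow> prob (surviving k i t) \<le> prob (surviving k i s)"
  by (intro finite_measure_mono surviving_antimono surviving_event)

lemma surviving_prob_borel [measurable]: "(\<lambda>s. prob (surviving k i s)) \<in> borel_measurable borel"
proof -
  have "(\<lambda>s. - prob (surviving k i s)) \<in> borel_measurable borel"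
    using surviving_prob_antimono by (intro borel_measurable_mono monoI) simp
  then have "(\<lambda>s. - (- prob (surviving k i s))) \<in> borel_measurable borel"
    by (rule borel_measurable_uminus)
  then show ?thesis by simp
qed

section \<open>The survival equation and its solution\<close>

lemma exit_rate_borel:
  assumes i: "i \<in> states"
  shows "(\<lambda>s. indicator {0..} s * exit_rate lam i s k) \<in> borel_measurable borel"
proof -
  have "(\<lambda>s. enn2real (\<Sum>\<^sub>\<infinity>j\<in>states - {i}. ennreal (lam i j s k))) \<in> borel_measurable (restrict_space borel {0..})"
  proof (intro borel_measurable_enn2real borel_measurable_infsum_ennreal)
    fix j assume "j \<in> states - {i}"
    with i have "(i, j) \<in> state_pairs" by (auto simp: state_pairs_def)
    from rate_measurable_section[OF lam_measurable[OF this], of k]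
    show "(\<lambda>s. ennreal (lam i j s k)) \<in> borel_measurable (restrict_space borel {0..})" by simp
  qed auto
  then have "(\<lambda>s. indicator {0..} s * enn2real (\<Sum>\<^sub>\<infinity>j\<in>states - {i}. ennreal (lam i j s k))) \<in> borel_measurable borel"
    by (simp add: borel_measurable_restrict_space_iff)
  then show ?thesis
    by (rule measurable_cong[THEN iffD1, rotated]) (auto simp: indicator_def exit_rate_eq[OF i])
qed

lemma AE_exit_rate:
  assumes i: "i \<in> states"
  shows "AE s in lborel. 0 \<le> s \<longrightarrow>
    (\<Sum>\<^sub>\<infinity>j\<in>states - {i}. ennreal (lam i j s k)) = ennreal (exit_rate lam i s k) \<and>
    0 \<le> exit_rate lam i s k \<and> exit_rate lam i s k \<le> enn2real (rate_bound lam i)"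
  using AE_exit_finite[OF i, of k]
proof eventually_elim
  case (elim s)
  show ?case
  proof
    assume s: "0 \<le> s"
    with elim rate_bound_finite[OF i] have "(\<Sum>\<^sub>\<infinity>j\<in>states - {i}. ennreal (lam i j s k)) < \<infinity>"
      by (auto intro: le_less_trans)
    then show "(\<Sum>\<^sub>\<infinity>j\<in>states - {i}. ennreal (lam i j s k)) = ennreal (exit_rate lam i s k) \<and>
      0 \<le> exit_rate lam i s k \<and> exit_rate lam i s k \<le> enn2real (rate_bound lam i)"
      using s elim rate_bound_finite[OF i] exit_rate_eq[OF i s] by (simp add: enn2real_mono)
  qed
qed

text \<open>Either the holding time exceeds \<open>c\<close>, or the next jump time is finite and
  \<open>next_state\<close> supplies a target different from \<open>i\<close>; different targets
  exclude each other.\<close>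

lemma in_state_decomposition:
  assumes i: "i \<in> states"
  shows "emeasure M (in_state k i) = emeasure M (surviving k i c) +
    (\<Sum>j. emeasure M (if j \<in> states - {i} then transition k i j c else {}))"
proof -
  \<comment> \<open>Padding with the empty set indexes the targets by all natural numbers, as
    countable additivity is stated.\<close>
  let ?J = "\<lambda>j. if j \<in> states - {i} then transition k i j c else {}"
  have pair: "(i, j) \<in> state_pairs" if "j \<in> states - {i}" for j
    using i that by (auto simp: state_pairs_def)
  have J: "range ?J \<subseteq> events"
    using transition_event[OF pair] by auto
  have "disjoint_family ?J"
    by (auto simp: disjoint_family_on_def transition_def jumps_to_def split: if_splits)
  then have sum: "(\<Sum>j. emeasure M (?J j)) = emeasure M (\<Union>j. ?J j)"
    using J by (intro suminf_emeasure)
  have "surviving k i c \<inter> (\<Union>j. ?J j) = {}"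
    by (auto simp: surviving_def transition_def split: if_splits)
  then have "emeasure M (surviving k i c) + emeasure M (\<Union>j. ?J j) = emeasure M (surviving k i c \<union> (\<Union>j. ?J j))"
    using J surviving_event by (intro plus_emeasure) auto
  also have "\<dots> = emeasure M (in_state k i)"
  proof (rule emeasure_eq_AE)
    show "AE \<omega> in M. \<omega> \<in> surviving k i c \<union> (\<Union>j. ?J j) \<longleftrightarrow> \<omega> \<in> in_state k i"
      using AE_regular
    proof eventually_elim
      case (elim \<omega>)
      interpret path: thinning_path lam lamt prec "P \<omega>" "X0 \<omega>" "Y0 \<omega>" "\<lambda>t. X t \<omega>" "\<lambda>t. Y t \<omega>" "\<lambda>t. N t \<omega>"
        using elim by (rule regular_path)
      have \<omega>: "\<omega> \<in> space M"
        using elim by (simp add: regular_def)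
      show ?case
      proof
        assume "\<omega> \<in> surviving k i c \<union> (\<Union>j. ?J j)"
        then show "\<omega> \<in> in_state k i"
          using \<omega> by (auto simp: surviving_def transition_def in_state_def split: if_splits)
      next
        assume st: "\<omega> \<in> in_state k i"
        show "\<omega> \<in> surviving k i c \<union> (\<Union>j. ?J j)"
        proof (cases "ereal c < T (Suc k) \<omega> - T k \<omega>")
          case True
          then show ?thesis
            using st elim by (auto simp: surviving_def in_state_def)
        next
          case False
          have "T k \<omega> < \<infinity>" "0 \<le> T k \<omega>"
            using st path.jump_time_nonneg[of k] by (auto simp: in_state_def jumps_to_def)
          then have "T (Suc k) \<omega> < \<infinity>"
            using False by (cases "T (Suc k) \<omega>"; cases "T k \<omega>") auto
          then obtain j where "j \<in> states - {i}" "jumps_to (\<lambda>t. X t \<omega>) (Suc k) j"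
            using path.next_state[OF k] st by (auto simp: in_state_def)
          then have "\<omega> \<in> ?J j"
            using st False \<omega> by (auto simp: transition_def in_state_def not_less)
          then show ?thesis by blast
        qed
      qed
    qed
  qed (use J surviving_event in auto)
  finally show ?thesis
    unfolding sum by simp
qed

lemma survival_integral_equation:
  assumes i: "i \<in> states" and c: "0 \<le> c"
  shows "measure M (surviving k i c) + (LINT s:{0..c}|lborel. exit_rate lam i s k * measure M (surviving k i s))
    = measure M (in_state k i)"
proof -
  define G where "G s = measure M (surviving k i s)" for s
  let ?f = "\<lambda>j s. if j \<in> states - {i} then ennreal (lam i j s k) else 0"
  have pair: "(i, j) \<in> state_pairs" if "j \<in> states - {i}" for j
    using i that by (auto simp: state_pairs_def)
  have G_meas [measurable]: "G \<in> borel_measurable borel"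
    unfolding G_def by (rule surviving_prob_borel)
  have "(\<Sum>j. emeasure M (if j \<in> states - {i} then transition k i j c else {})) =
      (\<Sum>j. \<integral>\<^sup>+s. indicator {0..c} s * ?f j s * ennreal (G s) \<partial>lborel)"
    using transition_emeasure[OF pair] by (intro suminf_cong) (auto simp: emeasure_eq_measure G_def)
  also have "\<dots> = (\<integral>\<^sup>+s. (\<Sum>j. indicator {0..c} s * ?f j s * ennreal (G s)) \<partial>lborel)"
  proof (rule nn_integral_suminf[symmetric])
    fix j
    show "(\<lambda>s. indicator {0..c} s * ?f j s * ennreal (G s)) \<in> borel_measurable lborel"
      using lam_borel[OF pair, of j c] by (cases "j \<in> states - {i}") auto
  qed
  also have "\<dots> = (\<integral>\<^sup>+s. ennreal (indicator {0..c} s *\<^sub>R (exit_rate lam i s k * G s)) \<partial>lborel)"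
  proof (rule nn_integral_cong_AE)
    \<comment> \<open>Only almost everywhere: where the rates out of \<open>i\<close> have a
      divergent sum, \<open>exit_rate\<close> takes the default value 0.\<close>
    show "AE s in lborel. (\<Sum>j. indicator {0..c} s * ?f j s * ennreal (G s)) =
        ennreal (indicator {0..c} s *\<^sub>R (exit_rate lam i s k * G s))"
      using AE_exit_rate[OF i]
    proof eventually_elim
      case (elim s)
      show ?case
      proof (cases "s \<in> {0..c}")
        case True
        have "(\<Sum>j. indicator {0..c} s * ?f j s * ennreal (G s)) = (\<Sum>j. ?f j s) * ennreal (G s)"
          using True by simp
        also have "(\<Sum>j. ?f j s) = ennreal (exit_rate lam i s k)"
          unfolding infsum_ennreal_eq_suminf[symmetric] using elim True by simp
        finally show ?thesis
          using True elim by (simp add: ennreal_mult G_def)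
      qed simp
    qed
  qed
  finally have sum: "(\<Sum>j. emeasure M (if j \<in> states - {i} then transition k i j c else {})) =
      (\<integral>\<^sup>+s. ennreal (indicator {0..c} s *\<^sub>R (exit_rate lam i s k * G s)) \<partial>lborel)" .
  have "(LINT s:{0..c}|lborel. exit_rate lam i s k * G s) =
      enn2real (\<integral>\<^sup>+s. ennreal (indicator {0..c} s *\<^sub>R (exit_rate lam i s k * G s)) \<partial>lborel)"
    unfolding set_lebesgue_integral_def
  proof (rule integral_eq_nn_integral)
    have "(\<lambda>s. indicator {0..c} s * (indicator {0..} s * exit_rate lam i s k) * G s) \<in> borel_measurable borel"
      using exit_rate_borel[OF i] by measurable
    also have "(\<lambda>s. indicator {0..c} s * (indicator {0..} s * exit_rate lam i s k) * G s) =
        (\<lambda>s. indicator {0..c} s *\<^sub>R (exit_rate lam i s k * G s))"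
      by (auto simp: fun_eq_iff indicator_def)
    finally show "(\<lambda>s. indicator {0..c} s *\<^sub>R (exit_rate lam i s k * G s)) \<in> borel_measurable lborel"
      by simp
    show "AE s in lborel. 0 \<le> indicator {0..c} s *\<^sub>R (exit_rate lam i s k * G s)"
      using AE_exit_rate[OF i] by eventually_elim (auto simp: G_def split: split_indicator)
  qed
  moreover have "ennreal (measure M (in_state k i)) = ennreal (G c) +
      (\<integral>\<^sup>+s. ennreal (indicator {0..c} s *\<^sub>R (exit_rate lam i s k * G s)) \<partial>lborel)"
    using in_state_decomposition[OF i, of c] unfolding sum by (simp add: emeasure_eq_measure G_def)
  ultimately show ?thesis
    unfolding G_def[symmetric]
    by (cases "\<integral>\<^sup>+s. ennreal (indicator {0..c} s *\<^sub>R (exit_rate lam i s k * G s)) \<partial>lborel")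
       (auto simp: G_def ennreal_plus[symmetric] simp del: ennreal_plus)
qed

lemma surviving_prob:
  assumes i: "i \<in> states" and c: "0 \<le> c"
  shows "measure M (surviving k i c) = measure M (in_state k i) * exp (- cum_rate lam i c k)"
  unfolding cum_rate_def
proof (rule survival_eq_exp[OF exit_rate_borel[OF i] _ _ _ _ survival_integral_equation[OF i] _ c])
  show "(\<lambda>s. measure M (surviving k i s)) \<in> borel_measurable borel"
    by (rule surviving_prob_borel)
  show "AE s in lborel. 0 \<le> s \<longrightarrow> 0 \<le> exit_rate lam i s k \<and> exit_rate lam i s k \<le> enn2real (rate_bound lam i)"
    using AE_exit_rate[OF i] by eventually_elim auto
  show "measure M (surviving k i t) \<le> measure M (surviving k i s)" if "s \<le> t" for s t
    using that by (rule surviving_prob_antimono)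
qed auto

lemma transition_prob:
  assumes ij: "(i, j) \<in> state_pairs"
  shows "measure M (transition k i j c) =
    measure M (in_state k i) * (LINT s:{0..c}|lborel. exp (- cum_rate lam i s k) * lam i j s k)"
proof -
  let ?p = "measure M (in_state k i)"
  have i: "i \<in> states"
    using ij by (auto simp: state_pairs_def)
  have eq: "indicator {0..c} s * ennreal (lam i j s k) * emeasure M (surviving k i s) =
      ennreal (indicator {0..c} s *\<^sub>R (?p * (exp (- cum_rate lam i s k) * lam i j s k)))" for s
    using surviving_prob[OF i, of s] lam_nonneg[OF ij, of s k]
    by (auto simp: indicator_def emeasure_eq_measure ennreal_mult[symmetric] mult_ac)
  have "?p * (LINT s:{0..c}|lborel. exp (- cum_rate lam i s k) * lam i j s k) =
      (LINT s:{0..c}|lborel. ?p * (exp (- cum_rate lam i s k) * lam i j s k))"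
    by (rule set_integral_mult_right[symmetric])
  also have "\<dots> = enn2real (\<integral>\<^sup>+s. ennreal (indicator {0..c} s *\<^sub>R (?p * (exp (- cum_rate lam i s k) * lam i j s k))) \<partial>lborel)"
    unfolding set_lebesgue_integral_def
  proof (rule integral_eq_nn_integral)
    \<comment> \<open>Through \<open>eq\<close> the measurability of the exponential factor is
      inherited from the survival probability, which is monotone in \<open>s\<close>.\<close>
    have "(\<lambda>s. indicator {0..c} s * ennreal (lam i j s k) * emeasure M (surviving k i s)) \<in> borel_measurable lborel"
    proof (rule borel_measurable_times_ennreal)
      show "(\<lambda>s. emeasure M (surviving k i s)) \<in> borel_measurable lborel"
        by (simp add: emeasure_eq_measure)
      show "(\<lambda>s. indicator {0..c} s * ennreal (lam i j s k)) \<in> borel_measurable lborel"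
        using lam_borel[OF ij, of c] by simp
    qed
    then have "(\<lambda>s. enn2real (ennreal (indicator {0..c} s *\<^sub>R (?p * (exp (- cum_rate lam i s k) * lam i j s k)))))
        \<in> borel_measurable lborel"
      unfolding eq by (rule borel_measurable_enn2real)
    then show "(\<lambda>s. indicator {0..c} s *\<^sub>R (?p * (exp (- cum_rate lam i s k) * lam i j s k))) \<in> borel_measurable lborel"
      by (rule measurable_cong[THEN iffD1, rotated])
         (use lam_nonneg[OF ij] in \<open>auto simp: indicator_def\<close>)
    show "AE s in lborel. 0 \<le> indicator {0..c} s *\<^sub>R (?p * (exp (- cum_rate lam i s k) * lam i j s k))"
      using lam_nonneg[OF ij] by (intro AE_I2) (auto simp: indicator_def)
  qed
  also have "\<dots> = enn2real (emeasure M (transition k i j c))"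
    unfolding transition_emeasure[OF ij] eq ..
  also have "\<dots> = measure M (transition k i j c)"
    by (simp add: measure_def)
  finally show ?thesis by simp
qed

end

end

theorem theorem3p5:
  fixes M :: "'w measure" and F :: "real \<Rightarrow> 'w measure"
    and P :: "'w \<Rightarrow> (real \<times> real) measure"
    and lam lamt :: "nat \<Rightarrow> nat \<Rightarrow> real \<Rightarrow> nat \<Rightarrow> real"
    and prec :: "(nat \<times> nat) set"
    and X0 :: "'w \<Rightarrow> nat" and Y0 :: "'w \<Rightarrow> real"
    and X :: "real \<Rightarrow> 'w \<Rightarrow> nat" and Y :: "real \<Rightarrow> 'w \<Rightarrow> real" and N :: "real \<Rightarrow> 'w \<Rightarrow> nat"
    and y :: real and n i j :: nat
  assumes "usual_hypotheses M F"
    and "poisson_random_measure M half_plane P"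
    and "prm_adapted F P"
    and "prm_future_indep M F P"
    and "\<And>k l. (k, l) \<in> state_pairs \<Longrightarrow> rate_measurable (lam k l) \<and> rate_bounded (lam k l)"
    and "assumption_A1 lam"
    and "assumption_A2 lam"
    and "strict_linear_order_on states prec"
    and "order_summable lam prec"
    and "\<And>k l. (k, l) \<in> state_pairs \<Longrightarrow> rate_measurable (lamt k l)"
    and "\<And>k l s m. (k, l) \<in> state_pairs \<Longrightarrow> 0 \<le> s \<Longrightarrow> lam k l s m \<le> lamt k l s m"
    and "\<And>k l. (k, l) \<in> state_pairs \<Longrightarrow>
           (AE s in lborel. 0 \<le> s \<longrightarrow> (\<forall>m. ennreal (lamt k l s m) \<le> Linf_norm (lam k l)))"
    and "X0 \<in> F 0 \<rightarrow>\<^sub>M count_space UNIV" and "\<And>\<omega>. \<omega> \<in> space M \<Longrightarrow> X0 \<omega> \<in> states"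
    and "Y0 \<in> borel_measurable (F 0)" and "\<And>\<omega>. \<omega> \<in> space M \<Longrightarrow> 0 \<le> Y0 \<omega>"
    and "strong_solution M F P (h_Lam prec lam lamt) (g_Lam prec lam lamt) X0 Y0 X Y N"
    and "0 < y" and "1 \<le> n" and "(i, j) \<in> state_pairs"
    and "\<P>(\<omega> in M. jumps_to (\<lambda>t. X t \<omega>) n i) > 0"
  shows "renewal_kernel M X i j y n =
         (LINT s:{0..y}|lborel. exp (- cum_rate lam i s n) * lam i j s n)"
proof -
  have prob: "prob_space M"
    using assms(1) by (simp add: usual_hypotheses_def)
  interpret prob_space M by (rule prob)
  interpret semi_markov_solution lam lamt prec M F P X0 Y0 X Y N
    by unfold_locales (use assms in auto)
  \<comment> \<open>\<open>measure\<close> is 0 outside the sigma-algebra, so positive probability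
    of the conditioning set forces it to be an event.\<close>
  have "in_state n i \<in> events"
    using assms(21) measure_notin_sets[of "in_state n i" M] by (auto simp: in_state_def)
  with transition_prob[OF \<open>1 \<le> n\<close> this \<open>(i, j) \<in> state_pairs\<close>, of y] assms(21)
  show ?thesis
    unfolding renewal_kernel_def cond_prob_def in_state_def transition_def
    by (simp add: conj_ac)
qed

end
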